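(* Let $Z=(X,Y)\in\Omega$ satisfy $X_i(\mathbf 0)Y_i(\mathbf 0)>0$ and $X_j(\mathbf 0)Y_j(\mathbf 0)<0$ for some $i,j\in\{1,2\}$ with $i\neq j$, and $X_1(\mathbf 0)X_2(\mathbf 0)>0$. Then $Z$ is locally $\Sigma$-equivalent at the origin to $$\tilde Z(p)=\begin{cases}\tilde X(p)=(a,a), & p\in\mathcal U^+,\\ \tilde Y(p)=(b,-b), & p\in\mathcal U^-,\end{cases}$$ where $a=\operatorname{sgn}(X_1(\mathbf 0))$ and $b=\operatorname{sgn}(Y_1(\mathbf 0))$.
   Context: Setting. Fix $r\ge 1$ and a bounded open neighborhood $\mathcal U$ of the origin $\mathbf 0$ in $\mathbb R^2$. Let $\Sigma=\{(x_1,x_2)\in\mathcal U: x_1x_2=0\}$, $\mathcal U^+=\{x_1x_2>0\}$, $\mathcal U^-=\{x_1x_2<0\}$. Write $\Sigma=\Sigma_1\cup\Sigma_2$ with $\Sigma_1=\{x_1=0\}$, $\Sigma_2=\{x_2=0\}$; $\Sigma_1^{\pm}=\{(0,x_2):\pm x_2>0\}$ and $\Sigma_2^{\pm}=\{(x_1,0):\pm x_1>0\}$. $\Omega$ is the set of piecewise smooth vector fields $Z=(X,Y)$, where $X=(X_1,X_2)$, $Y=(Y_1,Y_2)$ are $C^r$ vector fields on $\overline{\mathcal U}$, with $Z=X$ on $\mathcal U^+$ and $Z=Y$ on $\mathcal U^-$. Regions of $\Sigma$. For $i=1,2$: crossing region $\Sigma_i^c=\{p\in\Sigma_i: X_iY_i(p)>0\}$;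 sliding region $\Sigma_i^s=\{p\in\Sigma_i^+:X_i(p)<0,Y_i(p)>0\}\cup\{p\in\Sigma_i^-:X_i(p)>0,Y_i(p)<0\}$; escaping region $\Sigma_i^e=\{p\in\Sigma_i^+:X_i(p)>0,Y_i(p)<0\}\cup\{p\in\Sigma_i^-:X_i(p)<0,Y_i(p)>0\}$. $\Sigma^{c},\Sigma^s,\Sigma^e$ are the unions over $i=1,2$. On $\Sigma_i^{s}\cup\Sigma_i^e$ the sliding vector field is the one-dimensional vector field $Z_i^s=\dfrac{Y_iX_j-X_iY_j}{Y_i-X_i}\Big|_{\Sigma_i}$, $j\neq i$. Trajectories of $Z$. For $p\neq\mathbf 0$: if $p\in\mathcal U^{+}$ (resp. $\mathcal U^-$) follow the trajectory of $X$ (resp. $Y$), where trajectories meeting $\Sigma^s\cup\Sigma^e$ transversally are regarded as relatively open (they do not reach $\Sigma^s\cup\Sigma^e$ in finite time); if $p\in\Sigma^c$ concatenate the trajectories of $X$ and $Y$ through $p$; if $p\in\Sigma_i^s\cup\Sigma_i^e$ follow the trajectory of $Z_i^s$; if $p\in\partial\Sigma_i^e\cup\partial\Sigma_i^s\cup\partial\Sigma_i^c$ and the one-sided limits $\lim_{q\to p^\pm}\varphi_Z(t;q)$ along $\Sigma_i$ coincide, the trajectory is this limit; for other such boundary points it is $\{p\}$. For $\mathbf 0$: if $\Sigma=\overline{\Sigma^c}$, it is the unique trajectory of $X$ or $Y$ that crosses the origin; if $\mathbf 0\in\overline{\Sigma_i^e\cup\Sigma_i^s}\cap\overline{\Sigma_j^c}$,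 $i\ne j$, it is the trajectory of $Z_i^s$; if $\mathbf 0\in\bigcap_{i=1,2}\overline{\Sigma_i^e\cup\Sigma_i^s}$, it is $\{\mathbf 0\}$. Equivalence. $Z,\tilde Z\in\Omega$ are locally $\Sigma$-equivalent if there are neighborhoods $\mathcal U_0,\tilde{\mathcal U}_0$ of the origin and an orientation preserving homeomorphism $h:\mathcal U_0\to\tilde{\mathcal U}_0$ mapping trajectories of $Z$ to trajectories of $\tilde Z$ and $\Sigma$ to $\Sigma$. *)

theory Defs
  imports "HOL-Analysis.Analysis" "HOL-Complex_Analysis.Winding_Numbers"
begin

section \<open>Piecewise smooth vector fields with switching set $x_1 x_2 = 0$\<close>

text \<open>
  Coordinates are indexed by the two-element type \<open>2\<close>.  A piecewise smooth field is a pair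
  \<open>(X, Y)\<close> of total functions on the plane; only the values on the domain matter.  The domain
  \<open>W\<close> is a parameter of all notions below, so that the same definitions apply to a field
  restricted to a smaller neighbourhood of the origin.
\<close>

type_synonym vfield = "real^2 \<Rightarrow> real^2"

fun Cr_on_open :: "nat \<Rightarrow> (real^2) set \<Rightarrow> vfield \<Rightarrow> bool" where
  "Cr_on_open 0 S f \<longleftrightarrow> continuous_on S f"
| "Cr_on_open (Suc k) S f \<longleftrightarrow>
     (\<forall>x\<in>S. f differentiable (at x)) \<and>
     (\<forall>v. Cr_on_open k S (\<lambda>x. frechet_derivative f (at x) v))"

text \<open>On a set that is not open, \<open>C\<^sup>r\<close> means: restriction of a \<open>C\<^sup>r\<close> map on an open superset.\<close>

definition Cr_on :: "nat \<Rightarrow> (real^2) set \<Rightarrow> vfield \<Rightarrow> bool" where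
  "Cr_on r S f \<longleftrightarrow>
     (\<exists>V F. open V \<and> S \<subseteq> V \<and> Cr_on_open r V F \<and> (\<forall>x\<in>S. F x = f x))"

definition Omega :: "nat \<Rightarrow> (real^2) set \<Rightarrow> (vfield \<times> vfield) set" where
  "Omega r U = {(X, Y). Cr_on r (closure U) X \<and> Cr_on r (closure U) Y}"

definition Uplus :: "(real^2) set \<Rightarrow> (real^2) set" where
  "Uplus W = {p \<in> W. p $ 1 * p $ 2 > 0}"

definition Uminus :: "(real^2) set \<Rightarrow> (real^2) set" where
  "Uminus W = {p \<in> W. p $ 1 * p $ 2 < 0}"

definition Sig :: "(real^2) set \<Rightarrow> (real^2) set" where
  "Sig W = {p \<in> W. p $ 1 * p $ 2 = 0}"

definition Sig_i :: "(real^2) set \<Rightarrow> 2 \<Rightarrow> (real^2) set" where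
  "Sig_i W i = {p \<in> W. p $ i = 0}"

definition other :: "2 \<Rightarrow> 2" where
  "other i = (if i = 1 then 2 else 1)"

subsection \<open>Crossing, sliding and escaping regions\<close>

definition crossing :: "(real^2) set \<Rightarrow> vfield \<Rightarrow> vfield \<Rightarrow> 2 \<Rightarrow> (real^2) set" where
  "crossing W X Y i = {p \<in> Sig_i W i. X p $ i * Y p $ i > 0}"

definition sliding :: "(real^2) set \<Rightarrow> vfield \<Rightarrow> vfield \<Rightarrow> 2 \<Rightarrow> (real^2) set" where
  "sliding W X Y i =
     {p \<in> Sig_i W i. p $ other i > 0 \<and> X p $ i < 0 \<and> Y p $ i > 0} \<union>
     {p \<in> Sig_i W i. p $ other i < 0 \<and> X p $ i > 0 \<and> Y p $ i < 0}"

definition escaping :: "(real^2) set \<Rightarrow> vfield \<Rightarrow> vfield \<Rightarrow> 2 \<Rightarrow> (real^2) set" where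
  "escaping W X Y i =
     {p \<in> Sig_i W i. p $ other i > 0 \<and> X p $ i > 0 \<and> Y p $ i < 0} \<union>
     {p \<in> Sig_i W i. p $ other i < 0 \<and> X p $ i < 0 \<and> Y p $ i > 0}"

definition slide_esc :: "(real^2) set \<Rightarrow> vfield \<Rightarrow> vfield \<Rightarrow> 2 \<Rightarrow> (real^2) set" where
  "slide_esc W X Y i = sliding W X Y i \<union> escaping W X Y i"

text \<open>
  The one-dimensional sliding field on \<open>Sig_i W i\<close>, as a plane vector along that axis.  It is used
  on \<open>slide_esc W X Y i\<close>, where the denominator does not vanish, and at the origin when the
  trajectory of the origin is a sliding one.
\<close>

definition slide_field :: "vfield \<Rightarrow> vfield \<Rightarrow> 2 \<Rightarrow> vfield" where
  "slide_field X Y i p =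
     (let j = other i in
      axis j ((Y p $ i * X p $ j - X p $ i * Y p $ j) / (Y p $ i - X p $ i)))"


section \<open>Trajectories\<close>

text \<open>
  A trajectory is a curve \<open>\<gamma>\<close> on a nonempty time interval \<open>J\<close> that obeys a local rule at each
  time \<open>t \<in> J\<close> and cannot be extended.  The rule depends on the position of \<open>\<gamma> t\<close>.

  \<open>regular_rule\<close> covers the open quadrants and the crossing, sliding and escaping regions.  At a
  crossing point (other than the origin) the curve changes from one field to the other.  At a
  sliding or escaping point it has to stay on the axis for all nearby times; hence a trajectory
  of \<open>X\<close> or \<open>Y\<close> that tends to such a point in finite forward or backward time does not contain
  it (it is relatively open).
\<close>

definition regular_rule ::
  "(real^2) set \<Rightarrow> vfield \<Rightarrow> vfield \<Rightarrow> real set \<Rightarrow> (real \<Rightarrow> real^2) \<Rightarrow> real \<Rightarrow> bool" where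
  "regular_rule W X Y J \<gamma> t \<longleftrightarrow>
     (\<gamma> t \<in> Uplus W \<and> (\<gamma> has_vector_derivative X (\<gamma> t)) (at t within J)) \<or>
     (\<gamma> t \<in> Uminus W \<and> (\<gamma> has_vector_derivative Y (\<gamma> t)) (at t within J)) \<or>
     (\<gamma> t \<in> (\<Union>i. crossing W X Y i) - {0} \<and>
        (((\<forall>\<^sub>F s in at t within J \<inter> {..<t}. \<gamma> s \<in> Uplus W) \<and>
          (\<forall>\<^sub>F s in at t within J \<inter> {t<..}. \<gamma> s \<in> Uminus W)) \<or>
         ((\<forall>\<^sub>F s in at t within J \<inter> {..<t}. \<gamma> s \<in> Uminus W) \<and>
          (\<forall>\<^sub>F s in at t within J \<inter> {t<..}. \<gamma> s \<in> Uplus W)))) \<or>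
     (\<exists>i. \<gamma> t \<in> slide_esc W X Y i \<and>
        (\<forall>\<^sub>F s in at t within J. \<gamma> s \<in> slide_esc W X Y i) \<and>
        (\<gamma> has_vector_derivative slide_field X Y i (\<gamma> t)) (at t within J))"

text \<open>\<open>regular_flow W X Y t q y\<close>: starting at \<open>q\<close>, the flow is at \<open>y\<close> at time \<open>t\<close>, having met
  only points covered by \<open>regular_rule\<close>.\<close>

definition regular_flow ::
  "(real^2) set \<Rightarrow> vfield \<Rightarrow> vfield \<Rightarrow> real \<Rightarrow> real^2 \<Rightarrow> real^2 \<Rightarrow> bool" where
  "regular_flow W X Y t q y \<longleftrightarrow>
     (\<exists>J \<gamma>. is_interval J \<and> 0 \<in> J \<and> t \<in> J \<and> continuous_on J \<gamma> \<and>
        (\<forall>s\<in>J. regular_rule W X Y J \<gamma> s) \<and> \<gamma> 0 = q \<and> \<gamma> t = y)"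

text \<open>The one-sided limit of the flow at time \<open>u\<close>, as the initial point tends to \<open>p\<close> along
  \<open>Sig_i W i\<close> from the right (\<open>\<sigma> = 1\<close>) or from the left (\<open>\<sigma> = -1\<close>), exists and equals \<open>L\<close>.\<close>

definition flow_limit ::
  "(real^2) set \<Rightarrow> vfield \<Rightarrow> vfield \<Rightarrow> 2 \<Rightarrow> real \<Rightarrow> real^2 \<Rightarrow> real \<Rightarrow> real^2 \<Rightarrow> bool" where
  "flow_limit W X Y i \<sigma> p u L \<longleftrightarrow>
     (\<forall>e>0. \<forall>\<^sub>F q in at p within {q \<in> Sig_i W i. \<sigma> * (q $ other i - p $ other i) > 0}.
        \<exists>y. regular_flow W X Y u q y \<and> dist y L < e)"

text \<open>
  The regular flow from one side of \<open>p\<close> may exist in the limit for nonnegative (or nonpositive)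
  times only, for instance when sliding motion starts (or ends) at \<open>p\<close>.  The one-sided limits
  coincide if they agree at each time at which both exist; the limit trajectory is then given by
  whichever exists.
\<close>

definition limits_coincide ::
  "(real^2) set \<Rightarrow> vfield \<Rightarrow> vfield \<Rightarrow> 2 \<Rightarrow> real^2 \<Rightarrow> bool" where
  "limits_coincide W X Y i p \<longleftrightarrow>
     flow_limit W X Y i 1 p 0 p \<and> flow_limit W X Y i (-1) p 0 p \<and>
     (\<forall>u L L'. flow_limit W X Y i 1 p u L \<and> flow_limit W X Y i (-1) p u L' \<longrightarrow> L = L')"

definition boundary_rule ::
  "(real^2) set \<Rightarrow> vfield \<Rightarrow> vfield \<Rightarrow> real set \<Rightarrow> (real \<Rightarrow> real^2) \<Rightarrow> real \<Rightarrow> bool" where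
  "boundary_rule W X Y J \<gamma> t \<longleftrightarrow>
     (\<exists>i. \<gamma> t \<in> Sig_i W i - {0} - (crossing W X Y i \<union> slide_esc W X Y i) \<and>
        (if limits_coincide W X Y i (\<gamma> t)
         then (\<forall>\<^sub>F s in at t within J.
                 flow_limit W X Y i 1 (\<gamma> t) (s - t) (\<gamma> s) \<or>
                 flow_limit W X Y i (-1) (\<gamma> t) (s - t) (\<gamma> s))
         else J = {t}))"

definition origin_crossing :: "(real^2) set \<Rightarrow> vfield \<Rightarrow> vfield \<Rightarrow> bool" where
  "origin_crossing W X Y \<longleftrightarrow> Sig W = W \<inter> closure (\<Union>i. crossing W X Y i)"

text \<open>The last conjunct settles the degenerate overlap with the case that the origin is in the
  closure of the sliding or escaping regions of both axes: there the origin is stationary.\<close>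

definition origin_sliding :: "(real^2) set \<Rightarrow> vfield \<Rightarrow> vfield \<Rightarrow> 2 \<Rightarrow> bool" where
  "origin_sliding W X Y i \<longleftrightarrow>
     0 \<in> closure (slide_esc W X Y i) \<inter> closure (crossing W X Y (other i)) \<and>
     0 \<notin> closure (slide_esc W X Y (other i))"

definition origin_rule ::
  "(real^2) set \<Rightarrow> vfield \<Rightarrow> vfield \<Rightarrow> real set \<Rightarrow> (real \<Rightarrow> real^2) \<Rightarrow> real \<Rightarrow> bool" where
  "origin_rule W X Y J \<gamma> t \<longleftrightarrow> \<gamma> t = 0 \<and>
     ((origin_crossing W X Y \<and>
         ((\<forall>\<^sub>F s in at t within J. \<gamma> s \<in> Uplus W) \<or>
          (\<forall>\<^sub>F s in at t within J. \<gamma> s \<in> Uminus W))) \<or>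
      (\<exists>i. origin_sliding W X Y i \<and>
         (\<forall>\<^sub>F s in at t within J. \<gamma> s \<in> insert 0 (slide_esc W X Y i)) \<and>
         (\<gamma> has_vector_derivative slide_field X Y i 0) (at t within J)) \<or>
      (\<not> origin_crossing W X Y \<and> (\<forall>i. \<not> origin_sliding W X Y i) \<and> J = {t}))"

definition orbit_curve ::
  "(real^2) set \<Rightarrow> vfield \<Rightarrow> vfield \<Rightarrow> real set \<Rightarrow> (real \<Rightarrow> real^2) \<Rightarrow> bool" where
  "orbit_curve W X Y J \<gamma> \<longleftrightarrow>
     is_interval J \<and> J \<noteq> {} \<and> \<gamma> ` J \<subseteq> W \<and> continuous_on J \<gamma> \<and>
     (\<forall>t\<in>J. regular_rule W X Y J \<gamma> t \<or> boundary_rule W X Y J \<gamma> t \<or> origin_rule W X Y J \<gamma> t)"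

definition trajectory ::
  "(real^2) set \<Rightarrow> vfield \<Rightarrow> vfield \<Rightarrow> real set \<Rightarrow> (real \<Rightarrow> real^2) \<Rightarrow> bool" where
  "trajectory W X Y J \<gamma> \<longleftrightarrow>
     orbit_curve W X Y J \<gamma> \<and>
     (\<forall>J' \<gamma>'. orbit_curve W X Y J' \<gamma>' \<and> J \<subseteq> J' \<and> (\<forall>t\<in>J. \<gamma>' t = \<gamma> t) \<longrightarrow> J' = J)"


section \<open>Local equivalence\<close>

definition plane_to_complex :: "real^2 \<Rightarrow> complex" where
  "plane_to_complex p = Complex (p $ 1) (p $ 2)"

definition complex_to_plane :: "complex \<Rightarrow> real^2" where
  "complex_to_plane z = vector [Re z, Im z]"

text \<open>A homeomorphism \<open>h\<close> of plane domains preserves orientation if it has local degree 1: the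
  image of a positively oriented circle winds once, positively, around the image of its centre.\<close>

definition orientation_preserving_on :: "(real^2) set \<Rightarrow> vfield \<Rightarrow> bool" where
  "orientation_preserving_on W h \<longleftrightarrow>
     (\<forall>p\<in>W. \<forall>\<rho>>0. cball p \<rho> \<subseteq> W \<longrightarrow>
        winding_number
          (plane_to_complex \<circ> h \<circ> complex_to_plane \<circ> circlepath (plane_to_complex p) \<rho>)
          (plane_to_complex (h p)) = 1)"

text \<open>Trajectories are those of the fields restricted to the two neighbourhoods, and are mapped
  to trajectories up to an increasing change of time.\<close>

definition locally_Sigma_equivalent ::
  "(real^2) set \<Rightarrow> vfield \<times> vfield \<Rightarrow> vfield \<times> vfield \<Rightarrow> bool" where
  "locally_Sigma_equivalent U Z Z' \<longleftrightarrow>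
     (\<exists>U\<^sub>0 V\<^sub>0 h g.
        open U\<^sub>0 \<and> 0 \<in> U\<^sub>0 \<and> U\<^sub>0 \<subseteq> U \<and> open V\<^sub>0 \<and> 0 \<in> V\<^sub>0 \<and> V\<^sub>0 \<subseteq> U \<and>
        homeomorphism U\<^sub>0 V\<^sub>0 h g \<and> orientation_preserving_on U\<^sub>0 h \<and>
        h ` Sig U\<^sub>0 = Sig V\<^sub>0 \<and>
        (\<forall>J \<gamma>. trajectory U\<^sub>0 (fst Z) (snd Z) J \<gamma> \<longrightarrow>
           (\<exists>J' \<gamma>' \<tau>. trajectory V\<^sub>0 (fst Z') (snd Z') J' \<gamma>' \<and>
              strict_mono_on J \<tau> \<and> \<tau> ` J = J' \<and> (\<forall>t\<in>J. h (\<gamma> t) = \<gamma>' (\<tau> t)))))"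

end

theory Submission
  imports Defs
begin

text \<open>
  Write \<open>x\<close> for the coordinate \<open>p $ i\<close> and \<open>y\<close> for \<open>p $ j\<close>.  Near the origin all four components
  of \<open>X\<close> and \<open>Y\<close> keep their signs.  Up to the common sign \<open>a\<close>, every motion (that of \<open>X\<close>, of \<open>Y\<close> and
  of the sliding field on the axis \<open>y = 0\<close>) moves in the positive \<open>x\<close>-direction.  The axis \<open>x = 0\<close> is
  crossed, and the axis \<open>y = 0\<close> is sliding on one side of the origin and escaping on the other.
  Therefore every orbit is a graph over the \<open>x\<close>-axis (lemma \<open>orbit_curve_iff\<close>): either a piece of
  the axis \<open>y = 0\<close>, or a graph on which \<open>\<bar>y\<bar>\<close> decreases while \<open>\<bar>x\<bar>\<close> decreases and increases while
  \<open>\<bar>x\<bar>\<close> increases.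

  On each closed quadrant the orbits are thus solutions of a scalar equation
  \<open>d\<bar>y\<bar> / d\<bar>x\<bar> = f \<bar>x\<bar> \<bar>y\<bar>\<close> with \<open>f > 0\<close>.  Following such a solution towards \<open>x = 0\<close>, one leaves the
  quadrant either at a point \<open>(0, c)\<close> with \<open>c \<ge> 0\<close> or at a point \<open>(c, 0)\<close> with \<open>c > 0\<close>.  The orbit gets
  the label \<open>c\<close> in the first case and \<open>- c\<close> in the second.  This label is continuous, increases strictly
  with \<open>\<bar>y\<bar>\<close> and is constant exactly along the orbits.  On \<open>x = 0\<close> the labels of two adjacent quadrants
  agree, so that the label is also constant along an orbit that crosses this axis
  (lemma \<open>orbit_graph_iff_label\<close>).  The orbits that tend to the origin have label \<open>0\<close>; they separate
  the crossing orbits, with positive labels, from those that tend to, or come from, another point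
  of \<open>y = 0\<close>, with negative labels.

  For the constant system the label is \<open>\<bar>y\<bar> - \<bar>x\<bar>\<close>.  Hence the map
  \<open>(x, y) \<mapsto> (x, sgn y * (\<bar>x\<bar> + label (x, y)))\<close> takes orbits to orbits (\<open>straighten\<close>).  It fixes \<open>x\<close> and
  both axes and increases in \<open>y\<close>, so it is injective, hence a homeomorphism onto an open set by
  invariance of domain, and it is linearly homotopic to the identity through such maps, hence
  preserves orientation.

  Since both systems have the same description of orbits as graphs, and a graph can always be
  run through with the correct speed (lemma \<open>orbit_graph_time\<close>), a maximal orbit is carried to a
  maximal orbit: an extension of the image can be pulled back to an extension of the original
  (lemma \<open>trajectory_transfer\<close>).
\<close>

section \<open>Calculus on arbitrary real intervals\<close>

lemma interval_segment_subset:
  fixes J :: "real set"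
  assumes "is_interval J" "s \<in> J" "t \<in> J"
  shows "{s..t} \<subseteq> J"
proof
  fix x assume "x \<in> {s..t}"
  then show "x \<in> J"
    using mem_is_interval_1_I[OF assms, of x] by simp
qed

lemma interval_at_within_interior:
  fixes J :: "real set"
  assumes "is_interval J" "s \<in> J" "t \<in> J" "s < x" "x < t"
  shows "at x within J = at x"
  by (rule at_within_open_subset[where S = "{s<..<t}"])
     (use assms interval_segment_subset[OF assms(1-3)] in \<open>auto simp: less_imp_le\<close>)

text \<open>
  Orbits live on intervals that may be open, closed or half open.  Derivatives are therefore taken
  within the interval throughout; in its interior this makes no difference.
\<close>

lemma interval_mvt:
  fixes u :: "real \<Rightarrow> real"
  assumes J: "is_interval J" "continuous_on J u" "s \<in> J" "t \<in> J" "s < t"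
    and D: "\<And>x. s < x \<Longrightarrow> x < t \<Longrightarrow> (u has_real_derivative D x) (at x within J)"
  obtains x where "s < x" "x < t" "u t - u s = (t - s) * D x"
proof -
  have D': "(u has_real_derivative D x) (at x)" if "s < x" "x < t" for x
    using D[OF that] interval_at_within_interior[OF J(1,3,4) that] by simp
  have "\<exists>l z. s < z \<and> z < t \<and> DERIV u z :> l \<and> u t - u s = (t - s) * l"
  proof (rule MVT)
    show "continuous_on {s..t} u"
      using J(2) interval_segment_subset[OF J(1,3,4)] continuous_on_subset by blast
    show "u differentiable at x" if "s < x" "x < t" for x
      using D'[OF that] real_differentiable_def by blast
  qed (fact J(5))
  then obtain l z where z: "s < z" "z < t" "DERIV u z :> l" "u t - u s = (t - s) * l"
    by blast
  moreover have "l = D z" using DERIV_unique[OF z(3) D'[OF z(1,2)]] .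
  ultimately show thesis using that by blast
qed

lemma interval_increasing_open:
  fixes u :: "real \<Rightarrow> real"
  assumes J: "is_interval J" "continuous_on J u" "s \<in> J" "t \<in> J" "s < t"
    and D: "\<And>x. s < x \<Longrightarrow> x < t \<Longrightarrow> \<exists>d>0. (u has_real_derivative d) (at x within J)"
  shows "u s < u t"
proof -
  obtain D' where D': "\<And>x. s < x \<Longrightarrow> x < t \<Longrightarrow> D' x > 0 \<and> (u has_real_derivative D' x) (at x within J)"
    using D by metis
  obtain x where "s < x" "x < t" "u t - u s = (t - s) * D' x"
    using interval_mvt[OF J, of D'] D' by blast
  with D'[of x] J(5) show ?thesis
    by (metis diff_gt_0_iff_gt mult_pos_pos)
qed

text \<open>One exceptional time is harmless, since the function increases strictly on either side.\<close>

lemma strict_mono_on_interval_except: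
  fixes u :: "real \<Rightarrow> real"
  assumes J: "is_interval J" "continuous_on J u"
    and D: "\<And>x. x \<in> J \<Longrightarrow> x \<noteq> z \<Longrightarrow> \<exists>d>0. (u has_real_derivative d) (at x within J)"
  shows "strict_mono_on J u"
proof (rule strict_mono_onI)
  fix s t assume st: "s \<in> J" "t \<in> J" "s < t"
  note sub = interval_segment_subset[OF J(1) st(1,2)]
  have *: "u p < u q" if pq: "s \<le> p" "p < q" "q \<le> t" "z \<notin> {p<..<q}" for p q
  proof (rule interval_increasing_open[OF J])
    show "p \<in> J" "q \<in> J" using sub pq by auto
    show "\<exists>d>0. (u has_real_derivative d) (at x within J)" if "p < x" "x < q" for x
      using sub pq that by (intro D) auto
  qed (fact pq(2))
  show "u s < u t"
  proof (cases "s < z \<and> z < t")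
    case True
    then have "u s < u z" "u z < u t" by (auto intro!: *)
    then show ?thesis by simp
  next
    case False
    then show ?thesis using st by (intro *) auto
  qed
qed

text \<open>
  A function that increases wherever it is nonzero and has isolated zeros vanishes at most once:
  between two consecutive zeros it would have to increase strictly from \<open>0\<close> to \<open>0\<close>.
\<close>

lemma strict_mono_on_interval_isolated_zeros:
  fixes u :: "real \<Rightarrow> real"
  assumes J: "is_interval J" "continuous_on J u"
    and D: "\<And>x. x \<in> J \<Longrightarrow> u x \<noteq> 0 \<Longrightarrow> \<exists>d>0. (u has_real_derivative d) (at x within J)"
    and iso: "\<And>x. x \<in> J \<Longrightarrow> u x = 0 \<Longrightarrow> \<forall>\<^sub>F s in at x within J. u s \<noteq> 0"
  shows "strict_mono_on J u"
proof -
  have nozero: False if z: "z1 \<in> J" "z2 \<in> J" "z1 < z2" "u z1 = 0" "u z2 = 0" for z1 z2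
  proof -
    note sub = interval_segment_subset[OF J(1) z(1,2)]
    obtain e where e: "e > 0" "\<And>s. s \<in> J \<Longrightarrow> s \<noteq> z1 \<Longrightarrow> dist s z1 < e \<Longrightarrow> u s \<noteq> 0"
      using iso[OF z(1,4)] by (auto simp: eventually_at)
    define m where "m = min (z1 + e/2) z2"
    have m: "z1 < m" "m \<le> z2" 
      using e(1) z by (auto simp: m_def)
    have m0: "u s \<noteq> 0" if "z1 < s" "s < m" for s
      using that sub m e(1) by (intro e(2)) (auto simp: m_def dist_real_def)
    define K where "K = {z \<in> {m..z2}. u z = 0}"
    have "continuous_on {m..z2} u"
      using J(2) sub m by (force intro: continuous_on_subset)
    then have "closed K"
      unfolding K_def using continuous_closed_preimage_constant[of "{m..z2}" u 0] by simp
    moreover have "bounded K"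
      by (rule bounded_subset[of "{m..z2}"]) (auto simp: K_def)
    ultimately have "compact K"
      by (simp add: compact_eq_bounded_closed)
    moreover have "z2 \<in> K" using m z by (auto simp: K_def)
    ultimately obtain q where q: "q \<in> K" "\<And>s. s \<in> K \<Longrightarrow> q \<le> s"
      using compact_attains_inf[of K] by blast
    have "u s \<noteq> 0" if "z1 < s" "s < q" for s
      using q(2)[of s] q(1) that m0[of s] by (force simp: K_def)
    moreover have "q \<in> J" "z1 < q" using q(1) m sub by (auto simp: K_def)
    ultimately have "u z1 < u q"
      using sub q(1) by (intro interval_increasing_open[OF J] D z(1)) (auto simp: K_def)
    with z(4) q(1) show False by (simp add: K_def)
  qed
  show ?thesis
  proof (cases "\<exists>z\<in>J. u z = 0")
    case True
    then obtain z where z: "z \<in> J" "u z = 0" by blast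
    have "u x \<noteq> 0" if "x \<in> J" "x \<noteq> z" for x
      using nozero[of x z] nozero[of z x] that z by (meson linorder_less_linear)
    then show ?thesis
      by (intro strict_mono_on_interval_except[OF J, of z] D)
  next
    case False
    then show ?thesis
      by (intro strict_mono_on_interval_except[OF J, of 0] D) auto
  qed
qed

text \<open>
  The inverse function theorem in one variable, in a form that also covers the end points of
  the interval, where only a one-sided derivative is available.
\<close>

lemma strict_mono_interval_inverse:
  fixes T :: "real \<Rightarrow> real"
  assumes I: "is_interval I" "continuous_on I T" and mono: "strict_mono_on I T"
  defines "R \<equiv> the_inv_into I T"
  shows "is_interval (T ` I)" "continuous_on (T ` I) R" "strict_mono_on (T ` I) R"
    "\<And>s. s \<in> I \<Longrightarrow> R (T s) = s" "\<And>t. t \<in> T ` I \<Longrightarrow> R t \<in> I \<and> T (R t) = t" "R ` T ` I = I"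
    "\<And>s d. s \<in> I \<Longrightarrow> (T has_real_derivative d) (at s within I) \<Longrightarrow> d \<noteq> 0 \<Longrightarrow>
       (R has_real_derivative 1 / d) (at (T s) within T ` I)"
proof -
  have inj: "inj_on T I" using mono by (rule strict_mono_on_imp_inj_on)
  show RT: "R (T s) = s" if "s \<in> I" for s
    using inj that by (simp add: R_def the_inv_into_f_f)
  then show TR: "R t \<in> I \<and> T (R t) = t" if "t \<in> T ` I" for t
    using that by auto
  show img: "R ` T ` I = I" using RT by force
  show TI: "is_interval (T ` I)"
    using I by (simp add: is_interval_connected_1 connected_continuous_image)
  show "continuous_on (T ` I) R"
  proof -
    have "path_connected I" using I(1) by (simp add: is_interval_path_connected)
    then obtain g where g: "homeomorphism I (T ` I) T g"
      using injective_into_1d_eq_homeomorphism[OF I(2)] inj by blast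
    then have "continuous_on (T ` I) g" by (simp add: homeomorphism_def)
    then show ?thesis
      by (rule continuous_on_eq) (use g RT in \<open>auto simp: homeomorphism_def\<close>)
  qed
  show "strict_mono_on (T ` I) R"
  proof (rule strict_mono_onI)
    fix p q assume "p \<in> T ` I" "q \<in> T ` I" "p < q"
    then show "R p < R q"
      using RT mono by (auto simp: strict_mono_on_less)
  qed
  show "(R has_real_derivative 1 / d) (at (T s) within T ` I)"
    if "s \<in> I" "(T has_real_derivative d) (at s within I)" "d \<noteq> 0" for s d
    unfolding has_field_derivative_def
  proof (rule has_derivative_inverse_within)
    show "(T has_derivative (*) d) (at s within I)"
      using that(2) by (simp add: has_field_derivative_def)
    show "continuous (at (T s) within T ` I) R"
      using \<open>continuous_on (T ` I) R\<close> that(1) by (simp add: continuous_on_eq_continuous_within)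
    show "linear ((*) (1 / d))" by (intro bounded_linear.linear bounded_linear_mult_right)
    show "(*) (1 / d) \<circ> (*) d = id" using that(3) by auto
  qed (use that RT in auto)
qed

text \<open>
  The integral from a fixed base point works, but it must be differentiated within the whole
  interval, also at an end point.  So each point is placed in a compact subinterval that contains
  the base point and agrees with the interval near that point.
\<close>

lemma interval_antiderivative:
  fixes v :: "real \<Rightarrow> real"
  assumes I: "is_interval I" and v: "continuous_on I v"
  obtains T where "\<And>s. s \<in> I \<Longrightarrow> (T has_real_derivative v s) (at s within I)"
proof (cases "I = {}")
  case True
  then show thesis using that by simp
next
  case False
  then obtain p where p: "p \<in> I" by blast
  define T where "T x = (if p \<le> x then integral {p..x} v else - integral {x..p} v)" for x
  show thesis
  proof (rule that)
    fix x assume x: "x \<in> I"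
    obtain q where q: "q \<in> I" "q \<le> x" "q \<le> p" "q < x \<or> (\<forall>z\<in>I. x \<le> z)"
    proof (cases "\<exists>z\<in>I. z < x")
      case True
      then obtain z where "z \<in> I" "z < x" by blast
      then show thesis using p by (intro that[of "min z p"]) (auto simp: min_def)
    qed (use x p that in \<open>auto simp: not_less\<close>)
    obtain r where r: "r \<in> I" "x \<le> r" "p \<le> r" "x < r \<or> (\<forall>z\<in>I. z \<le> x)"
    proof (cases "\<exists>z\<in>I. x < z")
      case True
      then obtain z where "z \<in> I" "x < z" by blast
      then show thesis using p by (intro that[of "max z p"]) (auto simp: max_def)
    qed (use x p that in \<open>auto simp: not_less\<close>)
    note sub = interval_segment_subset[OF I q(1) r(1)]
    have v': "continuous_on {q..r} v"
      using v sub by (rule continuous_on_subset)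
    have int: "v integrable_on {c..d}" if "{c..d} \<subseteq> {q..r}" for c d
      using v' that by (intro integrable_continuous_real) (rule continuous_on_subset)
    have T: "T y = integral {q..y} v - integral {q..p} v" if y: "y \<in> {q..r}" for y
    proof (cases "p \<le> y")
      case True
      then show ?thesis
        using Henstock_Kurzweil_Integration.integral_combine[of q p y v] int[of q y] y q(3)
        by (simp add: T_def algebra_simps)
    next
      case False
      then show ?thesis
        using Henstock_Kurzweil_Integration.integral_combine[of q y p v] int[of q p] y r(3)
        by (simp add: T_def algebra_simps)
    qed
    have "((\<lambda>y. integral {q..y} v - integral {q..p} v) has_real_derivative v x - 0)
        (at x within {q..r})"
      using q(2) r(2) by (intro derivative_intros integral_has_real_derivative v') auto
    then have "((\<lambda>y. integral {q..y} v - integral {q..p} v) has_real_derivative v x)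
        (at x within {q..r})" by simp
    then have "(T has_real_derivative v x) (at x within {q..r})"
      by (rule has_field_derivative_transform_within[where d = 1]) (use q(2) r(2) in \<open>auto simp: T\<close>)
    moreover have "at x within {q..r} = at x within I"
    proof (rule at_within_nhd)
      show "x \<in> {if q < x then q else x - 1<..<if x < r then r else x + 1}" by simp
      show "{q..r} \<inter> {if q < x then q else x - 1<..<if x < r then r else x + 1} - {x} =
          I \<inter> {if q < x then q else x - 1<..<if x < r then r else x + 1} - {x}"
        using q r sub by (auto simp: not_less split: if_splits) force+
    qed simp
    ultimately show "(T has_real_derivative v x) (at x within I)" by simp
  qed
qed

lemma eventually_at_within_sides:
  fixes t :: real
  shows "(\<forall>\<^sub>F s in at t within J. P s) \<longleftrightarrow>
    (\<forall>\<^sub>F s in at t within J \<inter> {..<t}. P s) \<and> (\<forall>\<^sub>F s in at t within J \<inter> {t<..}. P s)"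
  unfolding eventually_at_filter eventually_conj_iff[symmetric]
  by (rule arg_cong[where f = "\<lambda>Q. eventually Q (nhds t)"]) (auto simp: neq_iff)

lemma eventually_at_withinI: "(\<And>s. s \<in> J \<Longrightarrow> P s) \<Longrightarrow> \<forall>\<^sub>F s in at t within J. P s"
  by (simp add: eventually_at_filter)

lemma continuous_on_sign_split:
  fixes \<phi> :: "'a::topological_space \<Rightarrow> real"
  assumes \<phi>: "continuous_on UNIV \<phi>"
    and k: "continuous_on (S \<inter> {x. 0 \<le> \<phi> x}) k" "continuous_on (S \<inter> {x. \<phi> x \<le> 0}) k"
  shows "continuous_on S k"
proof -
  have S: "(S \<inter> {x. 0 \<le> \<phi> x}) \<union> (S \<inter> {x. \<phi> x \<le> 0}) = S" by auto
  have "continuous_on ((S \<inter> {x. 0 \<le> \<phi> x}) \<union> (S \<inter> {x. \<phi> x \<le> 0})) k"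
  proof (rule continuous_on_Un_local[OF _ _ k]; unfold S)
    have "closed {x. 0 \<le> \<phi> x}" "closed {x. \<phi> x \<le> 0}"
      using \<phi> by (auto intro!: closed_Collect_le continuous_on_const)
    then show "closedin (top_of_set S) (S \<inter> {x. 0 \<le> \<phi> x})"
      "closedin (top_of_set S) (S \<inter> {x. \<phi> x \<le> 0})"
      by (auto simp: closedin_closed_Int)
  qed
  then show ?thesis by (simp only: S)
qed

lemma constant_on_interval_except:
  fixes u :: "real \<Rightarrow> real"
  assumes J: "is_interval J" "continuous_on J u"
    and D: "\<And>x. x \<in> J \<Longrightarrow> x \<noteq> z \<Longrightarrow> (u has_real_derivative 0) (at x within J)"
    and st: "s \<in> J" "t \<in> J"
  shows "u s = u t"
proof -
  have *: "u p = u q" if pq: "p \<in> J" "q \<in> J" "p < q" "z \<notin> {p<..<q}" for p q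
  proof -
    have "(u has_real_derivative 0) (at x within J)" if x: "p < x" "x < q" for x
      using interval_segment_subset[OF J(1) pq(1,2)] pq(4) x by (intro D) auto
    then show ?thesis
      by (rule interval_mvt[OF J pq(1-3), of "\<lambda>_. 0"]) auto
  qed
  have **: "u p = u q" if pq: "p \<in> J" "q \<in> J" "p < q" for p q
  proof (cases "p < z \<and> z < q")
    case True
    then have "z \<in> J" using interval_segment_subset[OF J(1) pq(1,2)] by auto
    then have "u p = u z" "u z = u q" using True pq by (auto intro!: *)
    then show ?thesis by simp
  next
    case False
    then show ?thesis using pq by (intro *) auto
  qed
  show ?thesis
    by (cases s t rule: linorder_cases) (simp_all add: **[OF st] **[OF st(2,1)])
qed

section \<open>A first integral of a scalar differential equation\<close>

text \<open>
  The equation is not imposed at \<open>0\<close>.  In the application \<open>x = 0\<close> is the axis on which an orbit changes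
  from one field to the other, where its slope may jump.
\<close>

definition solves :: "(real \<Rightarrow> real \<Rightarrow> real) \<Rightarrow> real set \<Rightarrow> (real \<Rightarrow> real) \<Rightarrow> bool" where
  "solves f I y \<longleftrightarrow> continuous_on I y \<and>
     (\<forall>x\<in>I - {0}. (y has_real_derivative f x (y x)) (at x within I))"

lemma solves_subset: "solves f I y \<Longrightarrow> J \<subseteq> I \<Longrightarrow> solves f J y"
  unfolding solves_def by (meson DERIV_subset Diff_mono continuous_on_subset subset_iff order_refl)

text \<open>
  On the interval \<open>{0..d}\<close> the Picard operator is a contraction by the factor \<open>1 / 2\<close>, whatever the initial
  point.  So there is a solution on all of \<open>{0..d}\<close> through every point over this interval, and it can be
  identified by its value at \<open>0\<close>.
\<close>

locale scalar_ode =
  fixes f :: "real \<Rightarrow> real \<Rightarrow> real" and M L d :: real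
  assumes f_cont: "continuous_on UNIV (\<lambda>(x, y). f x y)"
    and f_bound: "\<bar>f x y\<bar> \<le> M"
    and f_lipschitz: "\<bar>f x y - f x z\<bar> \<le> L * \<bar>y - z\<bar>"
    and d_pos: "0 < d" and small: "L * d \<le> 1 / 4"
begin

lemma f_compose_continuous:
  "continuous_on S u \<Longrightarrow> continuous_on S y \<Longrightarrow> continuous_on S (\<lambda>s. f (u s) (y s))"
  using continuous_on_compose2[OF f_cont, of S "\<lambda>s. (u s, y s)"]
  by (auto intro: continuous_on_Pair)

lemma L_nonneg: "0 \<le> L"
  using f_lipschitz[of 0 1 0] by simp

text \<open>
  The Picard operator is written with integrals from \<open>0\<close> only, as \<open>G \<phi> x - G \<phi> x0\<close>, which avoids
  integrals with reversed bounds.  Clamping the argument makes it an operator on bounded continuous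
  functions on the real line, to which the Banach fixed point theorem applies.
\<close>

lemma solution_exists:
  assumes x0: "x0 \<in> {0..d}"
  shows "\<exists>y. solves f {0..d} y \<and> (y has_real_derivative f 0 (y 0)) (at 0 within {0..d}) \<and> y x0 = y0"
proof -
  define G where "G \<phi> x = integral {0..x} (\<lambda>s. f s (apply_bcontfun \<phi> s))" for \<phi> :: "real \<Rightarrow>\<^sub>C real" and x
  define cl where "cl x = max 0 (min d x)" for x
  have cl: "cl x \<in> {0..d}" "x \<in> {0..d} \<Longrightarrow> cl x = x" for x
    using d_pos by (auto simp: cl_def)
  have cont: "continuous_on S (\<lambda>s. f s (apply_bcontfun \<phi> s))" for S \<phi>
    by (intro f_compose_continuous continuous_intros) auto
  have dG: "(G \<phi> has_real_derivative f x (apply_bcontfun \<phi> x)) (at x within {0..d})"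
    if "x \<in> {0..d}" for \<phi> x
    unfolding G_def by (rule integral_has_real_derivative[OF cont that])
  then have contG: "continuous_on {0..d} (G \<phi>)" for \<phi>
    by (meson DERIV_continuous continuous_on_eq_continuous_within)
  have "compact (G \<phi> ` {0..d})" for \<phi>
    by (rule compact_continuous_image[OF contG]) simp
  then have bG: "bounded (G \<phi> ` {0..d})" for \<phi>
    by (rule compact_imp_bounded)
  define K where "K \<phi> x = y0 + G \<phi> (cl x) - G \<phi> x0" for \<phi> x
  have Kb: "K \<phi> \<in> bcontfun" for \<phi>
    unfolding bcontfun_def mem_Collect_eq
  proof
    have "continuous_on UNIV (\<lambda>x. G \<phi> (cl x))"
      by (rule continuous_on_compose2[OF contG]) (use cl in \<open>auto simp: cl_def intro!: continuous_intros\<close>)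
    then show "continuous_on UNIV (K \<phi>)"
      unfolding K_def by (intro continuous_intros)
    obtain B where B: "\<forall>x\<in>{0..d}. \<bar>G \<phi> x\<bar> \<le> B"
      using bG[of \<phi>] by (auto simp: bounded_iff)
    have "norm (K \<phi> x) \<le> \<bar>y0\<bar> + B + B" for x
      using bspec[OF B cl(1)[of x]] bspec[OF B x0] unfolding K_def real_norm_def by linarith
    then show "bounded (range (K \<phi>))" by (auto simp: bounded_iff)
  qed
  have lip: "dist (Bcontfun (K \<phi>)) (Bcontfun (K \<psi>)) \<le> 1 / 2 * dist \<phi> \<psi>" for \<phi> \<psi>
  proof (rule dist_bound)
    fix x
    have GG: "\<bar>G \<phi> z - G \<psi> z\<bar> \<le> 1 / 4 * dist \<phi> \<psi>" if z: "z \<in> {0..d}" for z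
    proof -
      have "G \<phi> z - G \<psi> z =
          integral {0..z} (\<lambda>s. f s (apply_bcontfun \<phi> s) - f s (apply_bcontfun \<psi> s))"
        unfolding G_def by (intro integral_diff [symmetric] integrable_continuous_real cont)
      also have "norm \<dots> \<le> (L * dist \<phi> \<psi>) * (z - 0)"
      proof (rule integral_bound)
        show "continuous_on {0..z} (\<lambda>s. f s (apply_bcontfun \<phi> s) - f s (apply_bcontfun \<psi> s))"
          by (intro continuous_intros cont)
        fix s
        have "\<bar>apply_bcontfun \<phi> s - apply_bcontfun \<psi> s\<bar> \<le> dist \<phi> \<psi>"
          using dist_bounded[of \<phi> s \<psi>] by (simp add: dist_real_def)
        then show "norm (f s (apply_bcontfun \<phi> s) - f s (apply_bcontfun \<psi> s)) \<le> L * dist \<phi> \<psi>"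
          using f_lipschitz L_nonneg by (metis mult_left_mono order_trans real_norm_def)
      qed (use z in simp)
      also have "\<dots> \<le> (L * dist \<phi> \<psi>) * d"
        using z L_nonneg by (intro mult_left_mono) auto
      also have "\<dots> = (L * d) * dist \<phi> \<psi>" by simp
      also have "\<dots> \<le> 1 / 4 * dist \<phi> \<psi>"
        using small by (rule mult_right_mono) simp
      finally show ?thesis by simp
    qed
    have "dist (K \<phi> x) (K \<psi> x) \<le> \<bar>G \<phi> (cl x) - G \<psi> (cl x)\<bar> + \<bar>G \<phi> x0 - G \<psi> x0\<bar>"
      by (simp add: K_def dist_real_def)
    also have "\<dots> \<le> 1 / 2 * dist \<phi> \<psi>"
      using GG[OF cl(1)[of x]] GG[OF x0] by simp
    finally show "dist (apply_bcontfun (Bcontfun (K \<phi>)) x) (apply_bcontfun (Bcontfun (K \<psi>)) x)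
        \<le> 1 / 2 * dist \<phi> \<psi>"
      by (simp add: Bcontfun_inverse Kb)
  qed
  have "\<exists>!\<phi>. Bcontfun (K \<phi>) = \<phi>"
    by (rule banach_fix_type[where c = "1 / 2"]) (use lip in auto)
  then obtain \<phi> where "Bcontfun (K \<phi>) = \<phi>" by blast
  then have eq: "apply_bcontfun \<phi> x = K \<phi> x" for x
    using Bcontfun_inverse[OF Kb[of \<phi>]] by metis
  have "(apply_bcontfun \<phi> has_real_derivative f x (apply_bcontfun \<phi> x)) (at x within {0..d})"
    if x: "x \<in> {0..d}" for x
  proof -
    have "((\<lambda>x. y0 + G \<phi> x - G \<phi> x0) has_real_derivative 0 + f x (apply_bcontfun \<phi> x) - 0)
        (at x within {0..d})"
      by (intro derivative_intros dG x)
    then have "((\<lambda>x. y0 + G \<phi> x - G \<phi> x0) has_real_derivative f x (apply_bcontfun \<phi> x))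
        (at x within {0..d})" by simp
    then show ?thesis
      by (rule has_field_derivative_transform_within[where d = 1])
         (use x cl(2) in \<open>auto simp: eq K_def\<close>)
  qed
  moreover have "apply_bcontfun \<phi> x0 = y0"
    using x0 cl(2) by (simp add: eq K_def)
  ultimately show ?thesis
    using d_pos by (intro exI[of _ "apply_bcontfun \<phi>"]) (auto simp: solves_def)
qed

text \<open>
  Two solutions differ by an almost constant amount, because the interval is short compared with
  the Lipschitz constant.  Uniqueness, monotone and continuous dependence on the initial value
  are all special cases.
\<close>

lemma solutions_stable:
  assumes I: "is_interval I" "I \<subseteq> {0..d}" and sol: "solves f I y" "solves f I z"
    and pq: "p \<in> I" "q \<in> I"
  shows "\<bar>(y q - z q) - (y p - z p)\<bar> \<le> \<bar>y p - z p\<bar> / 3"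
proof -
  define D where "D x = y x - z x" for x
  define lo hi where "lo = min p q" and "hi = max p q"
  have lohi: "lo \<in> I" "hi \<in> I" "lo \<le> hi" "p \<in> {lo..hi}" "q \<in> {lo..hi}"
    using pq by (auto simp: lo_def hi_def min_def max_def)
  note sub = interval_segment_subset[OF I(1) lohi(1,2)]
  have contD: "continuous_on I D"
    unfolding D_def using sol by (auto simp: solves_def intro!: continuous_intros)
  then have "continuous_on {lo..hi} (\<lambda>x. \<bar>D x\<bar>)"
    using sub by (auto intro!: continuous_intros intro: continuous_on_subset)
  then obtain m where m: "m \<in> {lo..hi}" "\<And>x. x \<in> {lo..hi} \<Longrightarrow> \<bar>D x\<bar> \<le> \<bar>D m\<bar>"
    using continuous_attains_sup[of "{lo..hi}" "\<lambda>x. \<bar>D x\<bar>"] lohi(3) by auto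
  have incr: "\<bar>D t - D s\<bar> \<le> \<bar>D m\<bar> / 4" if st: "s \<in> {lo..hi}" "t \<in> {lo..hi}" "s < t" for s t
  proof -
    have stI: "s \<in> I" "t \<in> I" using sub st by auto
    have "(D has_real_derivative f x (y x) - f x (z x)) (at x within I)" if "s < x" "x < t" for x
    proof -
      have "x \<in> I - {0}" using that stI sub st I(2) by auto
      then show ?thesis
        unfolding D_def using sol by (intro derivative_intros) (auto simp: solves_def)
    qed
    then obtain x where x: "s < x" "x < t" "D t - D s = (t - s) * (f x (y x) - f x (z x))"
      using interval_mvt[OF I(1) contD stI st(3), of "\<lambda>x. f x (y x) - f x (z x)"] by blast
    have "\<bar>f x (y x) - f x (z x)\<bar> \<le> L * \<bar>D x\<bar>"
      using f_lipschitz by (simp add: D_def)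
    also have "\<dots> \<le> L * \<bar>D m\<bar>"
      using m(2)[of x] x st L_nonneg by (intro mult_left_mono) auto
    finally have "\<bar>t - s\<bar> * \<bar>f x (y x) - f x (z x)\<bar> \<le> d * (L * \<bar>D m\<bar>)"
      using subsetD[OF I(2) stI(1)] subsetD[OF I(2) stI(2)] st(3) d_pos
      by (intro mult_mono) auto
    also have "\<dots> = (L * d) * \<bar>D m\<bar>" by simp
    also have "\<dots> \<le> 1 / 4 * \<bar>D m\<bar>" using small by (rule mult_right_mono) simp
    finally show ?thesis unfolding x(3) abs_mult by simp
  qed
  then have incr': "\<bar>D s - D p\<bar> \<le> \<bar>D m\<bar> / 4" if "s \<in> {lo..hi}" for s
    using that lohi(4) by (cases s p rule: linorder_cases) (force simp: abs_minus_commute)+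
  have "\<bar>D m\<bar> \<le> 4 / 3 * \<bar>D p\<bar>" using incr'[OF m(1)] by linarith
  then show ?thesis using incr'[OF lohi(5)] by (simp add: D_def)
qed

definition sol :: "real \<Rightarrow> real \<Rightarrow> real \<Rightarrow> real" where
  "sol x0 y0 = (SOME y. solves f {0..d} y \<and>
     (y has_real_derivative f 0 (y 0)) (at 0 within {0..d}) \<and> y x0 = y0)"

text \<open>Solutions reach \<open>0\<close> and are determined by their values there, so these values serve as labels.\<close>

definition first_integral :: "real \<Rightarrow> real \<Rightarrow> real" where
  "first_integral x y = sol x y 0"

lemma sol:
  assumes "x0 \<in> {0..d}"
  shows "solves f {0..d} (sol x0 y0)" "sol x0 y0 x0 = y0"
    "(sol x0 y0 has_real_derivative f 0 (sol x0 y0 0)) (at 0 within {0..d})"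
  using someI_ex[OF solution_exists[OF assms, of y0]] unfolding sol_def by auto

lemma sol_derivative:
  assumes "x0 \<in> {0..d}" "x \<in> {0..d}"
  shows "(sol x0 y0 has_real_derivative f x (sol x0 y0 x)) (at x within {0..d})"
  using sol[OF assms(1), of y0] assms(2) by (cases "x = 0") (auto simp: solves_def)

lemma first_integral_0 [simp]: "first_integral 0 y = y"
  using sol(2)[of 0 y] d_pos by (simp add: first_integral_def)

text \<open>
  The difference quotients of \<open>first_integral x\<close> lie between \<open>2 / 3\<close> and \<open>4 / 3\<close>: distinct solutions stay apart, and in
  the same order, on the whole interval.
\<close>

lemma first_integral_lipschitz_strict_mono:
  assumes "x \<in> {0..d}"
  shows "\<bar>(first_integral x y - first_integral x z) - (y - z)\<bar> \<le> \<bar>y - z\<bar> / 3"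
  using solutions_stable[OF _ order_refl sol(1)[OF assms, of y] sol(1)[OF assms, of z] assms, of 0]
    sol(2)[OF assms] d_pos by (simp add: first_integral_def)

lemma first_integral_less_iff:
  assumes "x \<in> {0..d}"
  shows "first_integral x y < first_integral x z \<longleftrightarrow> y < z"
  using first_integral_lipschitz_strict_mono[OF assms, of y z]
  by argo

lemma first_integral_eq_iff:
  assumes "x \<in> {0..d}"
  shows "first_integral x y = first_integral x z \<longleftrightarrow> y = z"
  using first_integral_lipschitz_strict_mono[OF assms, of y z]
  by argo

lemma first_integral_constant:
  assumes I: "is_interval I" "I \<subseteq> {0..d}" and y: "solves f I y" and pq: "p \<in> I" "q \<in> I"
  shows "first_integral p (y p) = first_integral q (y q)"
proof -
  have pq': "p \<in> {0..d}" "q \<in> {0..d}" using pq I by auto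
  have "sol p (y p) q = y q"
    using solutions_stable[OF I y solves_subset[OF sol(1)[OF pq'(1), of "y p"] I(2)] pq]
      sol(2)[OF pq'(1)] by simp
  then show ?thesis
    using solutions_stable[OF _ order_refl sol(1)[OF pq'(1), of "y p"] sol(1)[OF pq'(2), of "y q"]
        pq'(2), of 0] sol(2)[OF pq'(2)] d_pos
    by (simp add: first_integral_def)
qed

text \<open>
  Conversely, a function along which the first integral is constant must coincide with the solution
  through any of its points, because the first integral is injective in \<open>y\<close>.
\<close>

lemma solves_iff_first_integral:
  assumes I: "is_interval I" "I \<subseteq> {0..d}"
  shows "solves f I y \<longleftrightarrow> (\<forall>p\<in>I. \<forall>q\<in>I. first_integral p (y p) = first_integral q (y q))"
proof
  assume "solves f I y"
  then show "\<forall>p\<in>I. \<forall>q\<in>I. first_integral p (y p) = first_integral q (y q)"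
    using first_integral_constant[OF I] by blast
next
  assume const: "\<forall>p\<in>I. \<forall>q\<in>I. first_integral p (y p) = first_integral q (y q)"
  show "solves f I y"
  proof (cases "I = {}")
    case False
    then obtain p where p: "p \<in> I" by blast
    then have pd: "p \<in> {0..d}" using I by auto
    let ?\<phi> = "sol p (y p)"
    have "?\<phi> q = y q" if q: "q \<in> I" for q
    proof -
      have "first_integral q (?\<phi> q) = first_integral p (?\<phi> p)"
        using q pd I by (intro first_integral_constant[OF _ order_refl sol(1)[OF pd]]) auto
      then have "first_integral q (?\<phi> q) = first_integral q (y q)"
        using const p q sol(2)[OF pd] by metis
      then show ?thesis using first_integral_eq_iff q I by blast
    qed
    moreover have "solves f I ?\<phi>" using solves_subset[OF sol(1)[OF pd] I(2)] .
    ultimately show ?thesis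
      unfolding solves_def
      by (auto intro: continuous_on_eq has_field_derivative_transform_within[where d = 1])
  qed (simp add: solves_def)
qed

lemma first_integral_continuous:
  "continuous_on ({0..d} \<times> UNIV) (\<lambda>(x, y). first_integral x y)"
proof -
  have main: "\<bar>first_integral x y - first_integral x' y'\<bar> \<le> 4 / 3 * (M * \<bar>x - x'\<bar> + \<bar>y - y'\<bar>)"
    if x: "x \<in> {0..d}" "x' \<in> {0..d}" for x y x' y'
  proof -
    let ?\<phi> = "sol x y"
    have int: "is_interval {0..d}" by simp
    have cont: "continuous_on {0..d} ?\<phi>" using sol(1)[OF x(1)] by (simp add: solves_def)
    have *: "\<bar>?\<phi> t - ?\<phi> s\<bar> \<le> M * \<bar>t - s\<bar>" if st: "s \<in> {0..d}" "t \<in> {0..d}" "s < t" for s t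
    proof -
      have "(?\<phi> has_real_derivative f r (?\<phi> r)) (at r within {0..d})" if "s < r" "r < t" for r
        using that st x by (intro sol_derivative) auto
      then obtain r where "?\<phi> t - ?\<phi> s = (t - s) * f r (?\<phi> r)"
        using interval_mvt[OF int cont st, of "\<lambda>r. f r (?\<phi> r)"] by blast
      then show ?thesis
        using mult_left_mono[OF f_bound[of r "?\<phi> r"], of "\<bar>t - s\<bar>"]
        by (simp add: abs_mult mult.commute)
    qed
    have "\<bar>?\<phi> x' - y\<bar> \<le> M * \<bar>x - x'\<bar>"
      using *[of x x'] *[of x' x] x sol(2)[OF x(1), of y]
      by (cases x x' rule: linorder_cases) (auto simp: abs_minus_commute)
    moreover have "first_integral x y = first_integral x' (?\<phi> x')"
      using first_integral_constant[OF int order_refl sol(1)[OF x(1)] x] sol(2)[OF x(1)] by simp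
    ultimately show ?thesis
      using first_integral_lipschitz_strict_mono[OF x(2), of "?\<phi> x'" y'] by argo
  qed
  show ?thesis
    unfolding continuous_on_def
  proof (intro ballI)
    fix p assume p: "p \<in> {0..d} \<times> (UNIV :: real set)"
    obtain x y where xy: "p = (x, y)" by (cases p)
    have "((\<lambda>q. 4 / 3 * (M * \<bar>fst q - x\<bar> + \<bar>snd q - y\<bar>)) \<longlongrightarrow>
        4 / 3 * (M * \<bar>fst p - x\<bar> + \<bar>snd p - y\<bar>)) (at p within {0..d} \<times> UNIV)"
      by (intro tendsto_intros)
    then have "((\<lambda>q. 4 / 3 * (M * \<bar>fst q - x\<bar> + \<bar>snd q - y\<bar>)) \<longlongrightarrow> 0) (at p within {0..d} \<times> UNIV)"
      by (simp add: xy)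
    then have "((\<lambda>q. (case q of (x, y) \<Rightarrow> first_integral x y) - first_integral x y) \<longlongrightarrow> 0)
        (at p within {0..d} \<times> UNIV)"
    proof (rule Lim_null_comparison[rotated])
      show "\<forall>\<^sub>F q in at p within {0..d} \<times> UNIV.
          norm ((case q of (x, y) \<Rightarrow> first_integral x y) - first_integral x y)
            \<le> 4 / 3 * (M * \<bar>fst q - x\<bar> + \<bar>snd q - y\<bar>)"
        unfolding eventually_at_filter
      proof (intro always_eventually allI impI)
        fix q :: "real \<times> real" assume "q \<in> {0..d} \<times> UNIV"
        then show "norm ((case q of (x, y) \<Rightarrow> first_integral x y) - first_integral x y)
            \<le> 4 / 3 * (M * \<bar>fst q - x\<bar> + \<bar>snd q - y\<bar>)"
          using main[of "fst q" x "snd q" y] p xy by (auto simp: case_prod_beta)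
      qed
    qed
    then show "((\<lambda>(x, y). first_integral x y) \<longlongrightarrow> (case p of (x, y) \<Rightarrow> first_integral x y))
        (at p within {0..d} \<times> UNIV)"
      using LIM_zero_iff xy by fastforce
  qed
qed

end

section \<open>Labelling the orbits in a quadrant\<close>

locale positive_scalar_ode = scalar_ode +
  assumes f_pos: "0 < f x y"
begin

text \<open>
  With a positive right-hand side the solution through a point of the first quadrant, followed
  backwards, leaves the quadrant either through \<open>x = 0\<close>, where its label is the ordinate (the first
  integral is nonnegative), or through \<open>y = 0\<close>, where its label is minus the abscissa (the first
  integral is negative and equals \<open>axis_value\<close> of that abscissa).
\<close>

definition axis_value :: "real \<Rightarrow> real" where
  "axis_value x = first_integral x 0"

definition level :: "real \<Rightarrow> real" where
  "level z = (if 0 \<le> z then z else - the_inv_into {0..d} axis_value z)"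

definition orbit_label :: "real \<Rightarrow> real \<Rightarrow> real" where
  "orbit_label x y = level (first_integral x y)"

text \<open>
  The solution through \<open>(x', 0)\<close> is increasing, so it is negative at a smaller abscissa \<open>x\<close>, below the
  solution through \<open>(x, 0)\<close>.
\<close>

lemma axis_value_decreasing:
  assumes "x \<in> {0..d}" "x' \<in> {0..d}" "x < x'"
  shows "axis_value x' < axis_value x"
proof -
  have "sol x' 0 x < sol x' 0 x'"
  proof (rule interval_increasing_open[where J = "{0..d}" and u = "sol x' 0"])
    show "continuous_on {0..d} (sol x' 0)"
      using sol(1)[OF assms(2)] by (simp add: solves_def)
    show "\<exists>e>0. (sol x' 0 has_real_derivative e) (at r within {0..d})" if "x < r" "r < x'" for r
      using sol_derivative[OF assms(2), of r 0] f_pos[of r "sol x' 0 r"] that assms by auto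
  qed (use assms in auto)
  then have "sol x' 0 x < 0" by (simp only: sol(2)[OF assms(2)])
  moreover have "axis_value x' = first_integral x (sol x' 0 x)"
    unfolding axis_value_def
    using first_integral_constant[OF _ order_refl sol(1)[OF assms(2)] assms(2,1), of 0]
      sol(2)[OF assms(2)] by simp
  ultimately show ?thesis
    using first_integral_less_iff[OF assms(1)] by (simp add: axis_value_def)
qed

lemma axis_value_inj: "inj_on axis_value {0..d}"
proof (rule linorder_inj_onI')
  fix x x' assume "x \<in> {0..d}" "x' \<in> {0..d}" "x < x'"
  then show "axis_value x \<noteq> axis_value x'" using axis_value_decreasing[of x x'] by simp
qed

lemma axis_value_continuous: "continuous_on {0..d} axis_value"
  unfolding axis_value_def
  using continuous_on_compose2[OF first_integral_continuous, of "{0..d}" "\<lambda>x. (x, 0)"]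
  by (simp add: continuous_on_Pair image_subset_iff)

lemma axis_value_0: "axis_value 0 = 0"
  by (simp add: axis_value_def)

lemma axis_value_bounds:
  assumes "x \<in> {0..d}"
  shows "axis_value d \<le> axis_value x" "axis_value x \<le> 0"
proof -
  show "axis_value d \<le> axis_value x"
    using axis_value_decreasing[of x d] assms d_pos by (cases "x = d") auto
  show "axis_value x \<le> 0"
    using axis_value_decreasing[of 0 x] assms d_pos by (cases "x = 0") (auto simp: axis_value_0)
qed

lemma axis_value_image: "axis_value ` {0..d} = {axis_value d..0}"
proof
  show "axis_value ` {0..d} \<subseteq> {axis_value d..0}"
    using axis_value_bounds by auto
  show "{axis_value d..0} \<subseteq> axis_value ` {0..d}"
  proof
    fix z assume "z \<in> {axis_value d..0}"
    then obtain x where "0 \<le> x" "x \<le> d" "axis_value x = z"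
      using IVT2'[of axis_value d z 0] axis_value_continuous d_pos by (auto simp: axis_value_0)
    then show "z \<in> axis_value ` {0..d}" by auto
  qed
qed

lemma level_axis_value: "x \<in> {0..d} \<Longrightarrow> level (axis_value x) = - x"
  using axis_value_decreasing[of 0 x] the_inv_into_f_f[OF axis_value_inj, of x]
  by (cases "x = 0") (auto simp: level_def axis_value_0)

lemma level_negative:
  assumes "axis_value d \<le> z" "z < 0"
  obtains x where "x \<in> {0..d}" "0 < x" "axis_value x = z" "level z = - x"
proof -
  obtain x where x: "x \<in> {0..d}" "axis_value x = z"
    using assms axis_value_image by (metis atLeastAtMost_iff imageE less_imp_le)
  moreover have "x \<noteq> 0" using x assms(2) axis_value_0 by auto
  ultimately show thesis using that level_axis_value[of x] by force
qed

lemma level_strict_mono: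
  assumes "axis_value d \<le> z" "z < w"
  shows "level z < level w"
proof (cases "0 \<le> z")
  case True
  then show ?thesis using assms by (simp add: level_def)
next
  case False
  then obtain x where x: "x \<in> {0..d}" "0 < x" "axis_value x = z" "level z = - x"
    using level_negative assms(1) by force
  show ?thesis
  proof (cases "0 \<le> w")
    case True
    then show ?thesis using x by (simp add: level_def[of w])
  next
    case False
    then obtain x' where x': "x' \<in> {0..d}" "axis_value x' = w" "level w = - x'"
      using level_negative[of w] assms by force
    have "x' < x"
      using axis_value_decreasing[OF x(1) x'(1)] x x' assms(2)
      by (cases x x' rule: linorder_cases) auto
    then show ?thesis using x x' by simp
  qed
qed

lemma level_continuous: "continuous_on {axis_value d..} level"
proof -
  have "continuous_on ({axis_value d..0} \<union> {0..}) level"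
  proof (rule continuous_on_closed_Un)
    have "continuous_on (axis_value ` {0..d}) (the_inv_into {0..d} axis_value)"
      by (rule continuous_on_inv_into[OF axis_value_continuous _ axis_value_inj]) simp
    then have *: "continuous_on {axis_value d..0} (\<lambda>z. - the_inv_into {0..d} axis_value z)"
      unfolding axis_value_image by (rule continuous_on_minus)
    have **: "the_inv_into {0..d} axis_value 0 = 0"
      using the_inv_into_f_f[OF axis_value_inj, of 0] d_pos by (simp add: axis_value_0)
    show "continuous_on {axis_value d..0} level"
      by (rule continuous_on_eq[OF *]) (auto simp: level_def ** order_antisym)
    show "continuous_on {0..} level"
      by (rule continuous_on_eq[OF continuous_on_id]) (auto simp: level_def)
  qed auto
  moreover have "{axis_value d..} \<subseteq> {axis_value d..0} \<union> {0..}" by auto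
  ultimately show ?thesis by (rule continuous_on_subset)
qed

lemma first_integral_ge:
  assumes "x \<in> {0..d}" "0 \<le> y"
  shows "axis_value d \<le> first_integral x y"
  using axis_value_bounds(1)[OF assms(1)] first_integral_less_iff[OF assms(1), of 0 y] assms(2)
  by (cases "y = 0") (auto simp: axis_value_def)

lemma orbit_label_continuous:
  "continuous_on ({0..d} \<times> {0..}) (\<lambda>(x, y). orbit_label x y)"
proof -
  have "continuous_on ({0..d} \<times> {0..}) (\<lambda>(x, y). first_integral x y)"
    by (rule continuous_on_subset[OF first_integral_continuous]) auto
  then have "continuous_on ({0..d} \<times> {0..}) (\<lambda>p. level (case p of (x, y) \<Rightarrow> first_integral x y))"
    by (rule continuous_on_compose2[OF level_continuous]) (use first_integral_ge in auto)
  then show ?thesis by (simp add: orbit_label_def case_prod_unfold)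
qed

lemma orbit_label_x_axis: "x \<in> {0..d} \<Longrightarrow> orbit_label x 0 = - x"
  using level_axis_value[of x] by (simp add: orbit_label_def axis_value_def)

lemma orbit_label_y_axis: "0 \<le> y \<Longrightarrow> orbit_label 0 y = y"
  by (simp add: orbit_label_def level_def)

lemma orbit_label_strict_mono:
  "x \<in> {0..d} \<Longrightarrow> 0 \<le> y \<Longrightarrow> y < z \<Longrightarrow> orbit_label x y < orbit_label x z"
  unfolding orbit_label_def
  by (intro level_strict_mono first_integral_ge) (auto simp: first_integral_less_iff)

text \<open>On the range of the first integral over the quadrant, \<open>level\<close> is injective.\<close>

lemma solves_iff_orbit_label:
  assumes "is_interval I" "I \<subseteq> {0..d}" "\<And>x. x \<in> I \<Longrightarrow> 0 \<le> y x"
  shows "solves f I y \<longleftrightarrow> (\<forall>p\<in>I. \<forall>q\<in>I. orbit_label p (y p) = orbit_label q (y q))"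
proof -
  have "level z = level w \<longleftrightarrow> z = w" if "axis_value d \<le> z" "axis_value d \<le> w" for z w
    using level_strict_mono that by (cases z w rule: linorder_cases) force+
  then show ?thesis
    unfolding solves_iff_first_integral[OF assms(1,2)] orbit_label_def
    using first_integral_ge assms(2,3) by (meson subsetD)
qed

end

section \<open>Orbits of transversal piecewise smooth systems\<close>

text \<open>
  The two cases \<open>i = 1\<close> and \<open>i = 2\<close> are treated at once: points are addressed by their coordinate \<open>x\<close>
  transversal to the crossing axis and their coordinate \<open>y\<close> transversal to the sliding axis.
\<close>

definition pt :: "2 \<Rightarrow> real \<Rightarrow> real \<Rightarrow> real^2" where
  "pt i x y = (\<chi> k. if k = i then x else y)"

locale axes =
  fixes i j :: 2
  assumes ij: "i \<noteq> j"
begin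

lemma index_cases: "k = i \<or> k = j"
  using ij exhaust_2[of i] exhaust_2[of j] exhaust_2[of k] by metis

lemma other_i [simp]: "other i = j" and other_j [simp]: "other j = i"
  unfolding other_def using ij exhaust_2[of i] exhaust_2[of j] by metis+

lemma pt_nth [simp]: "pt i x y $ i = x" "pt i x y $ j = y"
  using ij ij[symmetric] by (simp_all add: pt_def)

lemma plane_eq_iff: "p = q \<longleftrightarrow> p $ i = q $ i \<and> p $ j = q $ j" for p q :: "'a^2"
proof
  assume "p $ i = q $ i \<and> p $ j = q $ j"
  then have "p $ k = q $ k" for k using index_cases[of k] by metis
  then show "p = q" by (intro vec_eq_iff[THEN iffD2] allI)
qed simp

lemma pt_components [simp]: "pt i (p $ i) (p $ j) = p"
  by (simp add: plane_eq_iff)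

lemma pt_eq_axes: "pt i x y = x *\<^sub>R axis i 1 + y *\<^sub>R axis j 1"
  using ij by (auto simp: plane_eq_iff axis_def)

lemma product_components: "p $ 1 * p $ 2 = p $ i * p $ j" for p :: "real^2"
proof -
  have "(i = 1 \<and> j = 2) \<or> (i = 2 \<and> j = 1)"
    using ij exhaust_2[of i] exhaust_2[of j] by metis
  then show ?thesis by (elim disjE conjE) (simp_all only: mult.commute)
qed

lemma norm_pt_0: "norm (pt i x 0) = \<bar>x\<bar>"
  by (simp add: pt_eq_axes)

lemma continuous_on_pt [continuous_intros]:
  "continuous_on S u \<Longrightarrow> continuous_on S v \<Longrightarrow> continuous_on S (\<lambda>t. pt i (u t) (v t))"
  unfolding pt_eq_axes by (intro continuous_intros)

lemma has_vector_derivative_plane_iff: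
  "(\<gamma> has_vector_derivative v) F \<longleftrightarrow>
     ((\<lambda>t. \<gamma> t $ i) has_vector_derivative v $ i) F \<and> ((\<lambda>t. \<gamma> t $ j) has_vector_derivative v $ j) F"
  for v :: "real^2"
proof
  assume "(\<gamma> has_vector_derivative v) F"
  then show "((\<lambda>t. \<gamma> t $ i) has_vector_derivative v $ i) F \<and>
      ((\<lambda>t. \<gamma> t $ j) has_vector_derivative v $ j) F"
    using bounded_linear.has_vector_derivative[OF bounded_linear_vec_nth] by blast
next
  assume "((\<lambda>t. \<gamma> t $ i) has_vector_derivative v $ i) F \<and>
      ((\<lambda>t. \<gamma> t $ j) has_vector_derivative v $ j) F"
  then have "((\<lambda>t. (\<gamma> t $ i) *\<^sub>R (axis i 1 :: real^2) + (\<gamma> t $ j) *\<^sub>R axis j 1)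
      has_vector_derivative (v $ i) *\<^sub>R axis i 1 + (v $ j) *\<^sub>R axis j 1) F"
    by (intro has_vector_derivative_add bounded_linear.has_vector_derivative[OF bounded_linear_scaleR_left])
       auto
  then show "(\<gamma> has_vector_derivative v) F"
    unfolding pt_eq_axes[symmetric] pt_components .
qed

end

text \<open>
  The sign conditions of the theorem, imposed on a whole neighbourhood of the origin.  Both the given
  system and the constant one satisfy them.
\<close>

locale transversal_system = axes i j for i j :: 2 +
  fixes a :: real and W :: "(real^2) set" and X Y :: vfield
  assumes a: "a = 1 \<or> a = - 1"
    and W_open: "open W" and W_0: "0 \<in> W"
    and X_cont: "continuous_on W X" and Y_cont: "continuous_on W Y"
    and X_i: "p \<in> W \<Longrightarrow> 0 < a * X p $ i" and X_j: "p \<in> W \<Longrightarrow> 0 < a * X p $ j"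
    and Y_i: "p \<in> W \<Longrightarrow> 0 < a * Y p $ i" and Y_j: "p \<in> W \<Longrightarrow> a * Y p $ j < 0"
begin

lemma a_square [simp]: "a * a = 1" "a * (a * x) = x" and a_nonzero [simp]: "a \<noteq> 0"
  using a by auto

text \<open>
  The velocity of an orbit at \<open>p\<close>, except on the crossing axis away from the origin, where an orbit
  changes fields and its value has no meaning.  \<open>slope\<close> is the derivative of \<open>y\<close> with respect to the
  increasing parameter \<open>a * x\<close>.
\<close>

definition velocity :: vfield where
  "velocity p = (if p $ j = 0 then slide_field X Y j p
     else if 0 < p $ i * p $ j then X p else Y p)"

definition slope :: "real^2 \<Rightarrow> real" where
  "slope p = velocity p $ j / (a * velocity p $ i)"

lemma slide_field_component:
  "slide_field X Y j p $ i = (Y p $ j * X p $ i - X p $ j * Y p $ i) / (Y p $ j - X p $ j)"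
  "slide_field X Y j p $ j = 0"
  using ij by (simp_all add: slide_field_def Let_def axis_def)

text \<open>
  The sliding field is a convex combination of \<open>X\<close> and \<open>Y\<close>, and both move in the same \<open>x\<close>-direction.
\<close>

lemma slide_field_i:
  assumes p: "p \<in> W"
  shows "0 < a * slide_field X Y j p $ i"
proof -
  have "a * slide_field X Y j p $ i =
      ((a * Y p $ j) * (a * X p $ i) - (a * X p $ j) * (a * Y p $ i)) / (a * Y p $ j - a * X p $ j)"
  proof -
    have "a * (n / m) = n / (a * m)" for n m using a by auto
    moreover have "(a * x) * (a * y) = x * y" for x y using a by auto
    ultimately show ?thesis
      by (simp only: slide_field_component right_diff_distrib)
  qed
  moreover have "(a * Y p $ j) * (a * X p $ i) < 0"
    using Y_j[OF p] X_i[OF p] by (rule mult_neg_pos)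
  moreover have "0 < (a * X p $ j) * (a * Y p $ i)"
    using X_j[OF p] Y_i[OF p] by (rule mult_pos_pos)
  ultimately show ?thesis
    using X_j[OF p] Y_j[OF p] by (simp add: divide_neg_neg)
qed

lemma velocity_i: "p \<in> W \<Longrightarrow> 0 < a * velocity p $ i"
  using slide_field_i X_i Y_i by (auto simp: velocity_def)

lemma Uplus_eq: "Uplus W = {p \<in> W. 0 < p $ i * p $ j}"
  by (simp add: Uplus_def product_components)

lemma Uminus_eq: "Uminus W = {p \<in> W. p $ i * p $ j < 0}"
  by (simp add: Uminus_def product_components)

lemma same_sign: "p \<in> W \<Longrightarrow> 0 < X p $ i * Y p $ i"
  and opposite_sign: "p \<in> W \<Longrightarrow> X p $ j * Y p $ j < 0"
proof -
  have *: "(a * x) * (a * y) = x * y" for x y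
    using a by auto
  show "0 < X p $ i * Y p $ i" if "p \<in> W"
    using mult_pos_pos[OF X_i[OF that] Y_i[OF that]] by (simp only: *)
  show "X p $ j * Y p $ j < 0" if "p \<in> W"
    using mult_pos_neg[OF X_j[OF that] Y_j[OF that]] by (simp only: *)
qed

lemma crossing_eq: "crossing W X Y i = {p \<in> W. p $ i = 0}" "crossing W X Y j = {}"
  using same_sign opposite_sign by (force simp: crossing_def Sig_i_def)+

lemma Union_crossing: "(\<Union>k. crossing W X Y k) = {p \<in> W. p $ i = 0}"
proof -
  have univ: "(UNIV :: 2 set) = {i, j}" using index_cases by auto
  show ?thesis unfolding univ by (simp add: crossing_eq)
qed

lemma slide_esc_eq: "slide_esc W X Y i = {}" "slide_esc W X Y j = {p \<in> W. p $ j = 0 \<and> p $ i \<noteq> 0}"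
proof -
  have "p \<in> W \<and> X p $ i * Y p $ i < 0" if "p \<in> slide_esc W X Y i" for p
    using that by (auto simp: slide_esc_def sliding_def escaping_def Sig_i_def mult_neg_pos mult_pos_neg)
  then show "slide_esc W X Y i = {}"
    using same_sign by (meson equals0I order_less_asym)
  show "slide_esc W X Y j = {p \<in> W. p $ j = 0 \<and> p $ i \<noteq> 0}"
  proof (intro set_eqI iffI)
    fix p assume "p \<in> slide_esc W X Y j"
    then show "p \<in> {p \<in> W. p $ j = 0 \<and> p $ i \<noteq> 0}"
      by (auto simp: slide_esc_def sliding_def escaping_def Sig_i_def)
  next
    fix p assume p: "p \<in> {p \<in> W. p $ j = 0 \<and> p $ i \<noteq> 0}"
    then have "X p $ j > 0 \<and> Y p $ j < 0 \<or> X p $ j < 0 \<and> Y p $ j > 0"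
      using X_j[of p] Y_j[of p] a by (elim disjE) simp_all
    moreover have "p $ i < 0 \<or> p $ i > 0" using p by (simp add: neq_iff)
    ultimately show "p \<in> slide_esc W X Y j"
      using p by (elim disjE) (simp_all add: slide_esc_def sliding_def escaping_def Sig_i_def)
  qed
qed

text \<open>
  One axis consists of crossing points only, the other of sliding or escaping points and the origin.
  So there are no further boundary points.
\<close>

lemma not_boundary_rule: "\<not> boundary_rule W X Y J \<gamma> t"
proof
  assume "boundary_rule W X Y J \<gamma> t"
  then obtain k where "\<gamma> t \<in> Sig_i W k - {0} - (crossing W X Y k \<union> slide_esc W X Y k)"
    unfolding boundary_rule_def by blast
  then show False
    using index_cases[of k] crossing_eq slide_esc_eq by (auto simp: Sig_i_def plane_eq_iff)
qed

lemma small_axis_points: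
  assumes "0 < e"
  obtains x where "0 < x" "x < e" "pt i x 0 \<in> W"
proof -
  obtain r where r: "0 < r" "ball 0 r \<subseteq> W"
    using W_open W_0 openE by blast
  define x where "x = min r e / 2"
  have "pt i x 0 \<in> ball 0 r" using r assms by (simp add: norm_pt_0 x_def)
  then show thesis using that[of x] r assms by (auto simp: x_def)
qed

text \<open>
  The orbit through the origin is the sliding one.  In particular the solutions of \<open>X\<close> and \<open>Y\<close> that
  tend to the origin do not contain it.
\<close>

lemma origin_sliding_iff: "origin_sliding W X Y k \<longleftrightarrow> k = j"
proof -
  have "0 \<in> closure (slide_esc W X Y j)"
    unfolding closure_approachable slide_esc_eq
  proof (intro allI impI)
    fix e :: real assume "0 < e"
    then obtain x where "0 < x" "x < e" "pt i x 0 \<in> W" by (rule small_axis_points)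
    then show "\<exists>y\<in>{p \<in> W. p $ j = 0 \<and> p $ i \<noteq> 0}. dist y 0 < e"
      by (intro bexI[of _ "pt i x 0"]) (auto simp: norm_pt_0)
  qed
  moreover have "0 \<in> closure (crossing W X Y i)"
    using W_0 closure_subset by (force simp: crossing_eq)
  ultimately show ?thesis
    using index_cases[of k] ij slide_esc_eq(1) by (auto simp: origin_sliding_def)
qed

lemma not_origin_crossing: "\<not> origin_crossing W X Y"
proof
  assume *: "origin_crossing W X Y"
  obtain x where x: "0 < x" "x < 1" "pt i x 0 \<in> W"
    using small_axis_points[of 1] by auto
  then have "pt i x 0 \<in> Sig W" by (simp add: Sig_def product_components)
  then have "pt i x 0 \<in> closure {p \<in> W. p $ i = 0}"
    using * by (simp add: origin_crossing_def Union_crossing)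
  moreover have "closure {p \<in> W. p $ i = 0} \<subseteq> {p. p $ i = 0}"
    by (rule closure_minimal) (auto intro!: closed_Collect_eq continuous_intros)
  ultimately show False using x by auto
qed

lemma origin_rule_iff:
  "origin_rule W X Y J \<gamma> t \<longleftrightarrow> \<gamma> t = 0 \<and>
     (\<forall>\<^sub>F s in at t within J. \<gamma> s \<in> insert 0 (slide_esc W X Y j)) \<and>
     (\<gamma> has_vector_derivative slide_field X Y j 0) (at t within J)"
  using not_origin_crossing by (auto simp: origin_rule_def origin_sliding_iff)

lemma regular_rule_iff:
  "regular_rule W X Y J \<gamma> t \<longleftrightarrow>
     (\<gamma> t \<in> W \<and> 0 < \<gamma> t $ i * \<gamma> t $ j \<and> (\<gamma> has_vector_derivative X (\<gamma> t)) (at t within J)) \<or>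
     (\<gamma> t \<in> W \<and> \<gamma> t $ i * \<gamma> t $ j < 0 \<and> (\<gamma> has_vector_derivative Y (\<gamma> t)) (at t within J)) \<or>
     (\<gamma> t \<in> W \<and> \<gamma> t $ i = 0 \<and> \<gamma> t $ j \<noteq> 0 \<and>
        (((\<forall>\<^sub>F s in at t within J \<inter> {..<t}. \<gamma> s \<in> Uplus W) \<and>
          (\<forall>\<^sub>F s in at t within J \<inter> {t<..}. \<gamma> s \<in> Uminus W)) \<or>
         ((\<forall>\<^sub>F s in at t within J \<inter> {..<t}. \<gamma> s \<in> Uminus W) \<and>
          (\<forall>\<^sub>F s in at t within J \<inter> {t<..}. \<gamma> s \<in> Uplus W)))) \<or>
     (\<gamma> t \<in> W \<and> \<gamma> t $ j = 0 \<and> \<gamma> t $ i \<noteq> 0 \<and>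
        (\<forall>\<^sub>F s in at t within J. \<gamma> s \<in> slide_esc W X Y j) \<and>
        (\<gamma> has_vector_derivative slide_field X Y j (\<gamma> t)) (at t within J))"
proof -
  have ex: "(\<exists>k. P k) \<longleftrightarrow> P i \<or> P j" for P :: "2 \<Rightarrow> bool"
    using index_cases by metis
  show ?thesis
    unfolding regular_rule_def Union_crossing ex slide_esc_eq(1)
    by (simp add: Uplus_eq Uminus_eq slide_esc_eq(2) plane_eq_iff) auto
qed

text \<open>
  The position-dependent rules amount to three conditions: motion with the prescribed velocity, no
  passage between the axis \<open>y = 0\<close> and its two sides, and a strictly increasing \<open>a * x\<close>.  The sign of
  \<open>y\<close> is locally constant in time, because an orbit point on \<open>y = 0\<close> forces nearby orbit points onto
  that axis.  Conversely, the monotonicity of \<open>a * x\<close> says which quadrants are visited immediately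
  before and after a crossing.
\<close>

lemma orbit_curve_iff:
  "orbit_curve W X Y J \<gamma> \<longleftrightarrow>
     is_interval J \<and> J \<noteq> {} \<and> \<gamma> ` J \<subseteq> W \<and> continuous_on J \<gamma> \<and>
     strict_mono_on J (\<lambda>t. a * \<gamma> t $ i) \<and>
     (\<forall>s\<in>J. \<forall>t\<in>J. sgn (\<gamma> s $ j) = sgn (\<gamma> t $ j)) \<and>
     (\<forall>t\<in>J. \<gamma> t $ i \<noteq> 0 \<or> \<gamma> t $ j = 0 \<longrightarrow>
        (\<gamma> has_vector_derivative velocity (\<gamma> t)) (at t within J))"
  (is "_ \<longleftrightarrow> ?R")
proof
  assume orbit: "orbit_curve W X Y J \<gamma>"
  then have J: "is_interval J" "J \<noteq> {}" "\<gamma> ` J \<subseteq> W" "continuous_on J \<gamma>"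
    and "\<forall>t\<in>J. regular_rule W X Y J \<gamma> t \<or> origin_rule W X Y J \<gamma> t"
    using not_boundary_rule by (auto simp: orbit_curve_def)
  then have rule: "regular_rule W X Y J \<gamma> t \<or> origin_rule W X Y J \<gamma> t" if "t \<in> J" for t
    using that by blast
  have cont: "continuous_on J (\<lambda>t. \<gamma> t $ k)" for k
    using J(4) by (intro continuous_intros)
  have deriv: "(\<gamma> has_vector_derivative velocity (\<gamma> t)) (at t within J)"
    if t: "t \<in> J" "\<gamma> t $ i \<noteq> 0 \<or> \<gamma> t $ j = 0" for t
    using rule[OF t(1)] t(2) unfolding regular_rule_iff origin_rule_iff velocity_def
    by (elim disjE conjE) auto
  have near: "\<forall>\<^sub>F s in at t within J. sgn (\<gamma> t $ j) = sgn (\<gamma> s $ j)" if t: "t \<in> J" for t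
  proof (cases "\<gamma> t $ j = 0")
    case True
    then have "\<forall>\<^sub>F s in at t within J. \<gamma> s \<in> insert 0 (slide_esc W X Y j)"
      using rule[OF t] unfolding regular_rule_iff origin_rule_iff
      by (elim disjE conjE) (auto elim: eventually_mono)
    then show ?thesis
      by (rule eventually_mono) (auto simp: True slide_esc_eq)
  next
    case False
    have lim: "((\<lambda>s. \<gamma> s $ j) \<longlongrightarrow> \<gamma> t $ j) (at t within J)"
      using cont t by (simp add: continuous_on_def)
    show ?thesis
    proof (cases "\<gamma> t $ j > 0")
      case True
      then show ?thesis
        using order_tendstoD(1)[OF lim True] by (auto elim!: eventually_mono)
    next
      case neg: False
      then have "\<gamma> t $ j < 0" using False by simp
      then show ?thesis
        using order_tendstoD(2)[OF lim, of 0] by (auto elim!: eventually_mono)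
    qed
  qed
  have sgn_const: "sgn (\<gamma> s $ j) = sgn (\<gamma> t $ j)" if "s \<in> J" "t \<in> J" for s t
    using connected_local_const[of J s t "\<lambda>t. sgn (\<gamma> t $ j)"] near that J(1)
    by (simp add: is_interval_connected_1)
  have increasing: "\<exists>d>0. ((\<lambda>t. a * \<gamma> t $ i) has_real_derivative d) (at t within J)"
    if t: "t \<in> J" "\<gamma> t $ i \<noteq> 0 \<or> \<gamma> t $ j = 0" for t
  proof (intro exI conjI)
    show "0 < a * velocity (\<gamma> t) $ i" using velocity_i J(3) t(1) by blast
    show "((\<lambda>t. a * \<gamma> t $ i) has_real_derivative a * velocity (\<gamma> t) $ i) (at t within J)"
      using deriv[OF t] by (intro DERIV_cmult)
        (simp add: has_vector_derivative_plane_iff has_real_derivative_iff_has_vector_derivative)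
  qed
  have contu: "continuous_on J (\<lambda>t. a * \<gamma> t $ i)"
    by (intro continuous_intros cont)
  have "strict_mono_on J (\<lambda>t. a * \<gamma> t $ i)"
  proof (cases "\<exists>t\<in>J. \<gamma> t $ j = 0")
    case True
    then have "\<gamma> t $ j = 0" if "t \<in> J" for t
      using sgn_const that by (metis sgn_zero_iff)
    then show ?thesis
      using increasing by (intro strict_mono_on_interval_except[OF J(1) contu, of 0]) auto
  next
    case False
    show ?thesis
    proof (rule strict_mono_on_interval_isolated_zeros[OF J(1) contu])
      fix t assume t: "t \<in> J" "a * \<gamma> t $ i = 0"
      have "(\<forall>\<^sub>F s in at t within J \<inter> {..<t}. \<gamma> s $ i * \<gamma> s $ j \<noteq> 0) \<and>
          (\<forall>\<^sub>F s in at t within J \<inter> {t<..}. \<gamma> s $ i * \<gamma> s $ j \<noteq> 0)"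
        using rule[OF t(1)] t False unfolding regular_rule_iff origin_rule_iff Uplus_eq Uminus_eq
        by (elim disjE conjE) (auto elim!: eventually_mono)
      then show "\<forall>\<^sub>F s in at t within J. a * \<gamma> s $ i \<noteq> 0"
        unfolding eventually_at_within_sides[symmetric] by (rule eventually_mono) auto
    qed (use increasing in auto)
  qed
  then show ?R using J sgn_const deriv by blast
next
  assume R: ?R
  then have J: "is_interval J" "J \<noteq> {}" "\<gamma> ` J \<subseteq> W" "continuous_on J \<gamma>"
    and mono: "strict_mono_on J (\<lambda>t. a * \<gamma> t $ i)"
    and sgn_const: "\<And>s t. s \<in> J \<Longrightarrow> t \<in> J \<Longrightarrow> sgn (\<gamma> s $ j) = sgn (\<gamma> t $ j)"
    and deriv: "\<And>t. t \<in> J \<Longrightarrow> \<gamma> t $ i \<noteq> 0 \<or> \<gamma> t $ j = 0 \<Longrightarrow>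
      (\<gamma> has_vector_derivative velocity (\<gamma> t)) (at t within J)"
    by blast+
  have "regular_rule W X Y J \<gamma> t \<or> origin_rule W X Y J \<gamma> t" if t: "t \<in> J" for t
  proof (cases "\<gamma> t $ j = 0")
    case True
    then have zero: "\<gamma> s $ j = 0" if "s \<in> J" for s
      using sgn_const[OF t that] by (simp add: sgn_zero_iff)
    have d: "(\<gamma> has_vector_derivative slide_field X Y j (\<gamma> t)) (at t within J)"
      using deriv[OF t] True by (simp add: velocity_def)
    show ?thesis
    proof (cases "\<gamma> t $ i = 0")
      case i0: True
      then have "\<gamma> t = 0" using True by (simp add: plane_eq_iff)
      moreover have "\<forall>\<^sub>F s in at t within J. \<gamma> s \<in> insert 0 (slide_esc W X Y j)"
        using zero J(3) by (intro eventually_at_withinI) (auto simp: slide_esc_eq plane_eq_iff)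
      ultimately show ?thesis using d by (auto simp: origin_rule_iff)
    next
      case False
      have "((\<lambda>s. \<gamma> s $ i) \<longlongrightarrow> \<gamma> t $ i) (at t within J)"
        using J(4) t by (auto simp: continuous_on_def intro!: tendsto_intros)
      then have "\<forall>\<^sub>F s in at t within J. \<gamma> s $ i \<noteq> 0"
        using False by (rule tendsto_imp_eventually_ne)
      moreover have "\<forall>\<^sub>F s in at t within J. s \<in> J"
        by (rule eventually_at_withinI)
      ultimately have "\<forall>\<^sub>F s in at t within J. \<gamma> s \<in> slide_esc W X Y j"
        by eventually_elim (use zero J(3) in \<open>auto simp: slide_esc_eq\<close>)
      then show ?thesis
        using d True False t J(3) by (auto simp: regular_rule_iff)
    qed
  next
    case j0: False
    show ?thesis
    proof (cases "\<gamma> t $ i = 0")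
      case False
      then consider "0 < \<gamma> t $ i * \<gamma> t $ j" | "\<gamma> t $ i * \<gamma> t $ j < 0"
        using j0 by (metis linorder_neqE_linordered_idom mult_eq_0_iff)
      then show ?thesis
      proof cases
        case 1
        then show ?thesis using deriv[OF t] False j0 t J(3)
          by (auto simp: regular_rule_iff velocity_def)
      next
        case 2
        then show ?thesis using deriv[OF t] False j0 t J(3)
          by (auto simp: regular_rule_iff velocity_def)
      qed
    next
      case True
      have sg: "sgn (a * \<gamma> s $ j) = sgn (a * \<gamma> t $ j)" if "s \<in> J" for s
        using sgn_const[OF that t] by (simp add: sgn_mult)
      have prod: "\<gamma> s $ i * \<gamma> s $ j = (a * \<gamma> s $ i) * (a * \<gamma> s $ j)" for s
        using a by auto
      have before: "a * \<gamma> s $ i < 0" if "s \<in> J" "s < t" for s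
        using strict_mono_onD[OF mono that(1) t that(2)] True by simp
      have after: "0 < a * \<gamma> s $ i" if "s \<in> J" "t < s" for s
        using strict_mono_onD[OF mono t that(1) that(2)] True by simp
      have "a * \<gamma> t $ j \<noteq> 0" using j0 by simp
      then consider "0 < a * \<gamma> t $ j" | "a * \<gamma> t $ j < 0" by (meson neqE)
      then show ?thesis
      proof cases
        case 1
        then have pos: "0 < a * \<gamma> s $ j" if "s \<in> J" for s
          using sg[OF that] by (metis sgn_greater)
        have "\<forall>\<^sub>F s in at t within J \<inter> {..<t}. \<gamma> s \<in> Uminus W"
          using J(3) by (intro eventually_at_withinI)
            (auto simp: Uminus_eq prod intro!: mult_neg_pos before pos)
        moreover have "\<forall>\<^sub>F s in at t within J \<inter> {t<..}. \<gamma> s \<in> Uplus W"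
          using J(3) by (intro eventually_at_withinI)
            (auto simp: Uplus_eq prod intro!: mult_pos_pos after pos)
        ultimately show ?thesis
          using True j0 t J(3) by (auto simp: regular_rule_iff)
      next
        case 2
        then have neg: "a * \<gamma> s $ j < 0" if "s \<in> J" for s
          using sg[OF that] by (metis sgn_less)
        have "\<forall>\<^sub>F s in at t within J \<inter> {..<t}. \<gamma> s \<in> Uplus W"
          using J(3) by (intro eventually_at_withinI)
            (auto simp: Uplus_eq prod intro!: mult_neg_neg before neg)
        moreover have "\<forall>\<^sub>F s in at t within J \<inter> {t<..}. \<gamma> s \<in> Uminus W"
          using J(3) by (intro eventually_at_withinI)
            (auto simp: Uminus_eq prod intro!: mult_pos_neg after neg)
        ultimately show ?thesis
          using True j0 t J(3) by (auto simp: regular_rule_iff)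
      qed
    qed
  qed
  then show "orbit_curve W X Y J \<gamma>"
    using J by (auto simp: orbit_curve_def)
qed

end

context transversal_system
begin

text \<open>
  An orbit without its time parametrisation, as the graph of \<open>y\<close> over \<open>s = a * x\<close>.
\<close>

definition orbit_graph :: "real set \<Rightarrow> (real \<Rightarrow> real) \<Rightarrow> bool" where
  "orbit_graph I y \<longleftrightarrow> is_interval I \<and> continuous_on I y \<and>
     (\<forall>s\<in>I. pt i (a * s) (y s) \<in> W) \<and> (\<forall>s\<in>I. \<forall>t\<in>I. sgn (y s) = sgn (y t)) \<and>
     (\<forall>s\<in>I. s \<noteq> 0 \<or> y s = 0 \<longrightarrow>
        (y has_real_derivative slope (pt i (a * s) (y s))) (at s within I))"

lemma orbit_curve_abscissa:
  assumes orbit: "orbit_curve W X Y J \<gamma>" and u_def: "u = (\<lambda>t. a * \<gamma> t $ i)"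
  shows "is_interval J" "continuous_on J u" "strict_mono_on J u"
    "\<And>t. t \<in> J \<Longrightarrow> u t \<noteq> 0 \<or> \<gamma> t $ j = 0 \<Longrightarrow>
       (u has_real_derivative a * velocity (\<gamma> t) $ i) (at t within J) \<and>
       ((\<lambda>t. \<gamma> t $ j) has_real_derivative velocity (\<gamma> t) $ j) (at t within J)"
    "\<And>t. pt i (a * u t) (\<gamma> t $ j) = \<gamma> t"
proof -
  have *: "is_interval J" "continuous_on J \<gamma>" "strict_mono_on J u"
    and d: "\<And>t. t \<in> J \<Longrightarrow> \<gamma> t $ i \<noteq> 0 \<or> \<gamma> t $ j = 0 \<Longrightarrow>
      (\<gamma> has_vector_derivative velocity (\<gamma> t)) (at t within J)"
    using orbit unfolding orbit_curve_iff u_def by blast+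
  show "is_interval J" "strict_mono_on J u" by fact+
  show "continuous_on J u"
    unfolding u_def by (intro continuous_intros *)
  show "pt i (a * u t) (\<gamma> t $ j) = \<gamma> t" for t
    by (simp add: u_def)
  show "(u has_real_derivative a * velocity (\<gamma> t) $ i) (at t within J) \<and>
       ((\<lambda>t. \<gamma> t $ j) has_real_derivative velocity (\<gamma> t) $ j) (at t within J)"
    if "t \<in> J" "u t \<noteq> 0 \<or> \<gamma> t $ j = 0" for t
  proof -
    have "\<gamma> t $ i \<noteq> 0 \<or> \<gamma> t $ j = 0" using that(2) by (auto simp: u_def)
    from d[OF that(1) this] have
      "((\<lambda>t. \<gamma> t $ i) has_real_derivative velocity (\<gamma> t) $ i) (at t within J)"
      "((\<lambda>t. \<gamma> t $ j) has_real_derivative velocity (\<gamma> t) $ j) (at t within J)"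
      by (simp_all add: has_vector_derivative_plane_iff has_real_derivative_iff_has_vector_derivative)
    then show ?thesis unfolding u_def by (intro conjI DERIV_cmult)
  qed
qed

lemma orbit_graph_of_curve:
  assumes orbit: "orbit_curve W X Y J \<gamma>"
  defines "u \<equiv> \<lambda>t. a * \<gamma> t $ i"
  shows "orbit_graph (u ` J) (\<lambda>s. \<gamma> (the_inv_into J u s) $ j)"
proof -
  have u_eq: "u = (\<lambda>t. a * \<gamma> t $ i)" by (simp add: u_def)
  note u = orbit_curve_abscissa[OF orbit u_eq]
  define R where "R = the_inv_into J u"
  note inv = strict_mono_interval_inverse[OF u(1-3), folded R_def]
  have curve: "\<gamma> ` J \<subseteq> W" "continuous_on J \<gamma>" "\<And>s t. s \<in> J \<Longrightarrow> t \<in> J \<Longrightarrow> sgn (\<gamma> s $ j) = sgn (\<gamma> t $ j)"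
    using orbit unfolding orbit_curve_iff by blast+
  have RJ: "R s \<in> J" "u (R s) = s" if "s \<in> u ` J" for s
    using inv(5)[OF that] by auto
  have pt: "pt i (a * s) (\<gamma> (R s) $ j) = \<gamma> (R s)" if "s \<in> u ` J" for s
    using u(5)[of "R s"] RJ(2)[OF that] by simp
  show ?thesis
    unfolding orbit_graph_def R_def[symmetric]
  proof (intro conjI ballI impI)
    show "is_interval (u ` J)" by (rule inv(1))
    have "continuous_on (u ` J) (\<lambda>s. \<gamma> (R s))"
      using curve(2) inv(2) by (rule continuous_on_compose2) (use RJ in auto)
    then show "continuous_on (u ` J) (\<lambda>s. \<gamma> (R s) $ j)"
      by (intro continuous_intros)
    show "pt i (a * s) (\<gamma> (R s) $ j) \<in> W" if "s \<in> u ` J" for s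
      using pt[OF that] RJ(1)[OF that] curve(1) by auto
    show "sgn (\<gamma> (R s) $ j) = sgn (\<gamma> (R t) $ j)" if "s \<in> u ` J" "t \<in> u ` J" for s t
      using RJ(1) that curve(3) by blast
    show "((\<lambda>s. \<gamma> (R s) $ j) has_real_derivative slope (pt i (a * s) (\<gamma> (R s) $ j)))
        (at s within u ` J)" if s: "s \<in> u ` J" "s \<noteq> 0 \<or> \<gamma> (R s) $ j = 0" for s
    proof -
      define t where "t = R s"
      have t: "t \<in> J" "u t = s" using RJ[OF s(1)] by (auto simp: t_def)
      have d: "(u has_real_derivative a * velocity (\<gamma> t) $ i) (at t within J)"
        "((\<lambda>t. \<gamma> t $ j) has_real_derivative velocity (\<gamma> t) $ j) (at t within J)"
        using u(4)[OF t(1)] s(2) t(2) by (auto simp: t_def)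
      have "a * velocity (\<gamma> t) $ i \<noteq> 0"
        using velocity_i[of "\<gamma> t"] curve(1) t(1) by force
      then have "(R has_real_derivative 1 / (a * velocity (\<gamma> t) $ i)) (at s within u ` J)"
        using inv(7)[OF t(1) d(1)] t(2) by simp
      moreover have "((\<lambda>t. \<gamma> t $ j) has_real_derivative velocity (\<gamma> t) $ j)
          (at (R s) within R ` u ` J)"
        using d(2) inv(6) by (simp add: t_def)
      ultimately have "((\<lambda>t. \<gamma> t $ j) \<circ> R has_real_derivative
          velocity (\<gamma> t) $ j * (1 / (a * velocity (\<gamma> t) $ i))) (at s within u ` J)"
        by (rule DERIV_image_chain[rotated])
      then show ?thesis
        using pt[OF s(1)] by (simp add: o_def slope_def t_def)
    qed
  qed
qed

text \<open>
  The time that an orbit needs is an antiderivative of the reciprocal of its horizontal speed.  At a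
  crossing the speed jumps.  The antiderivatives for the two fields are therefore formed on the whole
  interval and glued at \<open>s = 0\<close>.
\<close>

lemma orbit_graph_time:
  assumes graph: "orbit_graph I y"
  obtains T where "continuous_on I T" "strict_mono_on I T"
    "\<And>s. s \<in> I \<Longrightarrow> s \<noteq> 0 \<or> y s = 0 \<Longrightarrow>
       (T has_real_derivative 1 / (a * velocity (pt i (a * s) (y s)) $ i)) (at s within I)"
proof -
  note goal_thesis = that
  define \<sigma> where "\<sigma> s = pt i (a * s) (y s)" for s
  have I: "is_interval I" "continuous_on I y" and \<sigma>W: "\<And>s. s \<in> I \<Longrightarrow> \<sigma> s \<in> W"
    and sg: "\<And>s t. s \<in> I \<Longrightarrow> t \<in> I \<Longrightarrow> sgn (y s) = sgn (y t)"
    using graph unfolding orbit_graph_def \<sigma>_def by blast+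
  have "continuous_on I \<sigma>"
    unfolding \<sigma>_def by (intro continuous_intros I)
  then have cXY: "continuous_on I (\<lambda>s. X (\<sigma> s) $ k)" "continuous_on I (\<lambda>s. Y (\<sigma> s) $ k)" for k
    using continuous_on_compose2[OF X_cont, of I \<sigma>] continuous_on_compose2[OF Y_cont, of I \<sigma>] \<sigma>W
    by (auto intro!: continuous_intros)
  have pos: "0 < 1 / (a * velocity (\<sigma> s) $ i)" if "s \<in> I" for s
    using velocity_i[OF \<sigma>W[OF that]] by simp
  have finish: thesis
    if T: "continuous_on I T" "\<And>s. s \<in> I \<Longrightarrow> s \<noteq> 0 \<or> y s = 0 \<Longrightarrow>
       (T has_real_derivative 1 / (a * velocity (\<sigma> s) $ i)) (at s within I)" for T
  proof (rule goal_thesis[of T])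
    show "strict_mono_on I T"
      by (rule strict_mono_on_interval_except[OF I(1) T(1), of 0]) (use T(2) pos in blast)
  qed (use T in \<open>auto simp: \<sigma>_def\<close>)
  show thesis
  proof (cases "\<exists>s\<in>I. y s = 0")
    case True
    then have y0: "y s = 0" if "s \<in> I" for s
      using sg that by (metis sgn_zero_iff)
    have v: "a * velocity (\<sigma> s) $ i = a * ((Y (\<sigma> s) $ j * X (\<sigma> s) $ i - X (\<sigma> s) $ j * Y (\<sigma> s) $ i) /
        (Y (\<sigma> s) $ j - X (\<sigma> s) $ j))" if "s \<in> I" for s
      using y0[OF that] by (simp add: velocity_def slide_field_component \<sigma>_def)
    have "continuous_on I (\<lambda>s. a * ((Y (\<sigma> s) $ j * X (\<sigma> s) $ i - X (\<sigma> s) $ j * Y (\<sigma> s) $ i) /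
        (Y (\<sigma> s) $ j - X (\<sigma> s) $ j)))"
      using opposite_sign[OF \<sigma>W] by (intro continuous_intros cXY) force
    then have "continuous_on I (\<lambda>s. a * velocity (\<sigma> s) $ i)"
      by (rule continuous_on_eq) (simp add: v)
    then have "continuous_on I (\<lambda>s. 1 / (a * velocity (\<sigma> s) $ i))"
      using pos by (intro continuous_on_divide continuous_on_const) force+
    then obtain T where T: "\<And>s. s \<in> I \<Longrightarrow>
        (T has_real_derivative 1 / (a * velocity (\<sigma> s) $ i)) (at s within I)"
      using interval_antiderivative[OF I(1)] by blast
    then have "continuous_on I T"
      by (meson DERIV_continuous continuous_on_eq_continuous_within)
    then show thesis using finish T by blast
  next
    case False
    \<comment> \<open>\<open>F b\<close> is the field that governs the part of the graph on which \<open>s\<close> has the sign \<open>b\<close>.\<close>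
    define F where "F b = (if 0 < b * a * y (SOME s. s \<in> I) then X else Y)" for b :: real
    have vF: "velocity (\<sigma> s) = F b (\<sigma> s)" if s: "s \<in> I" "0 < b * s" for s b
    proof -
      have "(SOME s. s \<in> I) \<in> I" using s(1) by (rule someI)
      then have "sgn (y (SOME s. s \<in> I)) = sgn (y s)" using sg s(1) by blast
      moreover have "sgn b = sgn s" using s(2) by (auto simp: zero_less_mult_iff)
      ultimately have "sgn (b * a * y (SOME s. s \<in> I)) = sgn (a * s * y s)"
        by (simp add: sgn_mult)
      then have "0 < b * a * y (SOME s. s \<in> I) \<longleftrightarrow> 0 < a * s * y s"
        by (metis sgn_greater)
      then show ?thesis using False s(1) by (simp add: velocity_def F_def \<sigma>_def)
    qed
    have Fpos: "0 < a * F b (\<sigma> s) $ i" if "s \<in> I" for b s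
      using X_i[OF \<sigma>W[OF that]] Y_i[OF \<sigma>W[OF that]] by (simp add: F_def)
    have "continuous_on I (\<lambda>s. 1 / (a * F b (\<sigma> s) $ i))" for b
    proof (intro continuous_on_divide continuous_on_const continuous_on_mult ballI)
      show "continuous_on I (\<lambda>s. F b (\<sigma> s) $ i)" using cXY by (simp add: F_def)
      show "a * F b (\<sigma> s) $ i \<noteq> 0" if "s \<in> I" for s
        by (rule less_imp_neq[OF Fpos[OF that], THEN not_sym])
    qed
    then have "\<exists>S. \<forall>s\<in>I. (S has_real_derivative 1 / (a * F b (\<sigma> s) $ i)) (at s within I)" for b
      by (rule interval_antiderivative[OF I(1)]) blast
    then obtain S where S: "\<And>b s. s \<in> I \<Longrightarrow> (S b has_real_derivative 1 / (a * F b (\<sigma> s) $ i)) (at s within I)"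
      by metis
    have cS: "continuous_on I (S b)" for b
      using S by (meson DERIV_continuous continuous_on_eq_continuous_within)
    define T where "T s = (if 0 \<le> s then S 1 s - S 1 0 else S (- 1) s - S (- 1) 0)" for s
    have "continuous_on I (\<lambda>s. S b s - S b 0)" for b
      by (intro continuous_intros cS)
    then have *: "continuous_on (I \<inter> A) (\<lambda>s. S b s - S b 0)" for A b
      by (rule continuous_on_subset) auto
    have "continuous_on I T"
    proof (rule continuous_on_sign_split[where \<phi> = "\<lambda>s. s"])
      show "continuous_on (I \<inter> {s. 0 \<le> s}) T"
        by (rule continuous_on_eq[OF *[of _ 1]]) (simp add: T_def)
      show "continuous_on (I \<inter> {s. s \<le> 0}) T"
        by (rule continuous_on_eq[OF *[of _ "- 1"]]) (auto simp: T_def)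
    qed (intro continuous_intros)
    moreover have "(T has_real_derivative 1 / (a * velocity (\<sigma> s) $ i)) (at s within I)"
      if s: "s \<in> I" "s \<noteq> 0 \<or> y s = 0" for s
    proof -
      have s0: "s \<noteq> 0" using s False by auto
      define b where "b = sgn s"
      have "((\<lambda>s. S b s - S b 0) has_real_derivative 1 / (a * F b (\<sigma> s) $ i) - 0) (at s within I)"
        by (intro derivative_intros S s(1))
      moreover have "F b (\<sigma> s) = velocity (\<sigma> s)"
        using vF[OF s(1), of b] s0 by (auto simp: b_def sgn_if)
      ultimately have "((\<lambda>s. S b s - S b 0) has_real_derivative 1 / (a * velocity (\<sigma> s) $ i))
          (at s within I)" by simp
      then show ?thesis
        by (rule has_field_derivative_transform_within[where d = "\<bar>s\<bar>"])
           (use s0 s(1) in \<open>auto simp: T_def b_def dist_real_def sgn_if\<close>)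
    qed
    ultimately show thesis by (rule finish)
  qed
qed

text \<open>Running through a graph with the inverse of its time function gives the prescribed velocity.\<close>

lemma orbit_curve_of_graph:
  assumes graph: "orbit_graph I y" and "I \<noteq> {}"
    and T: "continuous_on I T" "strict_mono_on I T"
      "\<And>s. s \<in> I \<Longrightarrow> s \<noteq> 0 \<or> y s = 0 \<Longrightarrow>
         (T has_real_derivative 1 / (a * velocity (pt i (a * s) (y s)) $ i)) (at s within I)"
  defines "R \<equiv> the_inv_into I T"
  shows "orbit_curve W X Y (T ` I) (\<lambda>t. pt i (a * R t) (y (R t)))"
proof -
  have I: "is_interval I" "continuous_on I y" and W: "\<And>s. s \<in> I \<Longrightarrow> pt i (a * s) (y s) \<in> W"
    and sg: "\<And>s t. s \<in> I \<Longrightarrow> t \<in> I \<Longrightarrow> sgn (y s) = sgn (y t)"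
    and dy: "\<And>s. s \<in> I \<Longrightarrow> s \<noteq> 0 \<or> y s = 0 \<Longrightarrow>
      (y has_real_derivative slope (pt i (a * s) (y s))) (at s within I)"
    using graph unfolding orbit_graph_def by blast+
  note inv = strict_mono_interval_inverse[OF I(1) T(1,2), folded R_def]
  have RI: "R t \<in> I" if "t \<in> T ` I" for t using inv(5)[OF that] by blast
  show ?thesis
    unfolding orbit_curve_iff
  proof (intro conjI ballI impI)
    show "is_interval (T ` I)" by (rule inv(1))
    show "T ` I \<noteq> {}" using assms(2) by simp
    show "(\<lambda>t. pt i (a * R t) (y (R t))) ` (T ` I) \<subseteq> W" using RI W by auto
    have "continuous_on (T ` I) (\<lambda>t. y (R t))"
      using I(2) inv(2) by (rule continuous_on_compose2) (use RI in auto)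
    then show "continuous_on (T ` I) (\<lambda>t. pt i (a * R t) (y (R t)))"
      using inv(2) by (intro continuous_intros)
    show "strict_mono_on (T ` I) (\<lambda>t. a * pt i (a * R t) (y (R t)) $ i)"
      using inv(3) by simp
    show "sgn (pt i (a * R s) (y (R s)) $ j) = sgn (pt i (a * R t) (y (R t)) $ j)"
      if "s \<in> T ` I" "t \<in> T ` I" for s t
      using sg RI that by simp
    fix t assume t: "t \<in> T ` I"
      "pt i (a * R t) (y (R t)) $ i \<noteq> 0 \<or> pt i (a * R t) (y (R t)) $ j = 0"
    define s where "s = R t"
    have s: "s \<in> I" "T s = t" "s \<noteq> 0 \<or> y s = 0"
      using inv(5)[OF t(1)] t(2) by (auto simp: s_def)
    define v where "v = velocity (pt i (a * s) (y s))"
    have v: "a * v $ i \<noteq> 0"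
      unfolding v_def by (rule less_imp_neq[OF velocity_i[OF W[OF s(1)]], THEN not_sym])
    have R': "(R has_real_derivative a * v $ i) (at t within T ` I)"
      using inv(7)[OF s(1) T(3)[OF s(1,3)]] v s(2) by (simp add: v_def)
    have "(y has_real_derivative slope (pt i (a * s) (y s))) (at (R t) within R ` T ` I)"
      using dy[OF s(1,3)] inv(6) by (simp add: s_def)
    from DERIV_image_chain[OF this R'] have "((\<lambda>t. y (R t)) has_real_derivative v $ j) (at t within T ` I)"
      using v by (simp add: o_def slope_def flip: v_def)
    moreover have "((\<lambda>t. a * R t) has_real_derivative v $ i) (at t within T ` I)"
      using DERIV_cmult[OF R', of a] by simp
    ultimately show "((\<lambda>t. pt i (a * R t) (y (R t))) has_vector_derivative
        velocity (pt i (a * R t) (y (R t)))) (at t within T ` I)"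
      unfolding s_def[symmetric] v_def[symmetric]
      by (simp add: has_vector_derivative_plane_iff has_real_derivative_iff_has_vector_derivative)
  qed
qed

text \<open>
  A parametrised orbit whose graph can be continued can itself be continued: the time function of
  the larger graph inverts the given parametrisation up to an additive constant, since both have
  the same derivative except at the crossing time.
\<close>

lemma orbit_curve_extend:
  assumes orbit: "orbit_curve W X Y J \<gamma>" and graph: "orbit_graph I y"
    and sub: "(\<lambda>t. a * \<gamma> t $ i) ` J \<subseteq> I"
    and y: "\<And>t. t \<in> J \<Longrightarrow> y (a * \<gamma> t $ i) = \<gamma> t $ j"
  obtains J' \<gamma>' where "orbit_curve W X Y J' \<gamma>'" "J \<subseteq> J'" "\<And>t. t \<in> J \<Longrightarrow> \<gamma>' t = \<gamma> t"
    "(\<lambda>t. a * \<gamma>' t $ i) ` J' = I"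
proof -
  define u where "u = (\<lambda>t. a * \<gamma> t $ i)"
  note u = orbit_curve_abscissa[OF orbit u_def]
  have uI: "u t \<in> I" if "t \<in> J" for t using sub that by (auto simp: u_def)
  have J: "J \<noteq> {}" "\<gamma> ` J \<subseteq> W" using orbit by (auto simp: orbit_curve_def)
  then obtain t0 where t0: "t0 \<in> J" by blast
  have I: "is_interval I" using graph by (simp add: orbit_graph_def)
  obtain T where T: "continuous_on I T" "strict_mono_on I T"
    "\<And>s. s \<in> I \<Longrightarrow> s \<noteq> 0 \<or> y s = 0 \<Longrightarrow>
       (T has_real_derivative 1 / (a * velocity (pt i (a * s) (y s)) $ i)) (at s within I)"
    using orbit_graph_time[OF graph] by blast
  define T' where "T' s = T s - (T (u t0) - t0)" for s
  have T': "continuous_on I T'" "strict_mono_on I T'"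
    "\<And>s. s \<in> I \<Longrightarrow> s \<noteq> 0 \<or> y s = 0 \<Longrightarrow>
       (T' has_real_derivative 1 / (a * velocity (pt i (a * s) (y s)) $ i)) (at s within I)"
  proof -
    show "continuous_on I T'" unfolding T'_def by (intro continuous_intros T)
    show "strict_mono_on I T'"
      using T(2) by (auto simp: T'_def strict_mono_on_def)
    show "(T' has_real_derivative 1 / (a * velocity (pt i (a * s) (y s)) $ i)) (at s within I)"
      if "s \<in> I" "s \<noteq> 0 \<or> y s = 0" for s
      using DERIV_diff[OF T(3)[OF that] DERIV_const, of "T (u t0) - t0"] by (simp add: T'_def[abs_def])
  qed
  have T'u: "T' (u t) = t" if t: "t \<in> J" for t
  proof -
    have cont: "continuous_on J (\<lambda>t. T' (u t) - t)"
      by (intro continuous_intros continuous_on_compose2[OF T'(1) u(2)]) (use uI in auto)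
    obtain z where z: "\<And>x. x \<in> J \<Longrightarrow> x \<noteq> z \<Longrightarrow> u x \<noteq> 0"
      using strict_mono_on_imp_inj_on[OF u(3)] unfolding inj_on_def by metis
    have "T' (u t0) - t0 = T' (u t) - t"
    proof (rule constant_on_interval_except[OF u(1) cont _ t0 t])
      fix x assume x: "x \<in> J" "x \<noteq> z"
      have "a * velocity (\<gamma> x) $ i \<noteq> 0"
        using velocity_i[of "\<gamma> x"] J(2) x(1) by force
      moreover have "(T' has_real_derivative 1 / (a * velocity (\<gamma> x) $ i)) (at (u x) within u ` J)"
      proof (rule DERIV_subset)
        have "y (u x) = \<gamma> x $ j" using y[OF x(1)] by (simp add: u_def)
        then show "(T' has_real_derivative 1 / (a * velocity (\<gamma> x) $ i)) (at (u x) within I)"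
          using T'(3)[OF uI[OF x(1)]] z[OF x] u(5)[of x] by simp
      qed (use uI in auto)
      moreover have "(u has_real_derivative a * velocity (\<gamma> x) $ i) (at x within J)"
        using u(4)[OF x(1)] z[OF x] by blast
      ultimately have "(T' \<circ> u has_real_derivative 1) (at x within J)"
        using DERIV_image_chain[of T' "1 / (a * velocity (\<gamma> x) $ i)" u x J "a * velocity (\<gamma> x) $ i"]
        by simp
      from DERIV_diff[OF this DERIV_ident]
      show "((\<lambda>t. T' (u t) - t) has_real_derivative 0) (at x within J)"
        by (simp add: o_def)
    qed
    then show ?thesis by (simp add: T'_def)
  qed
  define R where "R = the_inv_into I T'"
  note inv = strict_mono_interval_inverse[OF I T'(1,2), folded R_def]
  show thesis
  proof (rule that)
    show "orbit_curve W X Y (T' ` I) (\<lambda>t. pt i (a * R t) (y (R t)))"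
      unfolding R_def using uI t0 by (intro orbit_curve_of_graph graph T') auto
    show "J \<subseteq> T' ` I" using T'u uI by (metis imageI subsetI)
    show "pt i (a * R t) (y (R t)) = \<gamma> t" if t: "t \<in> J" for t
    proof -
      have "R t = u t" using inv(4)[OF uI[OF t]] T'u[OF t] by simp
      then show ?thesis using y[OF t] u(5)[of t] by (simp add: u_def)
    qed
    show "(\<lambda>t. a * pt i (a * R t) (y (R t)) $ i) ` T' ` I = I"
      using inv(6) by simp
  qed
qed

lemma orbit_graph_curve_exists:
  assumes "orbit_graph I y" "I \<noteq> {}"
  obtains J \<gamma> where "orbit_curve W X Y J \<gamma>" "(\<lambda>t. a * \<gamma> t $ i) ` J = I"
    "\<And>t. t \<in> J \<Longrightarrow> y (a * \<gamma> t $ i) = \<gamma> t $ j"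
proof -
  obtain T where T: "continuous_on I T" "strict_mono_on I T"
    "\<And>s. s \<in> I \<Longrightarrow> s \<noteq> 0 \<or> y s = 0 \<Longrightarrow>
       (T has_real_derivative 1 / (a * velocity (pt i (a * s) (y s)) $ i)) (at s within I)"
    using orbit_graph_time[OF assms(1)] by blast
  have I: "is_interval I" using assms(1) by (simp add: orbit_graph_def)
  show thesis
    using that[OF orbit_curve_of_graph[OF assms T]] strict_mono_interval_inverse(6)[OF I T(1,2)]
    by simp
qed

end

section \<open>Transfer of trajectories between two systems\<close>

locale two_transversal_systems =
  A: transversal_system i j a W X Y + B: transversal_system i j a W' X' Y'
  for i j :: 2 and a :: real and W W' :: "(real^2) set" and X Y X' Y' :: vfield
begin

text \<open>
  A homeomorphism that preserves \<open>x\<close> acts on graphs without changing their parameter \<open>s\<close>.  If it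
  also respects the two notions of orbit graph, then an extension of the image of a maximal orbit
  is again a graph over a larger interval, its preimage is a graph that extends the original one, and
  by maximality nothing has been added.
\<close>

lemma trajectory_transfer:
  assumes homeo: "homeomorphism W W' h g" and h_i: "\<And>p. p \<in> W \<Longrightarrow> h p $ i = p $ i"
    and graphs: "\<And>I y y'. (\<And>s. s \<in> I \<Longrightarrow> pt i (a * s) (y s) \<in> W \<and>
        h (pt i (a * s) (y s)) = pt i (a * s) (y' s)) \<Longrightarrow>
      A.orbit_graph I y \<longleftrightarrow> B.orbit_graph I y'"
    and traj: "trajectory W X Y J \<gamma>"
  obtains J' \<gamma>' \<tau> where "trajectory W' X' Y' J' \<gamma>'" "strict_mono_on J \<tau>" "\<tau> ` J = J'"
    "\<And>t. t \<in> J \<Longrightarrow> h (\<gamma> t) = \<gamma>' (\<tau> t)"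
proof -
  have hg: "\<And>p. p \<in> W \<Longrightarrow> h p \<in> W' \<and> g (h p) = p" "\<And>q. q \<in> W' \<Longrightarrow> g q \<in> W \<and> h (g q) = q"
    using homeo by (auto simp: homeomorphism_def)
  have orbit: "orbit_curve W X Y J \<gamma>" and
    maximal: "\<And>J' \<gamma>'. orbit_curve W X Y J' \<gamma>' \<Longrightarrow> J \<subseteq> J' \<Longrightarrow> (\<And>t. t \<in> J \<Longrightarrow> \<gamma>' t = \<gamma> t) \<Longrightarrow> J' = J"
    using traj unfolding trajectory_def by blast+
  have J: "J \<noteq> {}" "\<And>t. t \<in> J \<Longrightarrow> \<gamma> t \<in> W" using orbit by (auto simp: orbit_curve_def)
  define u where "u = (\<lambda>t. a * \<gamma> t $ i)"
  note u = A.orbit_curve_abscissa[OF orbit u_def]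
  define R where "R = the_inv_into J u"
  note R = strict_mono_interval_inverse[OF u(1-3), folded R_def]
  define y where "y s = \<gamma> (R s) $ j" for s
  define y' where "y' s = h (pt i (a * s) (y s)) $ j" for s
  have graph: "A.orbit_graph (u ` J) y"
    using A.orbit_graph_of_curve[OF orbit] by (simp add: u_def R_def y_def[abs_def])
  have \<gamma>_eq: "pt i (a * u t) (y (u t)) = \<gamma> t" if "t \<in> J" for t
    using u(5)[of t] R(4)[OF that] by (simp add: y_def)
  have h\<gamma>: "h (\<gamma> t) = pt i (a * u t) (y' (u t))" if "t \<in> J" for t
    using h_i[OF J(2)[OF that]] \<gamma>_eq[OF that] by (simp add: A.plane_eq_iff y'_def u_def)
  have "B.orbit_graph (u ` J) y'"
  proof (rule iffD1[OF graphs graph])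
    fix s assume "s \<in> u ` J"
    then obtain t where t: "t \<in> J" "s = u t" by blast
    then show "pt i (a * s) (y s) \<in> W \<and> h (pt i (a * s) (y s)) = pt i (a * s) (y' s)"
      using h\<gamma>[OF t(1)] \<gamma>_eq[OF t(1)] J(2)[OF t(1)] by simp
  qed
  then obtain J' \<gamma>' where orbit': "orbit_curve W' X' Y' J' \<gamma>'"
    and uJ': "(\<lambda>t. a * \<gamma>' t $ i) ` J' = u ` J"
    and y'_eq: "\<And>t. t \<in> J' \<Longrightarrow> y' (a * \<gamma>' t $ i) = \<gamma>' t $ j"
    using J(1) by (elim B.orbit_graph_curve_exists) auto
  define u' where "u' = (\<lambda>t. a * \<gamma>' t $ i)"
  note u' = B.orbit_curve_abscissa[OF orbit' u'_def]
  define R' where "R' = the_inv_into J' u'"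
  note R' = strict_mono_interval_inverse[OF u'(1-3), folded R'_def]
  have uJ: "u' ` J' = u ` J" using uJ' by (simp add: u'_def)
  define \<tau> where "\<tau> t = R' (u t)" for t
  have \<tau>: "\<tau> t \<in> J'" "u' (\<tau> t) = u t" if "t \<in> J" for t
    using R'(5)[of "u t"] that uJ by (auto simp: \<tau>_def)
  have h_\<tau>: "h (\<gamma> t) = \<gamma>' (\<tau> t)" if t: "t \<in> J" for t
  proof -
    have "y' (u t) = \<gamma>' (\<tau> t) $ j"
      using y'_eq[OF \<tau>(1)[OF t]] \<tau>(2)[OF t] by (simp add: u'_def)
    then show ?thesis
      using h\<gamma>[OF t] u'(5)[of "\<tau> t"] \<tau>(2)[OF t] by simp
  qed
  have \<tau>J: "\<tau> ` J = J'"
    using R'(6) uJ by (simp add: \<tau>_def[abs_def] flip: image_image)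
  have "strict_mono_on J \<tau>"
  proof (rule strict_mono_onI)
    fix s t assume st: "s \<in> J" "t \<in> J" "s < t"
    then have "u s < u t" using u(3) by (simp add: strict_mono_onD)
    then show "\<tau> s < \<tau> t"
      using R'(3) st uJ unfolding \<tau>_def by (intro strict_mono_onD[OF R'(3)]) auto
  qed
  moreover have "trajectory W' X' Y' J' \<gamma>'"
    unfolding trajectory_def
  proof (intro conjI allI impI orbit')
    fix J2 \<gamma>2
    assume "orbit_curve W' X' Y' J2 \<gamma>2 \<and> J' \<subseteq> J2 \<and> (\<forall>t\<in>J'. \<gamma>2 t = \<gamma>' t)"
    then have orbit2: "orbit_curve W' X' Y' J2 \<gamma>2" and sub: "J' \<subseteq> J2"
      and eq: "\<And>t. t \<in> J' \<Longrightarrow> \<gamma>2 t = \<gamma>' t" by auto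
    define u2 where "u2 = (\<lambda>t. a * \<gamma>2 t $ i)"
    note u2 = B.orbit_curve_abscissa[OF orbit2 u2_def]
    define R2 where "R2 = the_inv_into J2 u2"
    note R2 = strict_mono_interval_inverse[OF u2(1-3), folded R2_def]
    define y2 where "y2 s = \<gamma>2 (R2 s) $ j" for s
    have graph2: "B.orbit_graph (u2 ` J2) y2"
      using B.orbit_graph_of_curve[OF orbit2] by (simp add: u2_def R2_def y2_def[abs_def])
    have u2_eq: "u2 t = u' t" if "t \<in> J'" for t
      using eq[OF that] by (simp add: u2_def u'_def)
    define z where "z s = g (pt i (a * s) (y2 s)) $ j" for s
    have "A.orbit_graph (u2 ` J2) z"
    proof (rule iffD2[OF graphs graph2])
      fix s assume "s \<in> u2 ` J2"
      then have "pt i (a * s) (y2 s) \<in> W'"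
        using graph2 unfolding B.orbit_graph_def by blast
      then have g: "g (pt i (a * s) (y2 s)) \<in> W" "h (g (pt i (a * s) (y2 s))) = pt i (a * s) (y2 s)"
        using hg by auto
      moreover have "g (pt i (a * s) (y2 s)) = pt i (a * s) (z s)"
        using h_i[OF g(1)] g(2) by (simp add: A.plane_eq_iff z_def)
      ultimately show "pt i (a * s) (z s) \<in> W \<and> h (pt i (a * s) (z s)) = pt i (a * s) (y2 s)"
        by simp
    qed
    moreover have "u ` J \<subseteq> u2 ` J2"
      using uJ u2_eq sub by force
    moreover have "z (u t) = \<gamma> t $ j" if t: "t \<in> J" for t
    proof -
      have "u2 (\<tau> t) = u t" using u2_eq \<tau>[OF t] by simp
      then have "R2 (u t) = \<tau> t" using R2(4)[of "\<tau> t"] \<tau>(1)[OF t] sub by auto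
      then have "pt i (a * u t) (y2 (u t)) = pt i (a * u' (\<tau> t)) (\<gamma>' (\<tau> t) $ j)"
        using eq \<tau>[OF t] by (simp add: y2_def)
      also have "\<dots> = h (\<gamma> t)" using u'(5) h_\<tau>[OF t] by simp
      finally show ?thesis using hg(1)[OF J(2)[OF t]] by (simp add: z_def)
    qed
    ultimately obtain J3 \<gamma>3 where J3: "orbit_curve W X Y J3 \<gamma>3" "J \<subseteq> J3"
      "\<And>t. t \<in> J \<Longrightarrow> \<gamma>3 t = \<gamma> t" "(\<lambda>t. a * \<gamma>3 t $ i) ` J3 = u2 ` J2"
      using A.orbit_curve_extend[OF orbit, of "u2 ` J2" z] unfolding u_def by metis
    have "J3 = J" using maximal[OF J3(1-3)] .
    then have "u2 ` J2 = u ` J"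
      using J3(3,4) by (simp add: u_def)
    also have "\<dots> = u2 ` J'" using uJ u2_eq by auto
    finally show "J2 = J'"
      using strict_mono_on_imp_inj_on[OF u2(3)] sub by (meson inj_on_image_eq_iff order_refl)
  qed
  ultimately show thesis using that \<tau>J h_\<tau> by blast
qed

end

section \<open>Straightening a system by its orbit labels\<close>

text \<open>
  Quadrants are indexed by the signs \<open>e1\<close> of \<open>x\<close> and \<open>e2\<close> of \<open>y\<close>.  In the coordinates \<open>\<bar>x\<bar>\<close> and \<open>\<bar>y\<bar>\<close> the
  orbits in a quadrant solve the equation with right-hand side \<open>f e1 e2\<close>, and \<open>C e1 e2\<close> labels these
  solutions.
\<close>

locale integrable_system = transversal_system +
  fixes f C :: "real \<Rightarrow> real \<Rightarrow> real \<Rightarrow> real \<Rightarrow> real" and d :: real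
  assumes W_bounded: "p \<in> W \<Longrightarrow> \<bar>p $ i\<bar> \<le> d"
    and f_slope: "p \<in> W \<Longrightarrow> p $ i \<noteq> 0 \<Longrightarrow> p $ j \<noteq> 0 \<Longrightarrow>
      f (sgn (p $ i)) (sgn (p $ j)) \<bar>p $ i\<bar> \<bar>p $ j\<bar> = sgn (p $ i) * sgn (p $ j) * (a * slope p)"
    and C_solves: "\<bar>e1\<bar> = 1 \<Longrightarrow> \<bar>e2\<bar> = 1 \<Longrightarrow> is_interval I \<Longrightarrow> I \<subseteq> {0..d} \<Longrightarrow>
      (\<And>x. x \<in> I \<Longrightarrow> 0 \<le> y x) \<Longrightarrow>
      solves (f e1 e2) I y \<longleftrightarrow> (\<forall>p\<in>I. \<forall>q\<in>I. C e1 e2 p (y p) = C e1 e2 q (y q))"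
    and C_y_axis: "\<bar>e1\<bar> = 1 \<Longrightarrow> \<bar>e2\<bar> = 1 \<Longrightarrow> 0 \<le> y0 \<Longrightarrow> C e1 e2 0 y0 = y0"
    and C_x_axis: "\<bar>e1\<bar> = 1 \<Longrightarrow> \<bar>e2\<bar> = 1 \<Longrightarrow> x0 \<in> {0..d} \<Longrightarrow> C e1 e2 x0 0 = - x0"
    and C_strict_mono: "\<bar>e1\<bar> = 1 \<Longrightarrow> \<bar>e2\<bar> = 1 \<Longrightarrow> x0 \<in> {0..d} \<Longrightarrow> 0 \<le> y1 \<Longrightarrow> y1 < y2 \<Longrightarrow>
      C e1 e2 x0 y1 < C e1 e2 x0 y2"
    and C_continuous: "\<bar>e1\<bar> = 1 \<Longrightarrow> \<bar>e2\<bar> = 1 \<Longrightarrow>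
      continuous_on ({0..d} \<times> {0..}) (\<lambda>(x, y). C e1 e2 x y)"
begin

text \<open>
  Unlike \<open>sgn\<close>, this never vanishes: a point on an axis is assigned to one of the adjacent quadrants.
\<close>

definition sign :: "real \<Rightarrow> real" where
  "sign x = (if 0 \<le> x then 1 else - 1)"

definition label :: "real^2 \<Rightarrow> real" where
  "label p = C (sign (p $ i)) (sign (p $ j)) \<bar>p $ i\<bar> \<bar>p $ j\<bar>"

lemma abs_sign [simp]: "\<bar>sign x\<bar> = 1"
  by (simp add: sign_def)

text \<open>
  At a point of \<open>x = 0\<close> the label is \<open>\<bar>y\<bar>\<close> in either adjacent quadrant, so there the choice of \<open>e\<close> is free.
\<close>

lemma label_eq:
  assumes "\<bar>e\<bar> = 1" "0 \<le> e * p $ i" "p $ j \<noteq> 0"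
  shows "label p = C e (sgn (p $ j)) \<bar>p $ i\<bar> \<bar>p $ j\<bar>"
proof (cases "p $ i = 0")
  case True
  then show ?thesis using assms(1,3) by (simp add: label_def C_y_axis abs_sgn_eq)
next
  case False
  then have "sign (p $ i) = e" using assms(1,2) by (auto simp: sign_def abs_if split: if_splits)
  moreover have "sign (p $ j) = sgn (p $ j)" using assms(3) by (simp add: sign_def sgn_if)
  ultimately show ?thesis by (simp add: label_def)
qed

text \<open>
  The part of a graph with \<open>0 \<le> e * s\<close> lies in one closed quadrant, and the substitution \<open>u = e * s\<close>
  turns it into a solution of the scalar equation of that quadrant.
\<close>

lemma half_graph_solves_iff:
  assumes I: "is_interval I" "continuous_on I y" and W: "\<And>s. s \<in> I \<Longrightarrow> pt i (a * s) (y s) \<in> W"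
    and \<epsilon>: "\<And>s. s \<in> I \<Longrightarrow> sgn (y s) = \<epsilon>" "\<bar>\<epsilon>\<bar> = 1" and e: "\<bar>e\<bar> = 1"
  defines "I\<^sub>e \<equiv> {u. 0 \<le> u \<and> e * u \<in> I}"
  shows "(\<forall>s\<in>I. 0 < e * s \<longrightarrow>
      (y has_real_derivative slope (pt i (a * s) (y s))) (at s within I)) \<longleftrightarrow>
    solves (f (a * e) \<epsilon>) I\<^sub>e (\<lambda>u. \<bar>y (e * u)\<bar>)"
proof -
  have ee: "e * e = 1" "e * (e * x) = x" for x using e by (auto simp: abs_if split: if_splits)
  have \<epsilon>\<epsilon>: "\<epsilon> * \<epsilon> = 1" "\<epsilon> * (\<epsilon> * x) = x" for x using \<epsilon>(2) by (auto simp: abs_if split: if_splits)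
  have aa: "\<bar>a\<bar> = 1" using a by auto
  have abs_y: "\<bar>y s\<bar> = \<epsilon> * y s" if "s \<in> I" for s
    using \<epsilon>(1)[OF that] by (simp add: abs_sgn mult.commute)
  have rate: "f (a * e) \<epsilon> u \<bar>y (e * u)\<bar> = e * \<epsilon> * slope (pt i (a * (e * u)) (y (e * u)))"
    if u: "0 < u" "e * u \<in> I" for u
  proof -
    have y: "sgn (y (e * u)) = \<epsilon>" "y (e * u) \<noteq> 0" using \<epsilon>(1)[OF u(2)] \<epsilon>(2) by auto
    have "sgn (a * (e * u)) = a * e" "\<bar>a * (e * u)\<bar> = u" "a * (e * u) \<noteq> 0"
      using u(1) e aa by (auto simp: sgn_mult abs_mult abs_if split: if_splits)
    then show ?thesis
      using f_slope[OF W[OF u(2)]] y by (simp add: mult.assoc)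
  qed
  have sub: "(\<lambda>u. e * u) ` I\<^sub>e \<subseteq> I" by (auto simp: I\<^sub>e_def)
  have cont: "continuous_on I\<^sub>e (\<lambda>u. \<bar>y (e * u)\<bar>)"
    by (intro continuous_intros continuous_on_compose2[OF I(2)] sub)
  show ?thesis
  proof (intro iffI)
    assume D: "\<forall>s\<in>I. 0 < e * s \<longrightarrow>
      (y has_real_derivative slope (pt i (a * s) (y s))) (at s within I)"
    show "solves (f (a * e) \<epsilon>) I\<^sub>e (\<lambda>u. \<bar>y (e * u)\<bar>)"
      unfolding solves_def
    proof (intro conjI cont ballI)
      fix u assume "u \<in> I\<^sub>e - {0}"
      then have u: "0 < u" "e * u \<in> I" "u \<in> I\<^sub>e" by (auto simp: I\<^sub>e_def)
      have "0 < e * (e * u)" using u(1) by (simp add: ee)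
      then have "(y has_real_derivative slope (pt i (a * (e * u)) (y (e * u)))) (at (e * u) within I)"
        using D u(2) by blast
      then have "(y has_real_derivative slope (pt i (a * (e * u)) (y (e * u))))
          (at (e * u) within (\<lambda>u. e * u) ` I\<^sub>e)"
        using sub by (rule DERIV_subset)
      moreover have "((\<lambda>u. e * u) has_real_derivative e) (at u within I\<^sub>e)"
        using DERIV_cmult[OF DERIV_ident, of e] by simp
      ultimately have "(y \<circ> (\<lambda>u. e * u) has_real_derivative
          slope (pt i (a * (e * u)) (y (e * u))) * e) (at u within I\<^sub>e)"
        by (rule DERIV_image_chain)
      from DERIV_cmult[OF this, of \<epsilon>] have "((\<lambda>u. \<epsilon> * y (e * u)) has_real_derivative
          f (a * e) \<epsilon> u \<bar>y (e * u)\<bar>) (at u within I\<^sub>e)"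
        by (simp add: o_def rate[OF u(1,2)] mult_ac)
      then show "((\<lambda>u. \<bar>y (e * u)\<bar>) has_real_derivative f (a * e) \<epsilon> u \<bar>y (e * u)\<bar>) (at u within I\<^sub>e)"
        by (rule has_field_derivative_transform_within[where d = 1])
           (use u(3) abs_y in \<open>auto simp: I\<^sub>e_def\<close>)
    qed
  next
    assume S: "solves (f (a * e) \<epsilon>) I\<^sub>e (\<lambda>u. \<bar>y (e * u)\<bar>)"
    show "\<forall>s\<in>I. 0 < e * s \<longrightarrow>
      (y has_real_derivative slope (pt i (a * s) (y s))) (at s within I)"
    proof (intro ballI impI)
      fix s assume s: "s \<in> I" "0 < e * s"
      define I' where "I' = I \<inter> {s. 0 < e * s}"
      have sub': "(\<lambda>s. e * s) ` I' \<subseteq> I\<^sub>e" by (auto simp: I'_def I\<^sub>e_def ee)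
      have "e * s \<in> I\<^sub>e - {0}" using s by (auto simp: I\<^sub>e_def ee)
      then have "((\<lambda>u. \<bar>y (e * u)\<bar>) has_real_derivative f (a * e) \<epsilon> (e * s) \<bar>y (e * (e * s))\<bar>)
          (at (e * s) within I\<^sub>e)"
        using S unfolding solves_def by blast
      then have "((\<lambda>u. \<bar>y (e * u)\<bar>) has_real_derivative f (a * e) \<epsilon> (e * s) \<bar>y (e * (e * s))\<bar>)
          (at (e * s) within (\<lambda>s. e * s) ` I')"
        using sub' by (rule DERIV_subset)
      moreover have "((\<lambda>s. e * s) has_real_derivative e) (at s within I')"
        using DERIV_cmult[OF DERIV_ident, of e] by simp
      ultimately have "((\<lambda>u. \<bar>y (e * u)\<bar>) \<circ> (\<lambda>s. e * s) has_real_derivative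
          f (a * e) \<epsilon> (e * s) \<bar>y (e * (e * s))\<bar> * e) (at s within I')"
        by (rule DERIV_image_chain)
      moreover have "f (a * e) \<epsilon> (e * s) \<bar>y (e * (e * s))\<bar> = e * \<epsilon> * slope (pt i (a * s) (y s))"
        using rate[OF s(2)] s(1) by (simp add: ee)
      ultimately have "((\<lambda>s. \<bar>y s\<bar>) has_real_derivative e * \<epsilon> * slope (pt i (a * s) (y s)) * e)
          (at s within I')"
        by (simp add: o_def ee)
      from DERIV_cmult[OF this, of \<epsilon>]
      have "((\<lambda>s. \<epsilon> * \<bar>y s\<bar>) has_real_derivative slope (pt i (a * s) (y s))) (at s within I')"
        by (simp add: ee \<epsilon>\<epsilon> mult_ac)
      then have "(y has_real_derivative slope (pt i (a * s) (y s))) (at s within I')"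
        by (rule has_field_derivative_transform_within[where d = 1])
           (use s abs_y \<epsilon>\<epsilon> in \<open>auto simp: I'_def\<close>)
      moreover have "at s within I' = at s within I"
      proof (rule at_within_nhd)
        show "open {s. 0 < e * s}" by (intro open_Collect_less continuous_intros)
      qed (use s in \<open>auto simp: I'_def\<close>)
      ultimately show "(y has_real_derivative slope (pt i (a * s) (y s))) (at s within I)"
        by simp
    qed
  qed
qed

text \<open>
  Each half of a graph off the axis \<open>y = 0\<close> is an orbit if and only if its label is constant.  If both
  halves are present, the graph contains a point with \<open>s = 0\<close>, which belongs to both, so the two
  constants agree.
\<close>

lemma orbit_graph_iff_label:
  "orbit_graph I y \<longleftrightarrow> is_interval I \<and> continuous_on I y \<and>
     (\<forall>s\<in>I. pt i (a * s) (y s) \<in> W) \<and> (\<forall>s\<in>I. \<forall>t\<in>I. sgn (y s) = sgn (y t)) \<and>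
     (\<forall>s\<in>I. \<forall>t\<in>I. y s \<noteq> 0 \<longrightarrow> label (pt i (a * s) (y s)) = label (pt i (a * t) (y t)))"
  (is "_ \<longleftrightarrow> _ \<and> _ \<and> _ \<and> _ \<and> ?L")
proof -
  define D where "D s \<longleftrightarrow> (y has_real_derivative slope (pt i (a * s) (y s))) (at s within I)" for s
  have "(\<forall>s\<in>I. s \<noteq> 0 \<or> y s = 0 \<longrightarrow> D s) \<longleftrightarrow> ?L"
    if I: "is_interval I" "continuous_on I y" and W: "\<forall>s\<in>I. pt i (a * s) (y s) \<in> W"
      and sg: "\<forall>s\<in>I. \<forall>t\<in>I. sgn (y s) = sgn (y t)"
  proof (cases "\<exists>s\<in>I. y s = 0")
    case True
    then have y0: "y s = 0" if "s \<in> I" for s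
      using sg that by (metis sgn_zero_iff)
    have "D s" if s: "s \<in> I" for s
    proof -
      have "slope (pt i (a * s) (y s)) = 0"
        by (simp add: slope_def velocity_def y0[OF s] slide_field_component)
      moreover have "(y has_real_derivative 0) (at s within I)"
        by (rule has_field_derivative_transform_within[OF DERIV_const[of 0], of 1])
           (use y0 s in auto)
      ultimately show ?thesis by (simp add: D_def)
    qed
    then show ?thesis using y0 by blast
  next
    case nz: False
    define \<epsilon> where "\<epsilon> = sgn (y (SOME s. s \<in> I))"
    have \<epsilon>: "sgn (y s) = \<epsilon>" if "s \<in> I" for s
      unfolding \<epsilon>_def using sg that someI[of "\<lambda>s. s \<in> I", OF that] by blast
    define \<sigma> where "\<sigma> s = pt i (a * s) (y s)" for s
    have half: "(\<forall>s\<in>I. 0 < e * s \<longrightarrow> D s) \<longleftrightarrow>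
        (\<forall>s\<in>I. \<forall>t\<in>I. 0 \<le> e * s \<and> 0 \<le> e * t \<longrightarrow> label (\<sigma> s) = label (\<sigma> t))"
      if e: "\<bar>e\<bar> = 1" for e
    proof (cases "I = {}")
      case False
      then obtain r where "r \<in> I" by blast
      then have "y r \<noteq> 0" "sgn (y r) = \<epsilon>" using nz \<epsilon> by auto
      then have \<epsilon>1: "\<bar>\<epsilon>\<bar> = 1" by (auto simp: sgn_if)
      define I\<^sub>e where "I\<^sub>e = {u. 0 \<le> u \<and> e * u \<in> I}"
      have ee: "e * (e * x) = x" for x using e by (auto simp: abs_if split: if_splits)
      have aa: "\<bar>a\<bar> = 1" using a by auto
      have ae: "\<bar>a * e\<bar> = 1" by (simp add: abs_mult aa e)
      have abs_ae: "\<bar>a * (e * x)\<bar> = \<bar>x\<bar>" for x by (simp add: abs_mult aa e)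
      have lab: "label (\<sigma> (e * u)) = C (a * e) \<epsilon> u \<bar>y (e * u)\<bar>" if u: "u \<in> I\<^sub>e" for u
      proof -
        have u': "e * u \<in> I" "0 \<le> u" using u by (auto simp: I\<^sub>e_def)
        have "(a * e) * (a * (e * u)) = (a * a) * (e * (e * u))" by (simp only: mult_ac)
        then have "(a * e) * (a * (e * u)) = u" by (simp only: ee a_square mult_1_left)
        then have "0 \<le> (a * e) * \<sigma> (e * u) $ i" using u'(2) by (simp only: \<sigma>_def pt_nth)
        moreover have "\<sigma> (e * u) $ j \<noteq> 0" using nz u'(1) by (auto simp: \<sigma>_def)
        moreover have "\<bar>\<sigma> (e * u) $ i\<bar> = u" using abs_ae[of u] u'(2) by (simp add: \<sigma>_def)
        moreover have "\<sigma> (e * u) $ j = y (e * u)" by (simp add: \<sigma>_def)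
        ultimately show ?thesis
          using label_eq[OF ae, of "\<sigma> (e * u)"] \<epsilon>[OF u'(1)] by simp
      qed
      have Ie_int: "is_interval I\<^sub>e"
        unfolding is_interval_1
      proof (intro ballI allI impI)
        fix p q x assume pq: "p \<in> I\<^sub>e" "q \<in> I\<^sub>e" "p \<le> x \<and> x \<le> q"
        then have "e * x \<in> {e * p..e * q} \<or> e * x \<in> {e * q..e * p}"
          using e by (auto simp: abs_if split: if_splits)
        then show "x \<in> I\<^sub>e"
          using pq interval_segment_subset[OF I(1), of "e * p" "e * q"]
            interval_segment_subset[OF I(1), of "e * q" "e * p"] by (auto simp: I\<^sub>e_def)
      qed
      have Ie_d: "I\<^sub>e \<subseteq> {0..d}"
      proof
        fix u assume u: "u \<in> I\<^sub>e"
        then have "pt i (a * (e * u)) (y (e * u)) \<in> W" using W by (simp add: I\<^sub>e_def)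
        from W_bounded[OF this] have "\<bar>u\<bar> \<le> d" by (simp add: abs_ae)
        then show "u \<in> {0..d}" using u by (simp add: I\<^sub>e_def)
      qed
      have "(\<forall>s\<in>I. 0 < e * s \<longrightarrow> D s) \<longleftrightarrow> solves (f (a * e) \<epsilon>) I\<^sub>e (\<lambda>u. \<bar>y (e * u)\<bar>)"
        unfolding D_def I\<^sub>e_def using W \<epsilon> \<epsilon>1 e by (intro half_graph_solves_iff I) auto
      also have "\<dots> \<longleftrightarrow> (\<forall>u\<in>I\<^sub>e. \<forall>v\<in>I\<^sub>e. label (\<sigma> (e * u)) = label (\<sigma> (e * v)))"
        by (simp add: C_solves[OF ae \<epsilon>1 Ie_int Ie_d] lab)
      also have "\<dots> \<longleftrightarrow> (\<forall>s\<in>I. \<forall>t\<in>I. 0 \<le> e * s \<and> 0 \<le> e * t \<longrightarrow> label (\<sigma> s) = label (\<sigma> t))"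
        (is "?U \<longleftrightarrow> ?V")
      proof
        assume U: ?U
        show ?V
        proof (intro ballI impI)
          fix s t assume "s \<in> I" "t \<in> I" "0 \<le> e * s \<and> 0 \<le> e * t"
          then have "e * s \<in> I\<^sub>e" "e * t \<in> I\<^sub>e" by (auto simp: I\<^sub>e_def ee)
          then have "label (\<sigma> (e * (e * s))) = label (\<sigma> (e * (e * t)))" using U by blast
          then show "label (\<sigma> s) = label (\<sigma> t)" by (simp only: ee)
        qed
      next
        assume ?V then show ?U by (auto simp: I\<^sub>e_def ee)
      qed
      finally show ?thesis .
    qed simp
    have "(\<forall>s\<in>I. s \<noteq> 0 \<or> y s = 0 \<longrightarrow> D s) \<longleftrightarrow>
        (\<forall>s\<in>I. 0 < 1 * s \<longrightarrow> D s) \<and> (\<forall>s\<in>I. 0 < (- 1) * s \<longrightarrow> D s)"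
      using nz by (auto simp: neq_iff)
    also have "\<dots> \<longleftrightarrow> (\<forall>s\<in>I. \<forall>t\<in>I. label (\<sigma> s) = label (\<sigma> t))"
    proof -
      have "label (\<sigma> s) = label (\<sigma> t)"
        if H: "\<forall>s\<in>I. \<forall>t\<in>I. 0 \<le> s \<and> 0 \<le> t \<longrightarrow> label (\<sigma> s) = label (\<sigma> t)"
          "\<forall>s\<in>I. \<forall>t\<in>I. s \<le> 0 \<and> t \<le> 0 \<longrightarrow> label (\<sigma> s) = label (\<sigma> t)"
          and st: "s \<in> I" "t \<in> I" for s t
      proof (cases "0 \<le> s \<longleftrightarrow> 0 \<le> t")
        case True
        then have "0 \<le> s \<and> 0 \<le> t \<or> s \<le> 0 \<and> t \<le> 0" by linarith
        then show ?thesis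
          using bspec[OF bspec[OF H(1) st(1)] st(2)] bspec[OF bspec[OF H(2) st(1)] st(2)] by blast
      next
        case False
        then have "0 \<in> {s..t} \<or> 0 \<in> {t..s}" by auto
        then have zero: "0 \<in> I"
          using interval_segment_subset[OF I(1) st] interval_segment_subset[OF I(1) st(2,1)] by blast
        have "label (\<sigma> r) = label (\<sigma> 0)" if "r \<in> I" for r
        proof (cases "0 \<le> r")
          case True
          then show ?thesis using bspec[OF bspec[OF H(1) that] zero] by simp
        next
          case False
          then show ?thesis using bspec[OF bspec[OF H(2) that] zero] by simp
        qed
        then show ?thesis using st by simp
      qed
      moreover have "(\<forall>s\<in>I. 0 < 1 * s \<longrightarrow> D s) \<longleftrightarrow>
          (\<forall>s\<in>I. \<forall>t\<in>I. 0 \<le> s \<and> 0 \<le> t \<longrightarrow> label (\<sigma> s) = label (\<sigma> t))"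
        using half[of 1] by simp
      moreover have "(\<forall>s\<in>I. 0 < (- 1) * s \<longrightarrow> D s) \<longleftrightarrow>
          (\<forall>s\<in>I. \<forall>t\<in>I. s \<le> 0 \<and> t \<le> 0 \<longrightarrow> label (\<sigma> s) = label (\<sigma> t))"
        using half[of "- 1"] by simp
      ultimately show ?thesis by blast
    qed
    also have "\<dots> \<longleftrightarrow> ?L" using nz by (auto simp: \<sigma>_def)
    finally show ?thesis .
  qed
  then show ?thesis unfolding orbit_graph_def D_def by blast
qed

end

context axes
begin

text \<open>
  For \<open>q \<noteq> p\<close>, the segment from \<open>q - p\<close> to \<open>h q - h p\<close> avoids \<open>0\<close>: its end points have the same
  \<open>x\<close>-coordinate, and if that vanishes, their \<open>y\<close>-coordinates have the same strict sign.  Hence the image of a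
  circle, seen from the image of the centre, is homotopic to the circle seen from its centre.
\<close>

lemma orientation_preserving_of_monotone:
  fixes h :: vfield
  assumes cont: "continuous_on W h" and h_i: "\<And>p. p \<in> W \<Longrightarrow> h p $ i = p $ i"
    and mono: "\<And>p q. p \<in> W \<Longrightarrow> q \<in> W \<Longrightarrow> p $ i = q $ i \<Longrightarrow> p $ j < q $ j \<Longrightarrow> h p $ j < h q $ j"
  shows "orientation_preserving_on W h"
  unfolding orientation_preserving_on_def
proof (intro ballI allI impI)
  fix p :: "real^2" and \<rho> :: real
  assume p: "p \<in> W" and \<rho>: "0 < \<rho>" and sub: "cball p \<rho> \<subseteq> W"
  define P where "P = plane_to_complex"
  define Q where "Q = complex_to_plane"
  have PQ: "P (Q z) = z" for z
    by (simp add: P_def Q_def plane_to_complex_def complex_to_plane_def)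
  have P_diff: "P (q - q') = P q - P q'" for q q'
    by (simp add: P_def plane_to_complex_def complex_eq_iff)
  have norm_P: "norm (P q) = norm q" for q
    by (simp add: P_def plane_to_complex_def cmod_def norm_vec_def L2_set_def UNIV_2)
  have P_scale: "P (c *\<^sub>R q) = c *\<^sub>R P q" for c q
    by (simp add: P_def plane_to_complex_def complex_eq_iff)
  have P_add: "P (q + q') = P q + P q'" for q q'
    by (simp add: P_def plane_to_complex_def complex_eq_iff)
  have P_zero: "P q = 0 \<longleftrightarrow> q = 0" for q
    using norm_P[of q] by (metis norm_eq_zero)
  have cont_P: "continuous_on S P" for S
    unfolding P_def plane_to_complex_def Complex_eq by (intro continuous_intros)
  have QP: "Q (P q) = q" for q
    using P_diff[of "Q (P q)" q] PQ[of "P q"] P_zero[of "Q (P q) - q"] by simp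
  have cont_Q: "continuous_on S Q" for S
  proof -
    have "Q z = Re z *\<^sub>R axis 1 1 + Im z *\<^sub>R axis 2 1" for z
      by (simp add: Q_def complex_to_plane_def vec_eq_iff forall_2 axis_def)
    then have "Q = (\<lambda>z. Re z *\<^sub>R axis 1 1 + Im z *\<^sub>R axis 2 1)" by (rule ext)
    then show ?thesis by (simp only:) (intro continuous_intros)
  qed
  let ?c = "circlepath (P p) \<rho>"
  define q where "q t = Q (?c t)" for t
  have Pq: "P (q t) = ?c t" for t by (simp add: q_def PQ)
  have q_dist: "dist p (q t) = \<rho>" for t
  proof -
    have "norm (P (q t - p)) = \<rho>"
      using \<rho> by (simp add: P_diff Pq circlepath norm_mult)
    then show ?thesis by (simp add: norm_P dist_norm norm_minus_commute)
  qed
  have qW: "q t \<in> W" and qp: "q t \<noteq> p" for t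
    using q_dist[of t] sub \<rho> by auto
  have cont_q: "continuous_on {0..1} q"
    unfolding q_def by (rule continuous_on_compose2[OF cont_Q[of UNIV]])
      (use path_circlepath[of "P p" \<rho>] in \<open>auto simp: path_def\<close>)
  have q_loop: "q 1 = q 0"
    using pathfinish_circlepath[of "P p" \<rho>] pathstart_circlepath[of "P p" \<rho>]
    by (simp add: q_def pathfinish_def pathstart_def circlepath)
  define \<gamma> where "\<gamma> t = P (h (q t))" for t
  have path_\<gamma>: "path \<gamma>"
    unfolding path_def \<gamma>_def
    by (intro continuous_on_compose2[OF cont_P[of UNIV]] continuous_on_compose2[OF cont cont_q])
       (use qW in auto)
  have "winding_number (\<lambda>t. \<gamma> t - P (h p)) 0 = winding_number (\<lambda>t. ?c t - P p) 0"
  proof (rule winding_number_loops_linear_eq)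
    show "path (\<lambda>t. ?c t - P p)" "path (\<lambda>t. \<gamma> t - P (h p))"
      using path_circlepath[of "P p" \<rho>] path_\<gamma> unfolding path_def
      by (auto intro!: continuous_intros)
    show "pathfinish (\<lambda>t. ?c t - P p) = pathstart (\<lambda>t. ?c t - P p)"
      using Pq q_loop unfolding pathfinish_def pathstart_def by metis
    show "pathfinish (\<lambda>t. \<gamma> t - P (h p)) = pathstart (\<lambda>t. \<gamma> t - P (h p))"
      unfolding pathfinish_def pathstart_def \<gamma>_def q_loop ..
    \<comment> \<open>The linear homotopy never meets the centre.\<close>
    show "0 \<notin> closed_segment (?c t - P p) (\<gamma> t - P (h p))" for t
    proof
      assume "0 \<in> closed_segment (?c t - P p) (\<gamma> t - P (h p))"
      then obtain v where v: "0 \<le> v" "v \<le> 1"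
        "0 = (1 - v) *\<^sub>R (?c t - P p) + v *\<^sub>R (\<gamma> t - P (h p))"
        by (auto simp: in_segment)
      have "P ((1 - v) *\<^sub>R (q t - p) + v *\<^sub>R (h (q t) - h p)) = 0"
        using v(3) by (simp add: P_add P_scale P_diff Pq \<gamma>_def)
      then have zero: "(1 - v) *\<^sub>R (q t - p) + v *\<^sub>R (h (q t) - h p) = 0"
        by (simp only: P_zero)
      have comp: "(1 - v) * (q t $ k - p $ k) + v * (h (q t) $ k - h p $ k) = 0" for k
        using arg_cong[OF zero, of "\<lambda>x. x $ k"] by simp
      have "q t $ i = p $ i"
        using comp[of i] h_i[OF qW[of t]] h_i[OF p] by (simp add: algebra_simps)
      moreover from this have "q t $ j \<noteq> p $ j" using qp[of t] by (simp add: plane_eq_iff)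
      ultimately have "(0 < q t $ j - p $ j \<and> 0 < h (q t) $ j - h p $ j) \<or>
          (q t $ j - p $ j < 0 \<and> h (q t) $ j - h p $ j < 0)"
        using mono[OF p qW[of t]] mono[OF qW[of t] p] by (auto simp: neq_iff)
      moreover have pos: "0 < (1 - v) * b + v * c" if "0 < b" "0 < c" for b c :: real
        using that v(1,2) by (cases "v = 0") (auto intro!: add_nonneg_pos)
      ultimately show False
        using comp[of j] pos[of "q t $ j - p $ j" "h (q t) $ j - h p $ j"]
          pos[of "- (q t $ j - p $ j)" "- (h (q t) $ j - h p $ j)"] by (auto simp: algebra_simps)
    qed
  qed
  also have "\<dots> = winding_number ?c (P p)"
    by (rule winding_number_offset[symmetric])
  also have "\<dots> = 1"
    using \<rho> by (simp add: winding_number_circlepath_centre)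
  finally have "winding_number \<gamma> (P (h p)) = 1"
    by (simp only: winding_number_offset[of \<gamma> "P (h p)"])
  moreover have "plane_to_complex \<circ> h \<circ> complex_to_plane \<circ> circlepath (plane_to_complex p) \<rho> = \<gamma>"
    by (simp add: fun_eq_iff \<gamma>_def q_def P_def Q_def)
  ultimately show "winding_number
      (plane_to_complex \<circ> h \<circ> complex_to_plane \<circ> circlepath (plane_to_complex p) \<rho>)
      (plane_to_complex (h p)) = 1"
    by (simp add: P_def)
qed

end

context integrable_system
begin

text \<open>
  The constant system has the label \<open>\<bar>y\<bar> - \<bar>x\<bar>\<close>, so the image point is the one with the same \<open>x\<close>, on the
  same side of \<open>y = 0\<close>, whose label for the constant system is \<open>label p\<close>.
\<close>

definition straighten :: vfield where
  "straighten p = pt i (p $ i) (sgn (p $ j) * (\<bar>p $ i\<bar> + label p))"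

lemma straighten_i [simp]: "straighten p $ i = p $ i"
  by (simp add: straighten_def)

text \<open>
  On closed quadrants the formula also holds on the axes, where different choices of the quadrant
  give the same value.  Continuity follows by gluing four closed pieces.
\<close>

lemma straighten_on_quadrant:
  assumes p: "p \<in> W" and e: "\<bar>e1\<bar> = 1" "\<bar>e2\<bar> = 1" and q: "0 \<le> e1 * p $ i" "0 \<le> e2 * p $ j"
  shows "straighten p $ j = e2 * (\<bar>p $ i\<bar> + C e1 e2 \<bar>p $ i\<bar> \<bar>p $ j\<bar>)"
proof (cases "p $ j = 0")
  case True
  then show ?thesis
    using C_x_axis[OF e, of "\<bar>p $ i\<bar>"] W_bounded[OF p] by (simp add: straighten_def)
next
  case False
  then have "sgn (p $ j) = e2" using q(2) e(2) by (auto simp: sgn_if abs_if zero_le_mult_iff split: if_splits)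
  then show ?thesis using label_eq[OF e(1) q(1) False] by (simp add: straighten_def)
qed

lemma straighten_pos:
  assumes p: "p \<in> W" and "p $ j \<noteq> 0"
  shows "0 < \<bar>p $ i\<bar> + label p"
  using C_strict_mono[of "sign (p $ i)" "sign (p $ j)" "\<bar>p $ i\<bar>" 0 "\<bar>p $ j\<bar>"]
    C_x_axis[of "sign (p $ i)" "sign (p $ j)" "\<bar>p $ i\<bar>"] W_bounded[OF p] assms(2)
  by (simp add: label_def)

lemma sgn_straighten: "p \<in> W \<Longrightarrow> sgn (straighten p $ j) = sgn (p $ j)"
  using straighten_pos[of p] by (cases "p $ j = 0") (auto simp: straighten_def sgn_mult)

lemma straighten_strict_mono:
  assumes pq: "p \<in> W" "q \<in> W" "p $ i = q $ i" "p $ j < q $ j"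
  shows "straighten p $ j < straighten q $ j"
proof -
  define e1 where "e1 = sign (p $ i)"
  have e1: "\<bar>e1\<bar> = 1" "0 \<le> e1 * p $ i" "0 \<le> e1 * q $ i"
    using pq(3) by (auto simp: e1_def sign_def)
  have xd: "\<bar>p $ i\<bar> \<in> {0..d}" using W_bounded[OF pq(1)] by simp
  consider "0 \<le> p $ j" | "q $ j \<le> 0" | "p $ j < 0" "0 < q $ j" by linarith
  then show ?thesis
  proof cases
    case 1
    then show ?thesis
      using straighten_on_quadrant[OF pq(1) e1(1), of 1] straighten_on_quadrant[OF pq(2) e1(1), of 1]
        C_strict_mono[OF e1(1), of 1, OF _ xd, of "p $ j" "q $ j"] e1 pq(3,4) by simp
  next
    case 2
    then show ?thesis
      using straighten_on_quadrant[OF pq(1) e1(1), of "- 1"] straighten_on_quadrant[OF pq(2) e1(1), of "- 1"]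
        C_strict_mono[OF e1(1), of "- 1", OF _ xd, of "- q $ j" "- p $ j"] e1 pq(3,4) by simp
  next
    case 3
    then have "straighten p $ j < 0" "0 < straighten q $ j"
      using sgn_straighten[OF pq(1)] sgn_straighten[OF pq(2)] by (metis sgn_less, metis sgn_greater)
    then show ?thesis by simp
  qed
qed

lemma straighten_inj: "inj_on straighten W"
proof (rule inj_onI)
  fix p q assume pq: "p \<in> W" "q \<in> W" "straighten p = straighten q"
  then have i: "p $ i = q $ i" by (metis straighten_i)
  have "p $ j = q $ j"
    using straighten_strict_mono[OF pq(1,2) i] straighten_strict_mono[OF pq(2,1) i[symmetric]] pq(3)
    by (cases "p $ j" "q $ j" rule: linorder_cases) auto
  then show "p = q" using i by (simp add: plane_eq_iff)
qed

lemma straighten_continuous: "continuous_on W straighten"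
proof -
  define S where "S e1 e2 = W \<inter> {p. 0 \<le> e1 * p $ i} \<inter> {p. 0 \<le> e2 * p $ j}" for e1 e2
  have quadrant: "continuous_on (S e1 e2) (\<lambda>p. straighten p $ j)" if e: "\<bar>e1\<bar> = 1" "\<bar>e2\<bar> = 1" for e1 e2
  proof -
    have "continuous_on (S e1 e2) (\<lambda>p. (\<bar>p $ i\<bar>, \<bar>p $ j\<bar>))"
      by (intro continuous_intros)
    then have "continuous_on (S e1 e2) (\<lambda>p. case (\<bar>p $ i\<bar>, \<bar>p $ j\<bar>) of (x, y) \<Rightarrow> C e1 e2 x y)"
      by (rule continuous_on_compose2[OF C_continuous[OF e]]) (use W_bounded in \<open>auto simp: S_def\<close>)
    then have "continuous_on (S e1 e2) (\<lambda>p. e2 * (\<bar>p $ i\<bar> + C e1 e2 \<bar>p $ i\<bar> \<bar>p $ j\<bar>))"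
      by (intro continuous_intros) simp
    then show ?thesis
      by (rule continuous_on_eq) (use straighten_on_quadrant e in \<open>auto simp: S_def\<close>)
  qed
  have "continuous_on W (\<lambda>p. straighten p $ j)"
  proof (rule continuous_on_sign_split[where \<phi> = "\<lambda>p. p $ i"])
    show "continuous_on (W \<inter> {p. 0 \<le> p $ i}) (\<lambda>p. straighten p $ j)"
    proof (rule continuous_on_sign_split[where \<phi> = "\<lambda>p. p $ j"])
      show "continuous_on (W \<inter> {p. 0 \<le> p $ i} \<inter> {p. 0 \<le> p $ j}) (\<lambda>p. straighten p $ j)"
        using quadrant[of 1 1] by (simp add: S_def)
      show "continuous_on (W \<inter> {p. 0 \<le> p $ i} \<inter> {p. p $ j \<le> 0}) (\<lambda>p. straighten p $ j)"
        using quadrant[of 1 "- 1"] by (simp add: S_def)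
    qed (intro continuous_intros)
    show "continuous_on (W \<inter> {p. p $ i \<le> 0}) (\<lambda>p. straighten p $ j)"
    proof (rule continuous_on_sign_split[where \<phi> = "\<lambda>p. p $ j"])
      show "continuous_on (W \<inter> {p. p $ i \<le> 0} \<inter> {p. 0 \<le> p $ j}) (\<lambda>p. straighten p $ j)"
        using quadrant[of "- 1" 1] by (simp add: S_def)
      show "continuous_on (W \<inter> {p. p $ i \<le> 0} \<inter> {p. p $ j \<le> 0}) (\<lambda>p. straighten p $ j)"
        using quadrant[of "- 1" "- 1"] by (simp add: S_def)
    qed (intro continuous_intros)
  qed (intro continuous_intros)
  then have "continuous_on W (\<lambda>p. pt i (p $ i) (straighten p $ j))"
    by (intro continuous_on_pt continuous_on_component[OF continuous_on_id])
  then show ?thesis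
    by (rule continuous_on_eq) (simp add: plane_eq_iff)
qed

lemma straighten_homeomorphism:
  obtains g where "open (straighten ` W)" "homeomorphism W (straighten ` W) straighten g"
proof -
  have "open (straighten ` W)"
    using invariance_of_domain_gen[OF W_open straighten_continuous straighten_inj] by simp
  then show thesis
    using invariance_of_domain_homeomorphism[OF W_open straighten_continuous _ straighten_inj] that by blast
qed

end

section \<open>Equivalence with the constant system\<close>

lemma solves_unit_slope_iff:
  assumes I: "is_interval I"
  shows "solves (\<lambda>_ _. 1) I y \<longleftrightarrow> (\<forall>p\<in>I. \<forall>q\<in>I. y p - p = y q - q)"
proof
  assume S: "solves (\<lambda>_ _. 1) I y"
  show "\<forall>p\<in>I. \<forall>q\<in>I. y p - p = y q - q"
  proof (intro ballI)
    fix p q assume pq: "p \<in> I" "q \<in> I"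
    show "y p - p = y q - q"
    proof (rule constant_on_interval_except[OF I _ _ pq])
      show "continuous_on I (\<lambda>x. y x - x)"
        using S by (auto simp: solves_def intro!: continuous_intros)
      show "((\<lambda>x. y x - x) has_real_derivative 0) (at x within I)" if "x \<in> I" "x \<noteq> 0" for x
      proof -
        have "(y has_real_derivative 1) (at x within I)" using S that by (auto simp: solves_def)
        from DERIV_diff[OF this DERIV_ident] show ?thesis by simp
      qed
    qed
  qed
next
  assume const: "\<forall>p\<in>I. \<forall>q\<in>I. y p - p = y q - q"
  show "solves (\<lambda>_ _. 1) I y"
  proof (cases "I = {}")
    case False
    then obtain p where p: "p \<in> I" by blast
    have y: "x + (y p - p) = y x" if "x \<in> I" for x
      using bspec[OF bspec[OF const that] p] by linarith
    show ?thesis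
      unfolding solves_def
    proof (intro conjI ballI)
      have "continuous_on I (\<lambda>x. x + (y p - p))" by (intro continuous_intros)
      then show "continuous_on I y" by (rule continuous_on_eq) (rule y)
      fix x assume "x \<in> I - {0}"
      then have x: "x \<in> I" by simp
      have "((\<lambda>x. x + (y p - p)) has_real_derivative 1 + 0) (at x within I)"
        by (intro derivative_intros)
      then have "((\<lambda>x. x + (y p - p)) has_real_derivative 1) (at x within I)" by simp
      then show "(y has_real_derivative 1) (at x within I)"
        by (rule has_field_derivative_transform_within[where d = 1]) (use x y in auto)
    qed
  qed (simp add: solves_def)
qed

lemma (in axes) constant_system:
  assumes a: "a = 1 \<or> a = - 1" and W: "open W" "0 \<in> W" "\<And>p. p \<in> W \<Longrightarrow> \<bar>p $ i\<bar> \<le> d"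
  shows "integrable_system i j a W (\<lambda>_. pt i a a) (\<lambda>_. pt i a (- a))
    (\<lambda>_ _ _ _. 1) (\<lambda>_ _ x y. y - x) d"
proof -
  interpret T: transversal_system i j a W "\<lambda>_. pt i a a" "\<lambda>_. pt i a (- a)"
    by unfold_locales (use a W in auto)
  show ?thesis
  proof unfold_locales
    show "1 = sgn (p $ i) * sgn (p $ j) * (a * T.slope p)" if "p \<in> W" "p $ i \<noteq> 0" "p $ j \<noteq> 0" for p
    proof -
      have "a * T.slope p = sgn (p $ i * p $ j)"
        using that a by (auto simp: T.slope_def T.velocity_def sgn_if)
      then have "a * T.slope p = sgn (p $ i) * sgn (p $ j)" by (simp only: sgn_mult)
      moreover have "sgn (p $ i) = 1 \<or> sgn (p $ i) = - 1" "sgn (p $ j) = 1 \<or> sgn (p $ j) = - 1"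
        using that by (simp_all add: sgn_if)
      ultimately show ?thesis by (elim disjE) simp_all
    qed
    show "continuous_on ({0..d} \<times> {0..}) (\<lambda>(x, y). y - x)"
      by (simp add: case_prod_unfold) (intro continuous_intros)
  qed (use W solves_unit_slope_iff in auto)
qed

context integrable_system
begin

text \<open>
  The neighbourhood is shrunk once more after the map is known, so that the image lies in the given
  domain.  The labels, and hence the map, stay the same.
\<close>

lemma restrict:
  assumes "open W'" "0 \<in> W'" "W' \<subseteq> W"
  shows "integrable_system i j a W' X Y f C d"
proof -
  note sub = subsetD[OF assms(3)]
  interpret T: transversal_system i j a W' X Y
    by unfold_locales (use assms(1,2) a X_i[OF sub] X_j[OF sub] Y_i[OF sub] Y_j[OF sub]
      continuous_on_subset[OF X_cont assms(3)] continuous_on_subset[OF Y_cont assms(3)] in auto)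
  show ?thesis
    by unfold_locales
      (fact W_bounded[OF sub] f_slope[OF sub] C_solves C_y_axis C_x_axis C_strict_mono C_continuous)+
qed

text \<open>
  The label of \<open>straighten p\<close> for the constant system is the label of \<open>p\<close>, so constancy of one along
  a graph is constancy of the other along the image graph.
\<close>

lemma locally_equivalent_to_constant:
  assumes U: "W \<subseteq> U" "straighten ` W \<subseteq> U"
  shows "locally_Sigma_equivalent U (X, Y) (\<lambda>_. pt i a a, \<lambda>_. pt i a (- a))"
proof -
  obtain g where V: "open (straighten ` W)" and homeo: "homeomorphism W (straighten ` W) straighten g"
    by (rule straighten_homeomorphism)
  have g: "g (straighten p) = p" "continuous_on (straighten ` W) g" if "p \<in> W" for p
    using homeo that by (auto simp: homeomorphism_def)
  have straighten_0: "straighten 0 = 0"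
    by (simp add: plane_eq_iff straighten_def)
  then have V0: "0 \<in> straighten ` W" using W_0 by (metis imageI)
  interpret B: integrable_system i j a "straighten ` W" "\<lambda>_. pt i a a" "\<lambda>_. pt i a (- a)"
    "\<lambda>_ _ _ _. 1" "\<lambda>_ _ x y. y - x" d
    by (rule constant_system) (use a V V0 W_bounded in auto)
  interpret two: two_transversal_systems i j a W "straighten ` W" X Y "\<lambda>_. pt i a a" "\<lambda>_. pt i a (- a)" ..
  have graphs: "orbit_graph I y \<longleftrightarrow> B.orbit_graph I y'"
    if H: "\<And>s. s \<in> I \<Longrightarrow> pt i (a * s) (y s) \<in> W \<and> straighten (pt i (a * s) (y s)) = pt i (a * s) (y' s)"
    for I y y'
  proof -
    have y': "y' s = straighten (pt i (a * s) (y s)) $ j" if "s \<in> I" for s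
      using H[OF that] by simp
    have y: "y s = g (pt i (a * s) (y' s)) $ j" if "s \<in> I" for s
      using g(1)[of "pt i (a * s) (y s)"] H[OF that] by simp
    have V: "pt i (a * s) (y' s) \<in> straighten ` W" if "s \<in> I" for s
      using H[OF that] by (metis imageI)
    have sgn_eq: "sgn (y' s) = sgn (y s)" if "s \<in> I" for s
      using sgn_straighten[of "pt i (a * s) (y s)"] H[OF that] by simp
    have label_eq: "B.label (pt i (a * s) (y' s)) = label (pt i (a * s) (y s))"
      if s: "s \<in> I" "y s \<noteq> 0" for s
    proof -
      define l where "l = \<bar>a * s\<bar> + label (pt i (a * s) (y s))"
      have "0 < l"
        using straighten_pos[OF conjunct1[OF H[OF s(1)]]] s(2) by (simp only: l_def pt_nth simp_thms)
      moreover have "y' s = sgn (y s) * l"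
        using y'[OF s(1)] by (simp only: l_def straighten_def pt_nth)
      ultimately have "\<bar>y' s\<bar> = l" using s(2) by (simp add: abs_mult abs_sgn_eq)
      then show ?thesis by (simp add: B.label_def l_def)
    qed
    have cont: "continuous_on I y \<longleftrightarrow> continuous_on I y'"
    proof
      assume "continuous_on I y"
      then have "continuous_on I (\<lambda>s. straighten (pt i (a * s) (y s)) $ j)"
        using H by (intro continuous_on_component continuous_on_compose2[OF straighten_continuous]
            continuous_on_pt continuous_intros) auto
      then show "continuous_on I y'" by (rule continuous_on_eq) (simp add: y')
    next
      assume "continuous_on I y'"
      then have "continuous_on I (\<lambda>s. g (pt i (a * s) (y' s)) $ j)"
        using V by (intro continuous_on_component continuous_on_compose2[OF g(2)[OF W_0]]
            continuous_on_pt continuous_intros) auto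
      then show "continuous_on I y" by (rule continuous_on_eq) (simp add: y)
    qed
    have sgn_const: "(\<forall>s\<in>I. \<forall>t\<in>I. sgn (y s) = sgn (y t)) \<longleftrightarrow> (\<forall>s\<in>I. \<forall>t\<in>I. sgn (y' s) = sgn (y' t))"
      by (simp add: sgn_eq)
    have nz: "y' s \<noteq> 0 \<longleftrightarrow> y s \<noteq> 0" if "s \<in> I" for s
      using sgn_eq[OF that] by (metis sgn_zero_iff)
    have labels: "(\<forall>s\<in>I. \<forall>t\<in>I. y s \<noteq> 0 \<longrightarrow> label (pt i (a * s) (y s)) = label (pt i (a * t) (y t))) \<longleftrightarrow>
        (\<forall>s\<in>I. \<forall>t\<in>I. y' s \<noteq> 0 \<longrightarrow> B.label (pt i (a * s) (y' s)) = B.label (pt i (a * t) (y' t)))"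
      if const: "\<forall>s\<in>I. \<forall>t\<in>I. sgn (y s) = sgn (y t)"
    proof -
      have "(y s \<noteq> 0 \<longrightarrow> label (pt i (a * s) (y s)) = label (pt i (a * t) (y t))) \<longleftrightarrow>
          (y' s \<noteq> 0 \<longrightarrow> B.label (pt i (a * s) (y' s)) = B.label (pt i (a * t) (y' t)))"
        if st: "s \<in> I" "t \<in> I" for s t
      proof (cases "y s = 0")
        case True
        then show ?thesis using nz[OF st(1)] by simp
      next
        case False
        then have "y t \<noteq> 0" using const st by (metis sgn_zero_iff)
        then show ?thesis using label_eq[OF st(1) False] label_eq[OF st(2)] nz[OF st(1)] by simp
      qed
      then show ?thesis by (intro ball_cong refl)
    qed
    show ?thesis
      unfolding orbit_graph_iff_label B.orbit_graph_iff_label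
      using cont sgn_const labels H V by blast
  qed
  have Sig: "straighten ` Sig W = Sig (straighten ` W)"
  proof -
    have "straighten p $ 1 * straighten p $ 2 = 0 \<longleftrightarrow> p $ 1 * p $ 2 = 0" if "p \<in> W" for p
      using sgn_straighten[OF that] by (simp add: product_components) (metis sgn_zero_iff)
    then show ?thesis by (auto simp: Sig_def)
  qed
  have "\<exists>J' \<gamma>' \<tau>. trajectory (straighten ` W) (\<lambda>_. pt i a a) (\<lambda>_. pt i a (- a)) J' \<gamma>' \<and>
      strict_mono_on J \<tau> \<and> \<tau> ` J = J' \<and> (\<forall>t\<in>J. straighten (\<gamma> t) = \<gamma>' (\<tau> t))"
    if "trajectory W X Y J \<gamma>" for J \<gamma>
    by (rule two.trajectory_transfer[OF homeo straighten_i graphs that]) blast+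
  moreover have "orientation_preserving_on W straighten"
    by (rule orientation_preserving_of_monotone[OF straighten_continuous straighten_i straighten_strict_mono])
  ultimately show ?thesis
    unfolding locally_Sigma_equivalent_def fst_conv snd_conv
    using W_open W_0 U V V0 homeo Sig by blast
qed

end

section \<open>Continuously differentiable fields near the origin\<close>

lemma Cr_on_open_imp_continuous: "Cr_on_open k S f \<Longrightarrow> continuous_on S f"
  by (cases k) (auto intro: continuous_at_imp_continuous_on differentiable_imp_continuous_within)

text \<open>The derivative is bounded on a small closed ball, so the mean value inequality applies.\<close>

lemma Cr_on_locally_lipschitz:
  assumes f: "Cr_on r S f" "r \<ge> 1" and U: "open U" "U \<subseteq> S" "0 \<in> U"
  obtains \<rho> K where "0 < \<rho>" "0 \<le> K" "ball 0 \<rho> \<subseteq> U"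
    "\<And>p q. p \<in> ball 0 \<rho> \<Longrightarrow> q \<in> ball 0 \<rho> \<Longrightarrow> norm (f p - f q) \<le> K * norm (p - q)"
proof -
  obtain V F where V: "open V" "S \<subseteq> V" and F: "Cr_on_open r V F" and eq: "\<And>x. x \<in> S \<Longrightarrow> F x = f x"
    using f(1) by (auto simp: Cr_on_def)
  obtain k where "r = Suc k" using f(2) by (cases r) auto
  then have diff: "\<And>x. x \<in> V \<Longrightarrow> F differentiable (at x)"
    and "\<And>v. Cr_on_open k V (\<lambda>x. frechet_derivative F (at x) v)"
    using F by auto
  then have cont: "continuous_on V (\<lambda>x. frechet_derivative F (at x) v)" for v
    using Cr_on_open_imp_continuous by blast
  obtain \<rho> where \<rho>: "0 < \<rho>" "cball 0 \<rho> \<subseteq> U"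
    using U open_contains_cball by blast
  have "\<exists>B. \<forall>x\<in>cball 0 \<rho>. norm (frechet_derivative F (at x) v) \<le> B" for v
  proof -
    have "cball 0 \<rho> \<subseteq> V" using \<rho>(2) U(2) V(2) by (meson subset_trans)
    then have "continuous_on (cball 0 \<rho>) (\<lambda>x. frechet_derivative F (at x) v)"
      by (rule continuous_on_subset[OF cont])
    then have "bounded ((\<lambda>x. frechet_derivative F (at x) v) ` cball 0 \<rho>)"
      by (intro compact_imp_bounded compact_continuous_image) auto
    then show ?thesis by (auto simp: bounded_iff)
  qed
  then obtain B where B: "\<And>v x. x \<in> cball 0 \<rho> \<Longrightarrow> norm (frechet_derivative F (at x) v) \<le> B v"
    by metis
  define K where "K = B (axis 1 1) + B (axis 2 1)"
  have B0: "0 \<le> B v" for v using B[of 0 v] \<rho>(1) by (meson centre_in_cball norm_ge_zero order_less_imp_le order_trans)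
  show thesis
  proof (rule that)
    show "0 < \<rho>" by fact
    show "0 \<le> K" using B0 by (simp add: K_def)
    show "ball 0 \<rho> \<subseteq> U" using \<rho>(2) ball_subset_cball by blast
    fix p q assume pq: "p \<in> ball (0::real^2) \<rho>" "q \<in> ball (0::real^2) \<rho>"
    have "norm (F p - F q) \<le> K * norm (p - q)"
    proof (rule differentiable_bound[OF convex_ball _ _ pq])
      fix x :: "real^2" assume x: "x \<in> ball 0 \<rho>"
      then have xc: "x \<in> cball 0 \<rho>" by auto
      then have "x \<in> V" using \<rho>(2) U(2) V(2) by blast
      then have D: "(F has_derivative frechet_derivative F (at x)) (at x)"
        using diff frechet_derivative_works by blast
      then show "(F has_derivative frechet_derivative F (at x)) (at x within ball 0 \<rho>)"
        by (rule has_derivative_at_withinI)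
      have lin: "linear (frechet_derivative F (at x))"
        using D has_derivative_linear by blast
      show "onorm (frechet_derivative F (at x)) \<le> K"
      proof (rule onorm_bound)
        show "0 \<le> K" by fact
        fix h :: "real^2"
        have "h = (h $ 1) *\<^sub>R axis 1 1 + (h $ 2) *\<^sub>R axis 2 1"
          by (simp add: vec_eq_iff forall_2 axis_def)
        then have "frechet_derivative F (at x) h =
            frechet_derivative F (at x) ((h $ 1) *\<^sub>R axis 1 1 + (h $ 2) *\<^sub>R axis 2 1)"
          by (rule arg_cong)
        also have "\<dots> = (h $ 1) *\<^sub>R frechet_derivative F (at x) (axis 1 1) +
            (h $ 2) *\<^sub>R frechet_derivative F (at x) (axis 2 1)"
          by (simp only: linear_add[OF lin] linear_scale[OF lin])
        also have "norm \<dots> \<le> \<bar>h $ 1\<bar> * norm (frechet_derivative F (at x) (axis 1 1)) +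
            \<bar>h $ 2\<bar> * norm (frechet_derivative F (at x) (axis 2 1))"
          by (rule norm_triangle_le) simp
        also have "\<dots> \<le> norm h * B (axis 1 1) + norm h * B (axis 2 1)"
          by (intro add_mono mult_mono B[OF xc] component_le_norm_cart) auto
        finally show "norm (frechet_derivative F (at x) h) \<le> K * norm h"
          by (simp add: K_def algebra_simps)
      qed
    qed
    moreover have "p \<in> S" "q \<in> S" using pq \<rho>(2) U(2) ball_subset_cball by blast+
    ultimately show "norm (f p - f q) \<le> K * norm (p - q)" using eq by simp
  qed
qed

lemma quotient_lipschitz:
  fixes u v u' v' :: real
  assumes "0 < \<mu>" "\<mu> \<le> \<bar>u\<bar>" "\<mu> \<le> \<bar>u'\<bar>" "\<bar>u'\<bar> \<le> B" "\<bar>v'\<bar> \<le> B" "\<bar>v - v'\<bar> \<le> \<delta>" "\<bar>u - u'\<bar> \<le> \<delta>"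
  shows "\<bar>v / u - v' / u'\<bar> \<le> 2 * B * \<delta> / (\<mu> * \<mu>)"
proof -
  have nz: "u \<noteq> 0" "u' \<noteq> 0" using assms by auto
  then have "v / u - v' / u' = ((v - v') * u' + v' * (u' - u)) / (u * u')"
    by (simp add: field_simps)
  then have "\<bar>v / u - v' / u'\<bar> = \<bar>(v - v') * u' + v' * (u' - u)\<bar> / (\<bar>u\<bar> * \<bar>u'\<bar>)"
    by (simp add: abs_divide abs_mult)
  also have "\<dots> \<le> (2 * B * \<delta>) / (\<mu> * \<mu>)"
  proof (rule frac_le)
    have "\<bar>(v - v') * u'\<bar> \<le> \<delta> * B" "\<bar>v' * (u' - u)\<bar> \<le> B * \<delta>"
      unfolding abs_mult using assms by (auto intro!: mult_mono simp: abs_minus_commute)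
    then have "\<bar>(v - v') * u' + v' * (u' - u)\<bar> \<le> \<delta> * B + B * \<delta>"
      by (intro order_trans[OF abs_triangle_ineq] add_mono)
    then show "\<bar>(v - v') * u' + v' * (u' - u)\<bar> \<le> 2 * B * \<delta>" by (simp add: mult_ac)
    then show "0 \<le> 2 * B * \<delta>" by (meson abs_ge_zero order_trans)
    show "0 < \<mu> * \<mu>" using assms(1) by simp
    show "\<mu> * \<mu> \<le> \<bar>u\<bar> * \<bar>u'\<bar>" using assms by (intro mult_mono) auto
  qed
  finally show ?thesis .
qed

text \<open>
  On a small ball the quotient of the two components of \<open>X\<close> and its negative for \<open>Y\<close> are positive,
  bounded and Lipschitz continuous.  Clamping the coordinates to \<open>{0..\<eta>}\<close> extends it to the whole plane with the same
  bounds, as the scalar theory requires; on the ball of radius \<open>d \<le> \<eta>\<close> nothing has been changed.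
\<close>

lemma (in axes) equivalent_to_constant_system:
  fixes X Y :: vfield
  assumes U: "open U" "0 < \<rho>" "ball 0 \<rho> \<subseteq> U" and K: "0 \<le> K"
    and X_lip: "\<And>p q. p \<in> ball 0 \<rho> \<Longrightarrow> q \<in> ball 0 \<rho> \<Longrightarrow> norm (X p - X q) \<le> K * norm (p - q)"
    and Y_lip: "\<And>p q. p \<in> ball 0 \<rho> \<Longrightarrow> q \<in> ball 0 \<rho> \<Longrightarrow> norm (Y p - Y q) \<le> K * norm (p - q)"
    and a: "a = 1 \<or> a = - 1"
    and signs: "0 < a * X 0 $ i" "0 < a * X 0 $ j" "0 < a * Y 0 $ i" "a * Y 0 $ j < 0"
  shows "locally_Sigma_equivalent U (X, Y) (\<lambda>_. pt i a a, \<lambda>_. pt i a (- a))"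
proof -
  \<comment> \<open>Half of the smallest absolute value of a component at the origin.  On the ball of
      radius \<open>\<rho>'\<close> no component varies by more than \<open>\<mu>\<close>.\<close>
  define \<mu> where "\<mu> = min (min (a * X 0 $ i) (a * X 0 $ j)) (min (a * Y 0 $ i) (- (a * Y 0 $ j))) / 2"
  have \<mu>: "0 < \<mu>" and \<mu>0: "2 * \<mu> \<le> a * X 0 $ i" "2 * \<mu> \<le> a * X 0 $ j" "2 * \<mu> \<le> a * Y 0 $ i"
    "2 * \<mu> \<le> - (a * Y 0 $ j)"
    using signs by (auto simp: \<mu>_def)
  define \<rho>' where "\<rho>' = min \<rho> (\<mu> / (K + 1))"
  have \<rho>': "0 < \<rho>'" "\<rho>' \<le> \<rho>" using U(2) \<mu> K by (auto simp: \<rho>'_def)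
  have ball_sub: "p \<in> ball 0 \<rho>" if "p \<in> ball 0 \<rho>'" for p :: "real^2"
    using that \<rho>'(2) by auto
  have aa: "\<bar>a\<bar> = 1" using a by auto
  have near: "\<bar>F p $ k - F 0 $ k\<bar> \<le> \<mu>"
    if F: "\<And>p q. p \<in> ball 0 \<rho> \<Longrightarrow> q \<in> ball 0 \<rho> \<Longrightarrow> norm (F p - F q) \<le> K * norm (p - q)"
      and p: "p \<in> ball 0 \<rho>'" for F :: vfield and p k
  proof -
    have "\<bar>F p $ k - F 0 $ k\<bar> \<le> norm (F p - F 0)"
      using component_le_norm_cart[of "F p - F 0" k] by simp
    also have "\<dots> \<le> K * norm p"
      using F[OF ball_sub[OF p], of 0] U(2) by simp
    also have "\<dots> \<le> (K + 1) * (\<mu> / (K + 1))"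
      using p K by (intro mult_mono) (auto simp: \<rho>'_def)
    also have "\<dots> = \<mu>" using K by simp
    finally show ?thesis .
  qed
  define B where "B = norm (X 0) + norm (Y 0) + \<mu>"
  have a_near: "\<bar>a * F p $ k - a * F 0 $ k\<bar> = \<bar>F p $ k - F 0 $ k\<bar>" for F :: vfield and p k
    using aa by (simp flip: right_diff_distrib add: abs_mult)
  have X: "\<mu> \<le> a * X p $ i" "\<mu> \<le> a * X p $ j" "\<bar>X p $ k\<bar> \<le> B" if p: "p \<in> ball 0 \<rho>'" for p k
  proof -
    show "\<mu> \<le> a * X p $ i" using near[of X p i, OF X_lip p] a_near[of X p i] \<mu>0(1) by linarith
    show "\<mu> \<le> a * X p $ j" using near[of X p j, OF X_lip p] a_near[of X p j] \<mu>0(2) by linarith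
    show "\<bar>X p $ k\<bar> \<le> B"
      using near[of X p k, OF X_lip p] component_le_norm_cart[of "X 0" k] norm_ge_zero[of "Y 0"]
      unfolding B_def by linarith
  qed
  have Y: "\<mu> \<le> a * Y p $ i" "a * Y p $ j \<le> - \<mu>" "\<bar>Y p $ k\<bar> \<le> B" if p: "p \<in> ball 0 \<rho>'" for p k
  proof -
    show "\<mu> \<le> a * Y p $ i" using near[of Y p i, OF Y_lip p] a_near[of Y p i] \<mu>0(3) by linarith
    show "a * Y p $ j \<le> - \<mu>" using near[of Y p j, OF Y_lip p] a_near[of Y p j] \<mu>0(4) by linarith
    show "\<bar>Y p $ k\<bar> \<le> B"
      using near[of Y p k, OF Y_lip p] component_le_norm_cart[of "Y 0" k] norm_ge_zero[of "X 0"]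
      unfolding B_def by linarith
  qed
  have cont: "continuous_on (ball 0 \<rho>') F"
    if F: "\<And>p q. p \<in> ball 0 \<rho> \<Longrightarrow> q \<in> ball 0 \<rho> \<Longrightarrow> norm (F p - F q) \<le> K * norm (p - q)" for F :: vfield
    by (rule lipschitz_on_continuous_on[of K], rule lipschitz_onI)
       (use F ball_sub K in \<open>auto simp: dist_norm\<close>)
  \<comment> \<open>The square of half side \<open>\<eta>\<close> is contained in the ball of radius \<open>\<rho>'\<close>\<close>
  define \<eta> where "\<eta> = \<rho>' / 3"
  have \<eta>: "0 < \<eta>" using \<rho>' by (simp add: \<eta>_def)
  define cl where "cl x = max 0 (min \<eta> x)" for x
  have cl: "0 \<le> cl x" "cl x \<le> \<eta>" "0 \<le> x \<Longrightarrow> x \<le> \<eta> \<Longrightarrow> cl x = x" "\<bar>cl x - cl y\<bar> \<le> \<bar>x - y\<bar>" for x y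
    using \<eta> by (auto simp: cl_def)
  define F where "F e1 e2 = (if 0 < e1 * e2 then X else Y)" for e1 e2 :: real
  define q where "q e1 e2 x y = pt i (e1 * cl x) (e2 * cl y)" for e1 e2 x y
  define f where "f e1 e2 x y = e1 * e2 * (F e1 e2 (q e1 e2 x y) $ j / F e1 e2 (q e1 e2 x y) $ i)"
    for e1 e2 x y
  have q_ball: "q e1 e2 x y \<in> ball 0 \<rho>'" if "\<bar>e1\<bar> = 1" "\<bar>e2\<bar> = 1" for e1 e2 x y
  proof -
    have "norm (q e1 e2 x y) \<le> \<bar>e1 * cl x\<bar> + \<bar>e2 * cl y\<bar>"
      unfolding q_def pt_eq_axes by (rule norm_triangle_le) simp
    also have "\<dots> \<le> \<eta> + \<eta>"
      using that cl(1,2) by (intro add_mono) (auto simp: abs_mult)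
    also have "\<dots> < \<rho>'" using \<rho>' by (simp add: \<eta>_def)
    finally show ?thesis by simp
  qed
  have F_lip: "norm (F e1 e2 p - F e1 e2 p') \<le> K * norm (p - p')"
    if "p \<in> ball 0 \<rho>'" "p' \<in> ball 0 \<rho>'" for e1 e2 p p'
    using X_lip Y_lip ball_sub that by (simp add: F_def)
  have F_bounds: "\<mu> \<le> a * F e1 e2 p $ i" "\<mu> \<le> \<bar>F e1 e2 p $ i\<bar>" "\<bar>F e1 e2 p $ k\<bar> \<le> B"
    if p: "p \<in> ball 0 \<rho>'" for e1 e2 p k
  proof -
    show 1: "\<mu> \<le> a * F e1 e2 p $ i" "\<bar>F e1 e2 p $ k\<bar> \<le> B"
      using X[OF p] Y[OF p] by (auto simp: F_def)
    have "a * F e1 e2 p $ i \<le> \<bar>a * F e1 e2 p $ i\<bar>" by simp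
    then show "\<mu> \<le> \<bar>F e1 e2 p $ i\<bar>" using 1(1) by (simp add: abs_mult aa)
  qed
  define M where "M = B / \<mu>"
  define L where "L = 2 * B * K / (\<mu> * \<mu>)"
  have B0: "0 \<le> B" using \<mu> by (simp add: B_def)
  have L0: "0 \<le> L" unfolding L_def using B0 K \<mu> by (intro divide_nonneg_pos) auto
  define d where "d = min \<eta> (1 / (4 * (L + 1)))"
  have d: "0 < d" "d \<le> \<eta>" "L * d \<le> 1 / 4"
  proof -
    show "0 < d" "d \<le> \<eta>" using \<eta> L0 by (auto simp: d_def)
    have "L * d \<le> (L + 1) * (1 / (4 * (L + 1)))"
      using L0 \<eta> by (intro mult_mono) (auto simp: d_def)
    also have "\<dots> = 1 / 4" using L0 by simp
    finally show "L * d \<le> 1 / 4" .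
  qed
  \<comment> \<open>The factor \<open>e1 * e2\<close> in \<open>f\<close> is \<open>1\<close> where \<open>X\<close> applies and \<open>- 1\<close> where \<open>Y\<close> does, which makes \<open>f\<close> positive.\<close>
  have ode: "positive_scalar_ode (f e1 e2) M L d" if e: "\<bar>e1\<bar> = 1" "\<bar>e2\<bar> = 1" for e1 e2
  proof
    have cont_q: "continuous_on UNIV (\<lambda>z. q e1 e2 (fst z) (snd z))"
      unfolding q_def cl_def by (intro continuous_intros)
    have "continuous_on (ball 0 \<rho>') (F e1 e2)"
      using cont[OF X_lip] cont[OF Y_lip] by (simp add: F_def)
    then have cont_F: "continuous_on UNIV (\<lambda>z. F e1 e2 (q e1 e2 (fst z) (snd z)) $ k)" for k
      by (intro continuous_on_component continuous_on_compose2[OF _ cont_q]) (use q_ball e in auto)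
    have nz: "F e1 e2 (q e1 e2 x y) $ i \<noteq> 0" for x y
      using F_bounds(2)[OF q_ball[OF e, of x y], of e1 e2] \<mu> by auto
    show "continuous_on UNIV (\<lambda>(x, y). f e1 e2 x y)"
      unfolding f_def case_prod_unfold
      by (intro continuous_on_mult continuous_on_const continuous_on_divide cont_F) (use nz in auto)
    have f_abs: "\<bar>f e1 e2 x y\<bar> = \<bar>F e1 e2 (q e1 e2 x y) $ j\<bar> / \<bar>F e1 e2 (q e1 e2 x y) $ i\<bar>" for x y
      by (simp add: f_def abs_mult e)
    show "\<bar>f e1 e2 x y\<bar> \<le> M" for x y
      unfolding f_abs M_def using F_bounds(2,3)[OF q_ball[OF e]] \<mu> B0 by (intro frac_le) auto
    show "\<bar>f e1 e2 x y - f e1 e2 x z\<bar> \<le> L * \<bar>y - z\<bar>" for x y z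
    proof -
      let ?p = "q e1 e2 x y" and ?q = "q e1 e2 x z"
      have "?p - ?q = pt i 0 (e2 * (cl y - cl z))"
        by (simp add: plane_eq_iff q_def right_diff_distrib)
      then have "norm (?p - ?q) = \<bar>cl y - cl z\<bar>"
        by (simp add: pt_eq_axes abs_mult e)
      then have "norm (?p - ?q) \<le> \<bar>y - z\<bar>" using cl(4) by simp
      then have "norm (F e1 e2 ?p - F e1 e2 ?q) \<le> K * \<bar>y - z\<bar>"
        using F_lip[OF q_ball[OF e] q_ball[OF e]] K by (meson mult_left_mono order_trans)
      then have *: "\<bar>F e1 e2 ?p $ k - F e1 e2 ?q $ k\<bar> \<le> K * \<bar>y - z\<bar>" for k
        using component_le_norm_cart[of "F e1 e2 ?p - F e1 e2 ?q" k] by simp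
      have "f e1 e2 x y - f e1 e2 x z = e1 * e2 *
          (F e1 e2 ?p $ j / F e1 e2 ?p $ i - F e1 e2 ?q $ j / F e1 e2 ?q $ i)"
        by (simp add: f_def right_diff_distrib)
      then have "\<bar>f e1 e2 x y - f e1 e2 x z\<bar> =
          \<bar>F e1 e2 ?p $ j / F e1 e2 ?p $ i - F e1 e2 ?q $ j / F e1 e2 ?q $ i\<bar>"
        by (simp add: abs_mult e)
      also have "\<dots> \<le> 2 * B * (K * \<bar>y - z\<bar>) / (\<mu> * \<mu>)"
        by (intro quotient_lipschitz \<mu> F_bounds(2,3) q_ball e *)
      also have "\<dots> = L * \<bar>y - z\<bar>" by (simp add: L_def)
      finally show ?thesis .
    qed
    show "0 < d" "L * d \<le> 1 / 4" by (fact d)+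
    show "0 < f e1 e2 x y" for x y
    proof -
      let ?p = "q e1 e2 x y"
      have quot: "F e1 e2 ?p $ j / F e1 e2 ?p $ i = (a * F e1 e2 ?p $ j) / (a * F e1 e2 ?p $ i)"
        using a by auto
      have e': "e1 * e2 = 1 \<or> e1 * e2 = - 1"
        using e by (auto simp: abs_if split: if_splits)
      have pos: "0 < a * F e1 e2 ?p $ i"
        using F_bounds(1)[OF q_ball[OF e, of x y], of e1 e2] \<mu> by linarith
      have f_eq: "f e1 e2 x y = e1 * e2 * ((a * F e1 e2 ?p $ j) / (a * F e1 e2 ?p $ i))"
        by (simp only: f_def quot)
      from e' show ?thesis
      proof
        assume *: "e1 * e2 = 1"
        then have "0 < a * F e1 e2 ?p $ j"
          using X(2)[OF q_ball[OF e, of x y]] \<mu> by (simp add: F_def)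
        from divide_pos_pos[OF this pos] show ?thesis unfolding f_eq * by (simp only: mult_1_left)
      next
        assume *: "e1 * e2 = - 1"
        then have "a * F e1 e2 ?p $ j < 0"
          using Y(2)[OF q_ball[OF e, of x y]] \<mu> by (simp add: F_def)
        from divide_neg_pos[OF this pos] show ?thesis
          unfolding f_eq * by (simp only: mult_minus1 neg_0_less_iff_less)
      qed
    qed
  qed
  define C where "C e1 e2 = positive_scalar_ode.orbit_label (f e1 e2) d" for e1 e2
  have d_ball: "p \<in> ball 0 \<rho>'" if "p \<in> ball 0 d" for p :: "real^2"
    using that d(2) \<rho>' by (auto simp: \<eta>_def)
  interpret T: transversal_system i j a "ball 0 d" X Y
  proof
    show "continuous_on (ball 0 d) X" "continuous_on (ball 0 d) Y"
      using cont[OF X_lip] cont[OF Y_lip] d_ball by (auto intro: continuous_on_subset)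
    fix p :: "real^2" assume "p \<in> ball 0 d"
    then have "p \<in> ball 0 \<rho>'" by (rule d_ball)
    from X(1,2)[OF this] Y(1,2)[OF this] \<mu>
    show "0 < a * X p $ i" "0 < a * X p $ j" "0 < a * Y p $ i" "a * Y p $ j < 0" by linarith+
  qed (use a d in auto)
  interpret S: integrable_system i j a "ball 0 d" X Y f C d
  proof
    show "\<bar>p $ i\<bar> \<le> d" if "p \<in> ball 0 d" for p
      using component_le_norm_cart[of p i] that by simp
    show "f (sgn (p $ i)) (sgn (p $ j)) \<bar>p $ i\<bar> \<bar>p $ j\<bar> = sgn (p $ i) * sgn (p $ j) * (a * T.slope p)"
      if p: "p \<in> ball 0 d" "p $ i \<noteq> 0" "p $ j \<noteq> 0" for p
    proof -
      have "\<bar>p $ i\<bar> \<le> \<eta>" "\<bar>p $ j\<bar> \<le> \<eta>"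
        using component_le_norm_cart[of p i] component_le_norm_cart[of p j] p(1) d(2) by auto
      then have "q (sgn (p $ i)) (sgn (p $ j)) \<bar>p $ i\<bar> \<bar>p $ j\<bar> = p"
        by (simp add: q_def cl(3) sgn_mult_abs)
      moreover have "F (sgn (p $ i)) (sgn (p $ j)) p = T.velocity p"
        using p by (simp add: F_def T.velocity_def flip: sgn_mult)
      moreover have "a * T.slope p = T.velocity p $ j / T.velocity p $ i"
        by (simp add: T.slope_def)
      ultimately show ?thesis by (simp only: f_def)
    qed
    fix e1 e2 :: real assume e: "\<bar>e1\<bar> = 1" "\<bar>e2\<bar> = 1"
    interpret P: positive_scalar_ode "f e1 e2" M L d by (rule ode[OF e])
    have C: "C e1 e2 = P.orbit_label" by (simp add: C_def)
    show "solves (f e1 e2) I y \<longleftrightarrow> (\<forall>p\<in>I. \<forall>q\<in>I. C e1 e2 p (y p) = C e1 e2 q (y q))"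
      if "is_interval I" "I \<subseteq> {0..d}" "\<And>x. x \<in> I \<Longrightarrow> 0 \<le> y x" for I y
      unfolding C by (rule P.solves_iff_orbit_label[OF that])
    show "C e1 e2 0 y0 = y0" if "0 \<le> y0" for y0
      unfolding C by (rule P.orbit_label_y_axis[OF that])
    show "C e1 e2 x0 0 = - x0" if "x0 \<in> {0..d}" for x0
      unfolding C by (rule P.orbit_label_x_axis[OF that])
    show "C e1 e2 x0 y1 < C e1 e2 x0 y2" if "x0 \<in> {0..d}" "0 \<le> y1" "y1 < y2" for x0 y1 y2
      unfolding C by (rule P.orbit_label_strict_mono[OF that])
    show "continuous_on ({0..d} \<times> {0..}) (\<lambda>(x, y). C e1 e2 x y)"
      unfolding C by (rule P.orbit_label_continuous)
  qed
  \<comment> \<open>The image has to stay inside \<open>U\<close> as well\<close>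
  define W where "W = ball 0 d \<inter> S.straighten -` U"
  have "S.straighten 0 = 0" by (simp add: plane_eq_iff S.straighten_def)
  then have W: "open W" "0 \<in> W" "W \<subseteq> ball 0 d"
    using continuous_open_preimage[OF S.straighten_continuous open_ball U(1)] d(1) U(2,3)
    by (auto simp: W_def)
  interpret R: integrable_system i j a W X Y f C d
    by (rule S.restrict[OF W])
  show ?thesis
  proof (rule R.locally_equivalent_to_constant)
    show "W \<subseteq> U" using W(3) d_ball ball_sub U(3) by blast
    show "S.straighten ` W \<subseteq> U" by (auto simp: W_def)
  qed
qed

theorem proposition3p12:
  fixes U :: "(real^2) set" and X Y :: "real^2 \<Rightarrow> real^2" and r :: nat and i j :: 2
    and a b :: real
  assumes "r \<ge> 1"
    and "open U" and "bounded U" and "0 \<in> U"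
    and "(X, Y) \<in> Omega r U"
    and "i \<noteq> j"
    and "X 0 $ i * Y 0 $ i > 0"
    and "X 0 $ j * Y 0 $ j < 0"
    and "X 0 $ 1 * X 0 $ 2 > 0"
    and "a = sgn (X 0 $ 1)" and "b = sgn (Y 0 $ 1)"
  shows "locally_Sigma_equivalent U (X, Y) (\<lambda>_. vector [a, a], \<lambda>_. vector [b, - b])"
proof -
  interpret axes i j by unfold_locales fact
  have Cr: "Cr_on r (closure U) X" "Cr_on r (closure U) Y"
    using assms(5) by (auto simp: Omega_def)
  obtain \<rho>1 K1 where X: "0 < \<rho>1" "0 \<le> K1" "ball 0 \<rho>1 \<subseteq> U"
    "\<And>p q. p \<in> ball 0 \<rho>1 \<Longrightarrow> q \<in> ball 0 \<rho>1 \<Longrightarrow> norm (X p - X q) \<le> K1 * norm (p - q)"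
    using Cr_on_locally_lipschitz[OF Cr(1) assms(1,2) closure_subset assms(4)] by blast
  obtain \<rho>2 K2 where Y: "0 < \<rho>2" "0 \<le> K2" "ball 0 \<rho>2 \<subseteq> U"
    "\<And>p q. p \<in> ball 0 \<rho>2 \<Longrightarrow> q \<in> ball 0 \<rho>2 \<Longrightarrow> norm (Y p - Y q) \<le> K2 * norm (p - q)"
    using Cr_on_locally_lipschitz[OF Cr(2) assms(1,2) closure_subset assms(4)] by blast
  have axes_12: "(i = 1 \<and> j = 2) \<or> (i = 2 \<and> j = 1)"
    using assms(6) exhaust_2[of i] exhaust_2[of j] by metis
  have X_pos: "0 < X 0 $ i * X 0 $ j" using assms(9) by (simp only: product_components)
  have a_cases: "a = 1 \<or> a = - 1"
    using assms(9,10) by (auto simp: sgn_if)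
  have a_X: "0 < a * X 0 $ k" for k
  proof -
    have "0 < a * X 0 $ 1" "0 < a * X 0 $ 2"
      using assms(9,10) by (auto simp: sgn_if zero_less_mult_iff)
    then show ?thesis using exhaust_2[of k] by metis
  qed
  have a_a: "(a * x) * (a * y) = x * y" for x y using a_cases by auto
  have a_Y: "0 < a * Y 0 $ i" "a * Y 0 $ j < 0"
    using assms(7) a_X[of i] assms(8) a_X[of j] a_a
    by (metis zero_less_mult_pos, metis mult_less_0_iff not_less_iff_gr_or_eq)
  \<comment> \<open>The sign \<open>b\<close> belongs to the first coordinate: it is \<open>a\<close> if that is the crossing
      coordinate \<open>i\<close>, and \<open>- a\<close> otherwise.\<close>
  have field_X: "vector [a, a] = pt i a a"
    unfolding plane_eq_iff using axes_12 by (elim disjE conjE) (simp_all add: pt_def)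
  have field_Y: "vector [b, - b] = pt i a (- a)"
  proof -
    have "b = (if i = 1 then a else - a)"
      using axes_12 a_Y a_cases unfolding assms(11) by (elim disjE conjE) (auto simp: sgn_if)
    then show ?thesis
      unfolding plane_eq_iff using axes_12 by (elim disjE conjE) (simp_all add: pt_def)
  qed
  define \<rho> where "\<rho> = min \<rho>1 \<rho>2"
  define K where "K = max K1 K2"
  show ?thesis
    unfolding field_X field_Y
  proof (rule equivalent_to_constant_system)
    show "open U" "0 < \<rho>" "ball 0 \<rho> \<subseteq> U" "0 \<le> K"
      using assms(2) X(1-3) Y(1) by (auto simp: \<rho>_def K_def)
    fix p q :: "real^2" assume pq: "p \<in> ball 0 \<rho>" "q \<in> ball 0 \<rho>"
    show "norm (X p - X q) \<le> K * norm (p - q)"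
      using X(4)[of p q] pq mult_right_mono[of K1 K "norm (p - q)"] by (simp add: \<rho>_def K_def)
    show "norm (Y p - Y q) \<le> K * norm (p - q)"
      using Y(4)[of p q] pq mult_right_mono[of K2 K "norm (p - q)"] by (simp add: \<rho>_def K_def)
  qed (use a_cases a_X a_Y in auto)
qed

end
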